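(* Let $A\in M_d(\{0,1\})$ be aperiodic, let $\beta\in\mathbb{R}$, and let $a\in C(\Lambda_A)\subset\mathcal{O}_A$ be self-adjoint. The map $$\omega\mapsto\mu:=\omega\restriction_{C(\Lambda_A)}$$ sets up a surjective correspondence from the set of $(\alpha^{\beta,a},1)$-KMS states of $\mathcal{O}_A$ onto the set of probability measures $\mu$ on $\Lambda_A$ for which $\mathcal{L}_a^*\mu=e^\beta\mu$. If in addition $\mathrm{var}_0(a)<\log r(A)$, where $r(A)$ is the spectral radius of $A$, this map is a bijection.
   Context: $A$ is aperiodic if some power $A^N$ has all entries positive. $\mathcal{O}_A$ is the universal $C^*$-algebra generated by partial isometries $s_1,\dots,s_d$ with $\sum_is_is_i^*=I$, $s_i^*s_i=\sum_jA_{ij}s_js_j^*$. $\Lambda_A=\{(x_k)_{k\in\mathbb{N}}\in\{1,\dots,d\}^{\mathbb{N}}:A_{x_kx_{k+1}}=1\ \forall k\}$; $C(\Lambda_A)$ is identified with the $C^*$-subalgebra of $\mathcal{O}_A$ generated by the projections $s_{i_1}\cdots s_{i_r}(s_{i_1}\cdots s_{i_r})^*$ (characteristic functions of the cylinders $\{x:x_1=i_1,\dots,x_r=i_r\}$). $\alpha^{\beta,a}$ is the one-parameter automorphism group of $\mathcal{O}_A$ determined by $\alpha^{\beta,a}_t(s_i)=e^{it(\beta-a)}s_i$, $i=1,\dots,d$. A state $\omega$ is $(\alpha^{\beta,a},1)$-KMS (KMS at inverse temperature $1$) if $\omega(bc)=\omega(\alpha^{\beta,a}_{-i}(c)\,b)$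 for all $b\in\mathcal{O}_A$ and all analytic elements $c$. The Ruelle operator on $C(\Lambda_A)$ is $\mathcal{L}_a(f)(x)=\sum_{i:A_{ix_1}=1}e^{a(ix)}f(ix)$, where $ix=(i,x_1,x_2,\dots)$; $\mathcal{L}_a^*$ is its Banach space adjoint on $C(\Lambda_A)^*$. $\mathrm{var}_0(a)=\max a-\min a$. *)

theory Defs
  imports
    "HOL-Probability.Probability"
    "HOL-Library.Poly_Mapping"
    "Jordan_Normal_Form.Spectral_Radius"
begin

section \<open>Unital C*-algebras\<close>

text \<open>The distribution only has real normed algebras, so complex scalars and the involution are
  added here. The superclass \<open>real_normed_algebra_1\<close> excludes the zero algebra.\<close>

class unital_cstar_algebra = real_normed_algebra_1 + banach +
  fixes scaleC :: "complex \<Rightarrow> 'a \<Rightarrow> 'a" (infixr \<open>*\<^sub>C\<close> 75)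
    and adj :: "'a \<Rightarrow> 'a"
  assumes scaleC_add_right: "c *\<^sub>C (x + y) = c *\<^sub>C x + c *\<^sub>C y"
    and scaleC_add_left: "(b + c) *\<^sub>C x = b *\<^sub>C x + c *\<^sub>C x"
    and scaleC_scaleC: "b *\<^sub>C (c *\<^sub>C x) = (b * c) *\<^sub>C x"
    and scaleC_of_real: "complex_of_real r *\<^sub>C x = r *\<^sub>R x"
    and mult_scaleC_left: "(c *\<^sub>C x) * y = c *\<^sub>C (x * y)"
    and mult_scaleC_right: "x * (c *\<^sub>C y) = c *\<^sub>C (x * y)"
    and norm_scaleC: "norm (c *\<^sub>C x) = cmod c * norm x"
    and adj_adj: "adj (adj x) = x"
    and adj_add: "adj (x + y) = adj x + adj y"
    and adj_scaleC: "adj (c *\<^sub>C x) = cnj c *\<^sub>C adj x"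
    and adj_mult: "adj (x * y) = adj y * adj x"
    and cstar_identity: "norm (adj x * x) = (norm x)\<^sup>2"

definition star_hom :: "('a::unital_cstar_algebra \<Rightarrow> 'b::unital_cstar_algebra) \<Rightarrow> bool" where
  "star_hom \<phi> \<longleftrightarrow>
     (\<forall>x y. \<phi> (x + y) = \<phi> x + \<phi> y) \<and> (\<forall>c x. \<phi> (c *\<^sub>C x) = c *\<^sub>C \<phi> x) \<and>
     (\<forall>x y. \<phi> (x * y) = \<phi> x * \<phi> y) \<and> (\<forall>x. \<phi> (adj x) = adj (\<phi> x)) \<and> \<phi> 1 = 1"

definition cstar_subalgebra :: "'a::unital_cstar_algebra set \<Rightarrow> bool" where
  "cstar_subalgebra B \<longleftrightarrow>
     0 \<in> B \<and> (\<forall>x\<in>B. \<forall>y\<in>B. x + y \<in> B \<and> x * y \<in> B) \<and>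
     (\<forall>c. \<forall>x\<in>B. c *\<^sub>C x \<in> B) \<and> (\<forall>x\<in>B. adj x \<in> B) \<and> closed B"

definition cstar_generated :: "'a::unital_cstar_algebra set \<Rightarrow> 'a set" where
  "cstar_generated S = \<Inter>{B. cstar_subalgebra B \<and> S \<subseteq> B}"

definition partial_isometry :: "'a::unital_cstar_algebra \<Rightarrow> bool" where
  "partial_isometry v \<longleftrightarrow> v * adj v * v = v"

text \<open>A positive functional on a unital C*-algebra attains its norm at \<open>1\<close>, so the normalisation
  of a state is \<open>\<omega> 1 = 1\<close>.\<close>

definition state :: "('a::unital_cstar_algebra \<Rightarrow> complex) \<Rightarrow> bool" where
  "state \<omega> \<longleftrightarrow>
     (\<forall>x y. \<omega> (x + y) = \<omega> x + \<omega> y) \<and> (\<forall>c x. \<omega> (c *\<^sub>C x) = c * \<omega> x) \<and>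
     (\<forall>x. \<omega> (adj x * x) \<in> \<real>\<^sub>\<ge>\<^sub>0) \<and> \<omega> 1 = 1"


section \<open>The free unital *-algebra on generators \<open>x\<^sub>0, x\<^sub>1, \<dots>\<close>\<close>

text \<open>Words in the letters \<open>x\<^sub>i\<close>, encoded as \<open>(i, False)\<close>, and \<open>x\<^sub>i\<^sup>*\<close>, encoded as \<open>(i, True)\<close>.
  They form a monoid under concatenation, written additively because the convolution product
  of \<open>Poly_Mapping\<close> is set up for additive exponents.\<close>

datatype star_word = Word (letters: "(nat \<times> bool) list")

instantiation star_word :: monoid_add
begin
definition "0 = Word []"
definition "v + w = Word (letters v @ letters w)"
instance
proof
  fix u v w :: star_word
  show "u + v + w = u + (v + w)" by (simp add: plus_star_word_def)
  show "0 + v = v" by (simp add: plus_star_word_def zero_star_word_def)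
  show "v + 0 = v" by (simp add: plus_star_word_def zero_star_word_def)
qed
end

type_synonym star_poly = "star_word \<Rightarrow>\<^sub>0 complex"

definition gen :: "nat \<Rightarrow> star_poly" where
  "gen i = Poly_Mapping.single (Word [(i, False)]) 1"

definition word_adj :: "star_word \<Rightarrow> star_word" where
  "word_adj w = Word (rev (map (\<lambda>(i, b). (i, \<not> b)) (letters w)))"

definition poly_adj :: "star_poly \<Rightarrow> star_poly" where
  "poly_adj p = (\<Sum>w\<in>Poly_Mapping.keys p.
     Poly_Mapping.single (word_adj w) (cnj (Poly_Mapping.lookup p w)))"

definition word_eval :: "(nat \<Rightarrow> 'a::unital_cstar_algebra) \<Rightarrow> star_word \<Rightarrow> 'a" where
  "word_eval s w = prod_list (map (\<lambda>(i, b). if b then adj (s i) else s i) (letters w))"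

definition poly_eval :: "(nat \<Rightarrow> 'a::unital_cstar_algebra) \<Rightarrow> star_poly \<Rightarrow> 'a" where
  "poly_eval s p = (\<Sum>w\<in>Poly_Mapping.keys p. Poly_Mapping.lookup p w *\<^sub>C word_eval s w)"

definition star_polys :: "nat \<Rightarrow> star_poly set" where
  "star_polys d = {p. \<forall>w\<in>Poly_Mapping.keys p. fst ` set (letters w) \<subseteq> {..<d}}"

definition cstar_seminorm :: "(star_poly \<Rightarrow> real) \<Rightarrow> bool" where
  "cstar_seminorm q \<longleftrightarrow>
     (\<forall>p. 0 \<le> q p) \<and>
     (\<forall>p p'. q (p + p') \<le> q p + q p') \<and>
     (\<forall>c p. q (Poly_Mapping.single 0 c * p) = cmod c * q p) \<and>
     (\<forall>p p'. q (p * p') \<le> q p * q p') \<and>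
     (\<forall>p. q (poly_adj p * p) = (q p)\<^sup>2)"


section \<open>Cuntz-Krieger algebras\<close>

definition zero_one_mat :: "nat mat \<Rightarrow> bool" where
  "zero_one_mat A \<longleftrightarrow> elements_mat A \<subseteq> {0, 1}"

text \<open>The power has to be a proper one: for \<open>d = 1\<close> the zeroth power is always positive.\<close>

definition aperiodic :: "nat mat \<Rightarrow> bool" where
  "aperiodic A \<longleftrightarrow> (\<exists>N>0. \<forall>i<dim_row A. \<forall>j<dim_row A. 0 < (A ^\<^sub>m N) $$ (i, j))"

definition cuntz_krieger_family :: "nat mat \<Rightarrow> (nat \<Rightarrow> 'a::unital_cstar_algebra) \<Rightarrow> bool" where
  "cuntz_krieger_family A s \<longleftrightarrow>
     (\<forall>i<dim_row A. partial_isometry (s i)) \<and>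
     (\<Sum>i<dim_row A. s i * adj (s i)) = 1 \<and>
     (\<forall>i<dim_row A. adj (s i) * s i = (\<Sum>j<dim_row A. of_nat (A $$ (i, j)) * (s j * adj (s j))))"

definition cuntz_krieger_relators :: "nat mat \<Rightarrow> star_poly set" where
  "cuntz_krieger_relators A =
     {gen i * poly_adj (gen i) * gen i - gen i | i. i < dim_row A} \<union>
     {(\<Sum>i<dim_row A. gen i * poly_adj (gen i)) - 1} \<union>
     {poly_adj (gen i) * gen i - (\<Sum>j<dim_row A. of_nat (A $$ (i, j)) * (gen j * poly_adj (gen j))) | i.
        i < dim_row A}"

text \<open>The type \<open>'a\<close> together with \<open>s\<close> is the universal C*-algebra of the Cuntz-Krieger relations:
  \<open>s\<close> satisfies the relations and generates \<open>'a\<close>, and the norm of \<open>'a\<close> dominates, hence is the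
  largest of, all C*-seminorms on the free *-algebra that vanish on the relators. Seminorms are
  used because a formula cannot quantify over the types carrying the C*-algebras that receive
  homomorphisms; see \<open>cuntz_krieger_universal_property\<close> below for the usual formulation.\<close>

definition universal_cuntz_krieger :: "nat mat \<Rightarrow> (nat \<Rightarrow> 'a::unital_cstar_algebra) \<Rightarrow> bool" where
  "universal_cuntz_krieger A s \<longleftrightarrow>
     cuntz_krieger_family A s \<and>
     cstar_generated (s ` {..<dim_row A}) = UNIV \<and>
     (\<forall>q. cstar_seminorm q \<and> (\<forall>r\<in>cuntz_krieger_relators A. q r = 0) \<longrightarrow>
        (\<forall>p\<in>star_polys (dim_row A). q p \<le> norm (poly_eval s p)))"

lemma poly_eval_superset:
  assumes "finite F" "Poly_Mapping.keys p \<subseteq> F"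
  shows "poly_eval s p = (\<Sum>w\<in>F. Poly_Mapping.lookup p w *\<^sub>C word_eval s w)"
  unfolding poly_eval_def
proof (rule sum.mono_neutral_left)
  show "\<forall>w\<in>F - Poly_Mapping.keys p. Poly_Mapping.lookup p w *\<^sub>C word_eval s w = 0"
    using scaleC_of_real[of 0] by (auto simp: in_keys_iff)
qed (use assms in auto)

lemma scaleC_zero_left: "0 *\<^sub>C (x::'a::unital_cstar_algebra) = 0"
  using scaleC_of_real[of 0 x] by simp

lemma scaleC_one: "1 *\<^sub>C (x::'a::unital_cstar_algebra) = x"
  using scaleC_of_real[of 1 x] by simp

lemma scaleC_zero_right: "c *\<^sub>C (0::'a::unital_cstar_algebra) = 0"
  using scaleC_add_right[of c 0 "0::'a"] by simp

lemma adj_zero: "adj (0::'a::unital_cstar_algebra) = 0"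
  using adj_add[of 0 "0::'a"] by simp

lemma adj_one: "adj (1::'a::unital_cstar_algebra) = 1"
  by (metis adj_adj adj_mult mult.left_neutral mult.right_neutral)

lemma adj_sum: "adj (sum f F) = (\<Sum>x\<in>F. adj (f x :: 'a::unital_cstar_algebra))"
  by (induction F rule: infinite_finite_induct) (auto simp: adj_zero adj_add)

lemma norm_adj: "norm (adj x) = norm (x::'a::unital_cstar_algebra)"
proof -
  have le: "norm y \<le> norm (adj y)" for y :: 'a
  proof (cases "y = 0")
    case False
    have "norm y * norm y \<le> norm (adj y) * norm y"
      using cstar_identity[of y] norm_mult_ineq[of "adj y" y] by (simp add: power2_eq_square)
    with False show ?thesis by simp
  qed simp
  from le[of x] le[of "adj x"] show ?thesis by (simp add: adj_adj)
qed

lemma poly_eval_add: "poly_eval s (p + p') = poly_eval s p + poly_eval s p'"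
proof -
  let ?F = "Poly_Mapping.keys p \<union> Poly_Mapping.keys p'"
  have "poly_eval s (p + p') = (\<Sum>w\<in>?F. Poly_Mapping.lookup (p + p') w *\<^sub>C word_eval s w)"
    by (rule poly_eval_superset) (use Poly_Mapping.keys_add[of p p'] in auto)
  also have "\<dots> = (\<Sum>w\<in>?F. Poly_Mapping.lookup p w *\<^sub>C word_eval s w)
      + (\<Sum>w\<in>?F. Poly_Mapping.lookup p' w *\<^sub>C word_eval s w)"
    by (simp add: lookup_add scaleC_add_left sum.distrib)
  finally show ?thesis
    by (simp add: poly_eval_superset[of ?F, symmetric])
qed

lemma poly_eval_zero: "poly_eval s 0 = 0"
  by (simp add: poly_eval_def)

lemma poly_eval_sum: "poly_eval s (sum f F) = (\<Sum>x\<in>F. poly_eval s (f x))"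
  by (induction F rule: infinite_finite_induct) (auto simp: poly_eval_zero poly_eval_add)

lemma poly_eval_single: "poly_eval s (Poly_Mapping.single w c) = c *\<^sub>C word_eval s w"
  using poly_eval_superset[of "{w}" "Poly_Mapping.single w c" s] by simp

lemma word_eval_add: "word_eval s (v + w) = word_eval s v * word_eval s w"
  by (simp add: word_eval_def plus_star_word_def)

lemma word_eval_zero: "word_eval s 0 = 1"
  by (simp add: word_eval_def zero_star_word_def)

lemma word_eval_adj: "word_eval s (word_adj w) = adj (word_eval s w)"
proof -
  have "prod_list (map (\<lambda>(i, b). if b then adj (s i) else s i) (rev (map (\<lambda>(i, b). (i, \<not> b)) l)))
     = adj (prod_list (map (\<lambda>(i, b). if b then adj (s i) else s i) l))" for l
    by (induction l) (auto simp: adj_one adj_mult adj_adj)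
  then show ?thesis by (simp add: word_eval_def word_adj_def)
qed

lemma poly_eval_one: "poly_eval s 1 = 1"
  using poly_eval_single[of s 0 1] by (simp add: word_eval_zero scaleC_one)

lemma sum_keys_single: "(\<Sum>w\<in>Poly_Mapping.keys p. Poly_Mapping.single w (Poly_Mapping.lookup p w)) = p"
proof (rule poly_mapping_eqI)
  fix v
  show "Poly_Mapping.lookup (\<Sum>w\<in>Poly_Mapping.keys p. Poly_Mapping.single w (Poly_Mapping.lookup p w)) v
      = Poly_Mapping.lookup p v"
    by (simp add: lookup_sum lookup_single when_def in_keys_iff)
qed

lemma poly_eval_mult: "poly_eval s (p * p') = poly_eval s p * poly_eval s p'"
proof -
  have "p * p' = (\<Sum>v\<in>Poly_Mapping.keys p. Poly_Mapping.single v (Poly_Mapping.lookup p v)) *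
     (\<Sum>w\<in>Poly_Mapping.keys p'. Poly_Mapping.single w (Poly_Mapping.lookup p' w))"
    by (simp add: sum_keys_single)
  also have "\<dots> = (\<Sum>v\<in>Poly_Mapping.keys p. \<Sum>w\<in>Poly_Mapping.keys p'.
     Poly_Mapping.single (v + w) (Poly_Mapping.lookup p v * Poly_Mapping.lookup p' w))"
    by (simp add: sum_product mult_single)
  finally show ?thesis
    by (simp add: poly_eval_sum poly_eval_single poly_eval_def[of s p] poly_eval_def[of s p']
        sum_product word_eval_add mult_scaleC_left mult_scaleC_right scaleC_scaleC mult.commute)
qed

lemma poly_eval_scale: "poly_eval s (Poly_Mapping.single 0 c * p) = c *\<^sub>C poly_eval s p"
  by (simp add: poly_eval_mult poly_eval_single word_eval_zero mult_scaleC_left)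

lemma poly_eval_adj: "poly_eval s (poly_adj p) = adj (poly_eval s p)"
  by (simp add: poly_adj_def poly_eval_sum poly_eval_single poly_eval_def[of s p] adj_sum
      adj_scaleC word_eval_adj)

lemma poly_eval_diff: "poly_eval s (p - p') = poly_eval s p - poly_eval s p'"
  using poly_eval_add[of s "p - p'" p'] by (simp add: algebra_simps)

lemma poly_eval_of_nat: "poly_eval s (of_nat n) = of_nat n"
  by (induction n) (auto simp: poly_eval_zero poly_eval_one poly_eval_add)

lemma poly_eval_gen: "poly_eval s (gen i) = s i"
  by (simp add: gen_def poly_eval_single word_eval_def scaleC_one)

lemma cstar_seminorm_norm_poly_eval: "cstar_seminorm (\<lambda>p. norm (poly_eval s p))"
  by (auto simp: cstar_seminorm_def poly_eval_add poly_eval_scale norm_triangle_ineq norm_scaleC)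
    (simp_all add: poly_eval_mult poly_eval_adj norm_mult_ineq cstar_identity)

lemma cuntz_krieger_family_relators:
  assumes "cuntz_krieger_family A t" "r \<in> cuntz_krieger_relators A"
  shows "poly_eval t r = 0"
  using assms
  by (auto simp: cuntz_krieger_family_def cuntz_krieger_relators_def partial_isometry_def
      poly_eval_diff poly_eval_mult poly_eval_adj poly_eval_gen poly_eval_sum poly_eval_one
      poly_eval_of_nat)

lemma star_polys_zero: "0 \<in> star_polys d"
  by (simp add: star_polys_def)

lemma star_polys_add: "p \<in> star_polys d \<Longrightarrow> p' \<in> star_polys d \<Longrightarrow> p + p' \<in> star_polys d"
  using Poly_Mapping.keys_add[of p p'] by (fastforce simp: star_polys_def)

lemma star_polys_sum: "(\<And>x. x \<in> F \<Longrightarrow> f x \<in> star_polys d) \<Longrightarrow> sum f F \<in> star_polys d"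
  by (induction F rule: infinite_finite_induct) (auto simp: star_polys_zero star_polys_add)

lemma star_polys_single: "fst ` set (letters w) \<subseteq> {..<d} \<Longrightarrow> Poly_Mapping.single w c \<in> star_polys d"
  by (auto simp: star_polys_def)

lemma star_polys_mult: "p \<in> star_polys d \<Longrightarrow> p' \<in> star_polys d \<Longrightarrow> p * p' \<in> star_polys d"
  using keys_mult[of p p'] by (fastforce simp: star_polys_def plus_star_word_def)

lemma star_polys_scale: "p \<in> star_polys d \<Longrightarrow> Poly_Mapping.single 0 c * p \<in> star_polys d"
  by (rule star_polys_mult) (auto intro!: star_polys_single simp: zero_star_word_def)

lemma star_polys_one: "1 \<in> star_polys d"
proof -
  have "Poly_Mapping.single 0 (1::complex) \<in> star_polys d"
    by (rule star_polys_single) (simp add: zero_star_word_def)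
  then show ?thesis by (simp only: single_one)
qed

lemma star_polys_adj: "p \<in> star_polys d \<Longrightarrow> poly_adj p \<in> star_polys d"
  unfolding poly_adj_def
  by (intro star_polys_sum star_polys_single) (fastforce simp: star_polys_def word_adj_def)

lemma star_polys_gen: "i < d \<Longrightarrow> gen i \<in> star_polys d"
  unfolding gen_def by (rule star_polys_single) auto

lemma star_polys_diff: "p \<in> star_polys d \<Longrightarrow> p' \<in> star_polys d \<Longrightarrow> p - p' \<in> star_polys d"
proof -
  assume p: "p \<in> star_polys d" and p': "p' \<in> star_polys d"
  have "p - p' = p + Poly_Mapping.single 0 (-1) * p'"
    by (metis diff_conv_add_uminus mult_minus1 single_one single_uminus)
  then show ?thesis using star_polys_add[OF p star_polys_scale[OF p']] by metis
qed


lemma bounded_linear_adj: "bounded_linear (adj :: 'a::unital_cstar_algebra \<Rightarrow> 'a)"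
proof (rule bounded_linear_intro[where K = 1])
  show "adj (r *\<^sub>R x) = r *\<^sub>R adj x" for r and x :: 'a
    using adj_scaleC[of "complex_of_real r" x] by (simp add: scaleC_of_real)
qed (simp_all add: adj_add norm_adj)

lemma bounded_linear_scaleC: "bounded_linear (\<lambda>x::'a::unital_cstar_algebra. c *\<^sub>C x)"
proof (rule bounded_linear_intro[where K = "cmod c"])
  show "c *\<^sub>C (r *\<^sub>R x) = r *\<^sub>R (c *\<^sub>C x)" for r and x :: 'a
    by (simp add: scaleC_of_real[symmetric] scaleC_scaleC mult.commute)
qed (simp_all add: scaleC_add_right norm_scaleC)

lemma star_hom_diff:
  assumes "star_hom \<phi>" shows "\<phi> (x - y) = \<phi> x - \<phi> y"
proof -
  have "\<phi> (x - y + y) = \<phi> (x - y) + \<phi> y"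
    using assms unfolding star_hom_def by blast
  then show ?thesis by simp
qed

lemma star_hom_poly_eval:
  assumes "star_hom \<phi>" "\<And>i. i < d \<Longrightarrow> \<phi> (s i) = t i" "p \<in> star_polys d"
  shows "\<phi> (poly_eval s p) = poly_eval t p"
proof -
  note h = assms(1)[unfolded star_hom_def]
  have z: "\<phi> 0 = 0" using star_hom_diff[OF assms(1), of 0 0] by simp
  have sm: "\<phi> (sum f F) = (\<Sum>x\<in>F. \<phi> (f x))" for f :: "star_word \<Rightarrow> 'a" and F
    by (induction F rule: infinite_finite_induct) (auto simp: z h)
  have "\<phi> (prod_list (map (\<lambda>(i, b). if b then adj (s i) else s i) l))
      = prod_list (map (\<lambda>(i, b). if b then adj (t i) else t i) l)"
    if "fst ` set l \<subseteq> {..<d}" for l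
    using that by (induction l) (auto simp: h assms(2))
  then have "\<phi> (word_eval s w) = word_eval t w" if "w \<in> Poly_Mapping.keys p" for w
    using that assms(3) by (auto simp: word_eval_def star_polys_def)
  then show ?thesis by (simp add: poly_eval_def sm h)
qed

lemma cstar_subalgebra_closure:
  fixes X :: "'a::unital_cstar_algebra set"
  assumes "0 \<in> X" "\<And>x y. x \<in> X \<Longrightarrow> y \<in> X \<Longrightarrow> x + y \<in> X" "\<And>x y. x \<in> X \<Longrightarrow> y \<in> X \<Longrightarrow> x * y \<in> X"
    "\<And>c x. x \<in> X \<Longrightarrow> c *\<^sub>C x \<in> X" "\<And>x. x \<in> X \<Longrightarrow> adj x \<in> X"
  shows "cstar_subalgebra (closure X)"
  unfolding cstar_subalgebra_def
proof (intro conjI ballI allI)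
  show "0 \<in> closure X" using assms(1) closure_subset by blast
  fix x y assume "x \<in> closure X" "y \<in> closure X"
  then obtain u v where u: "\<And>n. u n \<in> X" "u \<longlonglongrightarrow> x" and v: "\<And>n. v n \<in> X" "v \<longlonglongrightarrow> y"
    unfolding closure_sequential by blast
  show "x + y \<in> closure X" unfolding closure_sequential
    by (rule exI[of _ "\<lambda>n. u n + v n"]) (auto intro: assms(2) u v tendsto_add)
  show "x * y \<in> closure X" unfolding closure_sequential
    by (rule exI[of _ "\<lambda>n. u n * v n"]) (auto intro: assms(3) u v tendsto_mult)
next
  fix c x assume "x \<in> closure X"
  then obtain u where u: "\<And>n. u n \<in> X" "u \<longlonglongrightarrow> x" unfolding closure_sequential by blast
  show "c *\<^sub>C x \<in> closure X" unfolding closure_sequential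
    by (rule exI[of _ "\<lambda>n. c *\<^sub>C u n"])
      (auto intro: assms(4) u bounded_linear.tendsto[OF bounded_linear_scaleC])
next
  fix x assume "x \<in> closure X"
  then obtain u where u: "\<And>n. u n \<in> X" "u \<longlonglongrightarrow> x" unfolding closure_sequential by blast
  show "adj x \<in> closure X" unfolding closure_sequential
    by (rule exI[of _ "\<lambda>n. adj (u n)"])
      (auto intro: assms(5) u bounded_linear.tendsto[OF bounded_linear_adj])
qed simp

text \<open>Continuity of *-homomorphisms is automatic; it is included here only to have uniqueness
  without developing spectral theory. Note that \<open>'b\<close> is arbitrary.\<close>

theorem cuntz_krieger_universal_property:
  fixes s :: "nat \<Rightarrow> 'a::unital_cstar_algebra" and t :: "nat \<Rightarrow> 'b::unital_cstar_algebra"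
  assumes univ: "universal_cuntz_krieger A s" and fam: "cuntz_krieger_family A t"
  shows "\<exists>!\<phi>. star_hom \<phi> \<and> continuous_on UNIV \<phi> \<and> (\<forall>i<dim_row A. \<phi> (s i) = t i)"
proof -
  define d where "d = dim_row A"
  define P where "P = star_polys d"
  define X where "X = poly_eval s ` P"
  note P = star_polys_zero star_polys_add star_polys_mult star_polys_scale star_polys_adj
    star_polys_one star_polys_gen star_polys_diff
  have le: "norm (poly_eval t p) \<le> norm (poly_eval s p)" if "p \<in> P" for p
    using univ that cstar_seminorm_norm_poly_eval[of t] cuntz_krieger_family_relators[OF fam]
    unfolding universal_cuntz_krieger_def P_def d_def by auto
  have wd: "poly_eval t p = poly_eval t p'"
    if "p \<in> P" "p' \<in> P" "poly_eval s p = poly_eval s p'" for p p'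
    using le[of "p - p'"] that P by (simp add: poly_eval_diff P_def)
  define \<phi>0 where "\<phi>0 x = poly_eval t (SOME p. p \<in> P \<and> poly_eval s p = x)" for x
  have \<phi>0: "\<phi>0 (poly_eval s p) = poly_eval t p" if "p \<in> P" for p
  proof -
    have "(SOME q. q \<in> P \<and> poly_eval s q = poly_eval s p) \<in> P \<and>
      poly_eval s (SOME q. q \<in> P \<and> poly_eval s q = poly_eval s p) = poly_eval s p"
      by (rule someI[of _ p]) (use that in simp)
    then show ?thesis unfolding \<phi>0_def using wd that by blast
  qed
  have "cstar_subalgebra (closure X)"
  proof (rule cstar_subalgebra_closure)
    show "0 \<in> X" using P(1) poly_eval_zero[of s] unfolding X_def P_def by (metis imageI)
    fix x y assume "x \<in> X" "y \<in> X"
    then obtain p q where "p \<in> P" "q \<in> P" "x = poly_eval s p" "y = poly_eval s q"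
      by (auto simp: X_def)
    then show "x + y \<in> X" "x * y \<in> X"
      using P unfolding X_def P_def by (metis imageI poly_eval_add, metis imageI poly_eval_mult)
  next
    fix c x assume "x \<in> X"
    then show "c *\<^sub>C x \<in> X" using P unfolding X_def P_def by (smt (verit) image_iff poly_eval_scale)
  next
    fix x assume "x \<in> X"
    then show "adj x \<in> X" using P unfolding X_def P_def by (smt (verit) image_iff poly_eval_adj)
  qed
  moreover have "s ` {..<d} \<subseteq> closure X"
  proof -
    have "s i \<in> X" if "i < d" for i
      using star_polys_gen[OF that] poly_eval_gen[of s i] unfolding X_def P_def by (metis imageI)
    then show ?thesis using closure_subset by blast
  qed
  ultimately have dense: "closure X = UNIV"
    using univ unfolding universal_cuntz_krieger_def cstar_generated_def d_def by blast
  have "1-lipschitz_on X \<phi>0"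
  proof (rule lipschitz_onI)
    fix x y assume "x \<in> X" "y \<in> X"
    then obtain p q where pq: "p \<in> P" "q \<in> P" "x = poly_eval s p" "y = poly_eval s q"
      by (auto simp: X_def)
    then have "p - q \<in> P" using P(8) by (simp add: P_def)
    from le[OF this] show "dist (\<phi>0 x) (\<phi>0 y) \<le> 1 * dist x y"
      by (simp add: pq \<phi>0 dist_norm poly_eval_diff)
  qed simp
  then obtain \<phi> where "uniformly_continuous_on (closure X) \<phi>" and ext: "\<And>x. x \<in> X \<Longrightarrow> \<phi>0 x = \<phi> x"
    using uniformly_continuous_on_extension_on_closure[OF lipschitz_on_uniformly_continuous] by metis
  then have cont: "continuous_on UNIV \<phi>"
    using dense uniformly_continuous_imp_continuous by force
  have ev: "\<phi> (poly_eval s p) = poly_eval t p" if "p \<in> P" for p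
    using \<phi>0[OF that] ext that by (simp add: X_def)
  have lim: "(\<lambda>n. \<phi> (u n)) \<longlonglongrightarrow> \<phi> x" if "u \<longlonglongrightarrow> x" for u x
    by (rule continuous_on_tendsto_compose[OF cont that]) auto
  have app: "\<exists>p. (\<forall>n. p n \<in> P) \<and> (\<lambda>n. poly_eval s (p n)) \<longlonglongrightarrow> x" for x
  proof -
    have "x \<in> closure X" using dense by simp
    then obtain u where u: "\<And>n. u n \<in> X" "u \<longlonglongrightarrow> x" unfolding closure_sequential by blast
    then have "\<forall>n. \<exists>p. p \<in> P \<and> u n = poly_eval s p" by (auto simp: X_def)
    then obtain p where "\<forall>n. p n \<in> P \<and> u n = poly_eval s (p n)" by metis
    moreover from this have "u = (\<lambda>n. poly_eval s (p n))" by auto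
    ultimately show ?thesis using u(2) by blast
  qed
  have hom: "star_hom \<phi>"
    unfolding star_hom_def
  proof (intro conjI allI)
    fix x y c
    obtain p q where p: "\<And>n. p n \<in> P" "(\<lambda>n. poly_eval s (p n)) \<longlonglongrightarrow> x"
      and q: "\<And>n. q n \<in> P" "(\<lambda>n. poly_eval s (q n)) \<longlonglongrightarrow> y"
      using app by meson
    have px: "(\<lambda>n. poly_eval t (p n)) \<longlonglongrightarrow> \<phi> x" and qy: "(\<lambda>n. poly_eval t (q n)) \<longlonglongrightarrow> \<phi> y"
      using lim[OF p(2)] lim[OF q(2)] ev p(1) q(1) by auto
    have "(\<lambda>n. poly_eval t (p n + q n)) \<longlonglongrightarrow> \<phi> (x + y)"
      using lim[OF tendsto_add[OF p(2) q(2)]] ev p(1) q(1) P(2)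
      by (simp add: P_def poly_eval_add[of s, symmetric])
    then show "\<phi> (x + y) = \<phi> x + \<phi> y"
      using LIMSEQ_unique tendsto_add[OF px qy] by (simp add: poly_eval_add) blast
    have "(\<lambda>n. poly_eval t (p n * q n)) \<longlonglongrightarrow> \<phi> (x * y)"
      using lim[OF tendsto_mult[OF p(2) q(2)]] ev p(1) q(1) P(3)
      by (simp add: P_def poly_eval_mult[of s, symmetric])
    then show "\<phi> (x * y) = \<phi> x * \<phi> y"
      using LIMSEQ_unique tendsto_mult[OF px qy] by (simp add: poly_eval_mult) blast
    have "(\<lambda>n. poly_eval t (Poly_Mapping.single 0 c * p n)) \<longlonglongrightarrow> \<phi> (c *\<^sub>C x)"
      using lim[OF bounded_linear.tendsto[OF bounded_linear_scaleC p(2)]] ev p(1) P(4)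
      by (simp add: P_def poly_eval_scale[of s, symmetric])
    then show "\<phi> (c *\<^sub>C x) = c *\<^sub>C \<phi> x"
      using LIMSEQ_unique bounded_linear.tendsto[OF bounded_linear_scaleC px]
      by (simp add: poly_eval_scale) blast
    have "(\<lambda>n. poly_eval t (poly_adj (p n))) \<longlonglongrightarrow> \<phi> (adj x)"
      using lim[OF bounded_linear.tendsto[OF bounded_linear_adj p(2)]] ev p(1) P(5)
      by (simp add: P_def poly_eval_adj[of s, symmetric])
    then show "\<phi> (adj x) = adj (\<phi> x)"
      using LIMSEQ_unique bounded_linear.tendsto[OF bounded_linear_adj px]
      by (simp add: poly_eval_adj) blast
    show "\<phi> 1 = 1" using ev[of 1] P(6) by (simp add: P_def poly_eval_one)
  qed
  have gens: "\<phi> (s i) = t i" if "i < d" for i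
    using ev[of "gen i"] P(7)[OF that] by (simp add: P_def poly_eval_gen)
  show ?thesis
  proof (rule ex1I[of _ \<phi>])
    show "star_hom \<phi> \<and> continuous_on UNIV \<phi> \<and> (\<forall>i<dim_row A. \<phi> (s i) = t i)" using hom cont gens by (simp add: d_def)
    fix \<psi> assume \<psi>: "star_hom \<psi> \<and> continuous_on UNIV \<psi> \<and> (\<forall>i<dim_row A. \<psi> (s i) = t i)"
    show "\<psi> = \<phi>"
    proof
      fix x
      obtain p where p: "\<And>n. p n \<in> P" "(\<lambda>n. poly_eval s (p n)) \<longlonglongrightarrow> x"
        using app by meson
      have "\<psi> (poly_eval s (p n)) = \<phi> (poly_eval s (p n))" for n
        using star_hom_poly_eval[of \<psi> d s t "p n"] \<psi> p(1) ev by (simp add: d_def P_def)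
      moreover have "(\<lambda>n. \<psi> (poly_eval s (p n))) \<longlonglongrightarrow> \<psi> x"
        by (rule continuous_on_tendsto_compose[OF _ p(2)]) (use \<psi> in auto)
      ultimately show "\<psi> x = \<phi> x" using lim[OF p(2)] LIMSEQ_unique by simp blast
    qed
  qed
qed

section \<open>The Markov shift and its algebra of continuous functions\<close>

definition shift_space :: "nat mat \<Rightarrow> (nat \<Rightarrow> nat) set" where
  "shift_space A = {x. \<forall>k. x k < dim_row A \<and> A $$ (x k, x (Suc k)) = 1}"

text \<open>Sequences carry the product topology of the discrete topology on \<open>nat\<close>. Elements of
  \<open>C(\<Lambda>\<^sub>A)\<close> are represented by functions on all sequences; only their values on \<open>\<Lambda>\<^sub>A\<close> matter.\<close>

definition cont_funs :: "nat mat \<Rightarrow> ((nat \<Rightarrow> nat) \<Rightarrow> complex) set" where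
  "cont_funs A = {f. continuous_on (shift_space A) f}"

definition cylinder :: "nat list \<Rightarrow> (nat \<Rightarrow> nat) set" where
  "cylinder w = {x. \<forall>k<length w. x k = w ! k}"

definition word_prod :: "(nat \<Rightarrow> 'a::unital_cstar_algebra) \<Rightarrow> nat list \<Rightarrow> 'a" where
  "word_prod s w = prod_list (map s w)"

text \<open>\<open>\<iota>\<close> is the identification of \<open>C(\<Lambda>\<^sub>A)\<close> with a C*-subalgebra: the isometric *-isomorphism
  onto the C*-algebra generated by the projections \<open>s\<^sub>w s\<^sub>w\<^sup>*\<close> that sends the characteristic function
  of the cylinder of \<open>w\<close> to \<open>s\<^sub>w s\<^sub>w\<^sup>*\<close>.\<close>

definition diagonal_identification ::
    "nat mat \<Rightarrow> (nat \<Rightarrow> 'a::unital_cstar_algebra) \<Rightarrow> (((nat \<Rightarrow> nat) \<Rightarrow> complex) \<Rightarrow> 'a) \<Rightarrow> bool" where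
  "diagonal_identification A s \<iota> \<longleftrightarrow>
     (\<forall>f\<in>cont_funs A. \<forall>g\<in>cont_funs A.
        \<iota> (\<lambda>x. f x + g x) = \<iota> f + \<iota> g \<and> \<iota> (\<lambda>x. f x * g x) = \<iota> f * \<iota> g) \<and>
     (\<forall>c. \<forall>f\<in>cont_funs A. \<iota> (\<lambda>x. c * f x) = c *\<^sub>C \<iota> f) \<and>
     (\<forall>f\<in>cont_funs A. \<iota> (\<lambda>x. cnj (f x)) = adj (\<iota> f)) \<and>
     (\<forall>f\<in>cont_funs A. norm (\<iota> f) = (SUP x\<in>shift_space A. cmod (f x))) \<and>
     (\<forall>w. set w \<subseteq> {..<dim_row A} \<longrightarrow>
        \<iota> (indicator (cylinder w)) = word_prod s w * adj (word_prod s w)) \<and>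
     \<iota> ` cont_funs A =
       cstar_generated {word_prod s w * adj (word_prod s w) | w. w \<noteq> [] \<and> set w \<subseteq> {..<dim_row A}}"


section \<open>KMS states\<close>

definition one_parameter_automorphism_group ::
    "(real \<Rightarrow> 'a::unital_cstar_algebra \<Rightarrow> 'a) \<Rightarrow> bool" where
  "one_parameter_automorphism_group \<alpha> \<longleftrightarrow>
     (\<forall>t. star_hom (\<alpha> t) \<and> bij (\<alpha> t)) \<and>
     \<alpha> 0 = id \<and> (\<forall>t u. \<alpha> (t + u) = \<alpha> t \<circ> \<alpha> u) \<and>
     (\<forall>x. continuous_on UNIV (\<lambda>t. \<alpha> t x))"

text \<open>Such a group is unique, since it is prescribed on generators. Here \<open>exp\<close> is the exponential
  series in the Banach algebra \<open>'a\<close>.\<close>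

definition is_flow :: "nat mat \<Rightarrow> (nat \<Rightarrow> 'a::unital_cstar_algebra) \<Rightarrow>
    (((nat \<Rightarrow> nat) \<Rightarrow> complex) \<Rightarrow> 'a) \<Rightarrow> real \<Rightarrow> ((nat \<Rightarrow> nat) \<Rightarrow> real) \<Rightarrow> (real \<Rightarrow> 'a \<Rightarrow> 'a) \<Rightarrow> bool" where
  "is_flow A s \<iota> \<beta> a \<alpha> \<longleftrightarrow>
     one_parameter_automorphism_group \<alpha> \<and>
     (\<forall>t. \<forall>i<dim_row A.
        \<alpha> t (s i) = exp ((\<i> * of_real t) *\<^sub>C (of_real \<beta> - \<iota> (\<lambda>x. of_real (a x)))) * s i)"

text \<open>\<open>F\<close> is the entire extension of \<open>t \<mapsto> \<alpha>\<^sub>t(c)\<close>, so that \<open>\<alpha>\<^sub>z(c) = F z\<close>; complex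
  differentiability is real differentiability with complex linear derivative. An element is
  analytic if it has such an extension, which is then unique.\<close>

definition entire_extension ::
    "(real \<Rightarrow> 'a::unital_cstar_algebra \<Rightarrow> 'a) \<Rightarrow> 'a \<Rightarrow> (complex \<Rightarrow> 'a) \<Rightarrow> bool" where
  "entire_extension \<alpha> c F \<longleftrightarrow>
     (\<forall>t. F (of_real t) = \<alpha> t c) \<and>
     (\<forall>z. \<exists>D. (F has_derivative (\<lambda>h. h *\<^sub>C D)) (at z))"

definition kms_state ::
    "(real \<Rightarrow> 'a::unital_cstar_algebra \<Rightarrow> 'a) \<Rightarrow> ('a \<Rightarrow> complex) \<Rightarrow> bool" where
  "kms_state \<alpha> \<omega> \<longleftrightarrow>
     state \<omega> \<and> (\<forall>b c F. entire_extension \<alpha> c F \<longrightarrow> \<omega> (b * c) = \<omega> (F (- \<i>) * b))"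


section \<open>The Ruelle operator and its eigenmeasures\<close>

definition ruelle_op :: "nat mat \<Rightarrow> ((nat \<Rightarrow> nat) \<Rightarrow> real) \<Rightarrow>
    ((nat \<Rightarrow> nat) \<Rightarrow> complex) \<Rightarrow> (nat \<Rightarrow> nat) \<Rightarrow> complex" where
  "ruelle_op A a f x =
     (\<Sum>i | i < dim_row A \<and> A $$ (i, x 0) = 1. of_real (exp (a (case_nat i x))) * f (case_nat i x))"

definition ruelle_adjoint :: "nat mat \<Rightarrow> ((nat \<Rightarrow> nat) \<Rightarrow> real) \<Rightarrow>
    (((nat \<Rightarrow> nat) \<Rightarrow> complex) \<Rightarrow> complex) \<Rightarrow> ((nat \<Rightarrow> nat) \<Rightarrow> complex) \<Rightarrow> complex" where
  "ruelle_adjoint A a \<Phi> f = \<Phi> (ruelle_op A a f)"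

definition prob_measures :: "nat mat \<Rightarrow> (nat \<Rightarrow> nat) measure set" where
  "prob_measures A = {\<mu>. prob_space \<mu> \<and> sets \<mu> = sets (restrict_space borel (shift_space A))}"

definition functional_of :: "(nat \<Rightarrow> nat) measure \<Rightarrow> ((nat \<Rightarrow> nat) \<Rightarrow> complex) \<Rightarrow> complex" where
  "functional_of \<mu> f = (\<integral>x. f x \<partial>\<mu>)"

definition eigenmeasures :: "nat mat \<Rightarrow> ((nat \<Rightarrow> nat) \<Rightarrow> real) \<Rightarrow> real \<Rightarrow> (nat \<Rightarrow> nat) measure set" where
  "eigenmeasures A a \<beta> = {\<mu> \<in> prob_measures A. \<forall>f\<in>cont_funs A.
     ruelle_adjoint A a (functional_of \<mu>) f = of_real (exp \<beta>) * functional_of \<mu> f}"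

text \<open>The restriction of a state to \<open>C(\<Lambda>\<^sub>A)\<close>, viewed as a measure by the Riesz representation
  theorem.\<close>

definition restriction :: "nat mat \<Rightarrow> (((nat \<Rightarrow> nat) \<Rightarrow> complex) \<Rightarrow> 'a::unital_cstar_algebra) \<Rightarrow>
    ('a \<Rightarrow> complex) \<Rightarrow> (nat \<Rightarrow> nat) measure" where
  "restriction A \<iota> \<omega> =
     (THE \<mu>. \<mu> \<in> prob_measures A \<and> (\<forall>f\<in>cont_funs A. \<omega> (\<iota> f) = functional_of \<mu> f))"

definition var0 :: "nat mat \<Rightarrow> ((nat \<Rightarrow> nat) \<Rightarrow> real) \<Rightarrow> real" where
  "var0 A a = (SUP x\<in>shift_space A. a x) - (INF x\<in>shift_space A. a x)"

end

theory Submission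
  imports Defs "HOL-Complex_Analysis.Complex_Analysis"
begin

text \<open>
  The KMS condition for \<open>c = s\<^sub>i\<close> and \<open>b = s\<^sub>i\<^sup>* e\<^sup>a f\<close>, summed over \<open>i\<close>, reads
  \<open>\<omega> (L\<^sub>a f) = e\<^sup>\<beta> \<omega> f\<close>, because \<open>\<Sum>\<^sub>i s\<^sub>i\<^sup>* e\<^sup>a f s\<^sub>i\<close> is the Ruelle operator inside \<open>C(\<Lambda>\<^sub>A)\<close> and
  the flow at \<open>- \<i>\<close> multiplies \<open>s\<^sub>i\<close> by \<open>e\<^sup>\<beta>\<^sup>-\<^sup>a\<close>. So a KMS state restricts to an eigenmeasure
  (\<open>kms_ruelle\<close>). The measure comes from Caratheodory's theorem on the clopen subsets of the
  zero-dimensional space \<open>\<Lambda>\<^sub>A\<close> (\<open>shift_space_Riesz\<close>).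

  Conversely, every point \<open>x\<close> of \<open>\<Lambda>\<^sub>A\<close> gives a state \<open>E\<^sub>x\<close> of the algebra that extends evaluation at
  \<open>x\<close> and kills every \<open>s\<^sub>u s\<^sub>v\<^sup>*\<close> with \<open>u \<noteq> v\<close>; as \<open>x\<close> varies this is the conditional expectation onto
  \<open>C(\<Lambda>\<^sub>A)\<close>. It is a vector state of the representation on functions on \<open>\<Lambda>\<^sub>A \<times> \<int>\<close> in which \<open>s\<^sub>i\<close> sends
  the point mass at \<open>(y, n)\<close> to that at \<open>(iy, n + 1)\<close>; the operator norm there is a C*-seminorm that
  vanishes on the relators, hence is dominated by the universal norm (\<open>cstar_seminorm_op_norm\<close>,
  \<open>op_norm_relators\<close>, \<open>vector_state\<close>). In this picture \<open>E\<^sub>x (b s\<^sub>i) = E\<^sub>i\<^sub>x (s\<^sub>i b)\<close>, and for the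
  state \<open>\<omega> b = \<integral> E\<^sub>x b d\<mu>\<close> the eigenvalue equation for \<open>\<mu>\<close> becomes the KMS condition for
  \<open>c = s\<^sub>i\<close> (\<open>integral_state_gen\<close>). It follows for \<open>s\<^sub>i\<^sup>*\<close> by taking adjoints, for polynomials in the
  generators by multiplicativity, and for all elements with an entire extension by a maximum
  principle on the strip \<open>-1 \<le> Im z \<le> 0\<close> (\<open>kms_state_generators\<close>).

  For injectivity, the numbers \<open>\<mu> [i]\<close> form a positive vector \<open>v\<close> with
  \<open>exp (min a) A v \<le> exp \<beta> v\<close>, so \<open>log r(A) \<le> \<beta> - min a\<close>, and the hypothesis on \<open>var\<^sub>0\<close> forces
  \<open>max a < \<beta>\<close> (\<open>sup_less_beta\<close>). Then \<open>\<mu> [iw] \<le> exp (max a - \<beta>) \<mu> [w]\<close>, so cylinders shrink exponentially.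
  Since \<open>C(\<Lambda>\<^sub>A)\<close> is fixed by the flow, \<open>\<omega>\<close> is tracial against it, and this moves the value of \<open>\<omega>\<close> at
  \<open>s\<^sub>v\<^sub>r s\<^sub>v\<^sup>*\<close> into ever smaller cylinders around the point \<open>v r r r \<dots>\<close>. The value is therefore zero
  (\<open>kms_off_diagonal\<close>), and \<open>\<omega>\<close> is determined by its restriction, as the elements \<open>s\<^sub>u s\<^sub>v\<^sup>*\<close> span a
  dense subspace (\<open>dense_unit_induct\<close>).
\<close>

section \<open>Positivity in unital C*-algebras\<close>

lemma scaleC_minus_right: "c *\<^sub>C (- x) = - (c *\<^sub>C (x::'a::unital_cstar_algebra))"
  by (metis add_eq_0_iff scaleC_add_right scaleC_zero_right)

lemma scaleC_diff_right: "c *\<^sub>C (x - y) = c *\<^sub>C x - c *\<^sub>C (y::'a::unital_cstar_algebra)"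
  using scaleC_add_right[of c x "- y"] by (simp add: scaleC_minus_right)

lemma adj_minus: "adj (- x) = - adj (x::'a::unital_cstar_algebra)"
  by (metis add_eq_0_iff adj_add adj_zero)

lemma adj_diff: "adj (x - y) = adj x - adj (y::'a::unital_cstar_algebra)"
  using adj_add[of x "- y"] by (simp add: adj_minus)

lemma adj_scaleR: "adj (r *\<^sub>R x) = r *\<^sub>R adj (x::'a::unital_cstar_algebra)"
  by (metis adj_scaleC complex_cnj_complex_of_real scaleC_of_real)

text \<open>The square root \<open>k\<close> of \<open>1 - h\<close> is \<open>1 - y\<close>, where \<open>y\<close> is the fixed point of
  \<open>y \<mapsto> (h + y\<^sup>2) / 2\<close>, a contraction of the ball of radius \<open>norm h\<close> that preserves
  self-adjointness.\<close>

lemma one_minus_self_adjoint_square: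
  fixes h :: "'a::unital_cstar_algebra"
  assumes "adj h = h" "norm h < 1"
  obtains k where "adj k = k" "1 - h = k * k"
proof -
  let ?r = "norm h"
  define S where "S = {y::'a. adj y = y \<and> norm y \<le> ?r}"
  define f where "f y = (1/2::real) *\<^sub>R (h + y * y)" for y :: 'a
  have cl: "closed S"
  proof -
    have "continuous_on UNIV (adj :: 'a \<Rightarrow> 'a)"
      by (rule linear_continuous_on[OF bounded_linear_adj])
    then have "closed {y::'a. adj y = y}" "closed {y::'a. norm y \<le> ?r}"
      by (intro closed_Collect_eq closed_Collect_le continuous_intros; simp)+
    then show ?thesis unfolding S_def Collect_conj_eq by (rule closed_Int)
  qed
  have maps: "f ` S \<subseteq> S"
  proof
    fix z assume "z \<in> f ` S"
    then obtain y where y: "adj y = y" "norm y \<le> ?r" "z = f y" by (auto simp: S_def)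
    have "norm (y * y) \<le> norm y * norm y" by (rule norm_mult_ineq)
    also have "\<dots> \<le> ?r * 1" using y(2) assms(2) by (intro mult_mono) auto
    finally have "norm (h + y * y) \<le> 2 * ?r" using norm_triangle_ineq[of h "y * y"] by simp
    then have "norm z \<le> ?r" by (simp add: y f_def)
    moreover have "adj z = z" by (simp add: y f_def adj_scaleR adj_add adj_mult assms(1))
    ultimately show "z \<in> S" by (simp add: S_def)
  qed
  have contr: "dist (f y) (f z) \<le> ?r * dist y z" if "y \<in> S" "z \<in> S" for y z
  proof -
    have "f y - f z = (1/2::real) *\<^sub>R (y * (y - z) + (y - z) * z)"
      by (simp add: f_def algebra_simps)
    then have "dist (f y) (f z) = (1/2) * norm (y * (y - z) + (y - z) * z)"
      by (simp add: dist_norm)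
    also have "\<dots> \<le> (1/2) * (norm y * norm (y - z) + norm (y - z) * norm z)"
      using norm_triangle_ineq[of "y * (y - z)" "(y - z) * z"]
        norm_mult_ineq[of y "y - z"] norm_mult_ineq[of "y - z" z] by simp
    also have "\<dots> \<le> (1/2) * (?r * norm (y - z) + norm (y - z) * ?r)"
      using that by (intro mult_left_mono add_mono mult_mono) (auto simp: S_def)
    finally show ?thesis by (simp add: dist_norm)
  qed
  have "\<exists>!y. y \<in> S \<and> f y = y"
  proof (rule Banach_fix[OF complete_eq_closed[THEN iffD2, OF cl]])
    show "S \<noteq> {}" using adj_zero[where 'a='a] by (auto simp: S_def intro: exI[of _ 0])
  qed (use maps contr assms(2) in auto)
  then obtain y where y: "adj y = y" "f y = y" by (auto simp: S_def)
  have "2 *\<^sub>R y = h + y * y" using arg_cong[OF y(2), of "\<lambda>z. 2 *\<^sub>R z"] by (simp add: f_def)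
  then have "1 - h = (1 - y) * (1 - y)" by (simp add: algebra_simps scaleR_2)
  moreover have "adj (1 - y) = 1 - y" by (simp add: adj_diff adj_one y(1))
  ultimately show ?thesis using that by blast
qed

context
  fixes \<omega> :: "'a::unital_cstar_algebra \<Rightarrow> complex"
  assumes st: "state \<omega>"
begin

lemma state_add: "\<omega> (x + y) = \<omega> x + \<omega> y"
  and state_scaleC: "\<omega> (c *\<^sub>C x) = c * \<omega> x"
  and state_one: "\<omega> 1 = 1"
  using st unfolding state_def by blast+

lemma state_zero: "\<omega> 0 = 0" using state_add[of 0 0] by simp

lemma state_minus: "\<omega> (- x) = - \<omega> x"
  using state_add[of x "- x"] by (simp add: state_zero eq_neg_iff_add_eq_0 add.commute)

lemma state_diff: "\<omega> (x - y) = \<omega> x - \<omega> y"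
  using state_add[of x "- y"] by (simp add: state_minus)

lemma state_scaleR: "\<omega> (r *\<^sub>R x) = of_real r * \<omega> x"
  using state_scaleC[of "of_real r" x] by (simp add: scaleC_of_real)

lemma state_sum: "\<omega> (sum f F) = (\<Sum>x\<in>F. \<omega> (f x))"
  by (induction F rule: infinite_finite_induct) (auto simp: state_zero state_add)

lemma state_square: "Im (\<omega> (adj x * x)) = 0" "0 \<le> Re (\<omega> (adj x * x))"
proof -
  have "\<omega> (adj x * x) \<in> \<real>\<^sub>\<ge>\<^sub>0" using st unfolding state_def by blast
  then show "Im (\<omega> (adj x * x)) = 0" "0 \<le> Re (\<omega> (adj x * x))"
    by (auto simp: complex_nonneg_Reals_iff)
qed

text \<open>Polarisation: the sums of the cross terms of \<open>\<omega> (adj (x + y) * (x + y))\<close> and of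
  \<open>\<omega> (adj (x + \<i> y) * (x + \<i> y))\<close> are real.\<close>

lemma state_cross: "\<omega> (adj y * x) = cnj (\<omega> (adj x * y))"
proof -
  have "adj (x + y) * (x + y) = adj x * x + adj x * y + (adj y * x + adj y * y)"
    by (simp add: adj_add algebra_simps)
  then have "\<omega> (adj (x + y) * (x + y)) =
      \<omega> (adj x * x) + \<omega> (adj x * y) + (\<omega> (adj y * x) + \<omega> (adj y * y))"
    by (simp add: state_add)
  from arg_cong[OF this, of Im]
  have 1: "Im (\<omega> (adj x * y)) + Im (\<omega> (adj y * x)) = 0"
    using state_square(1)[of x] state_square(1)[of y] state_square(1)[of "x + y"]
    by (simp)
  have "adj (x + \<i> *\<^sub>C y) * (x + \<i> *\<^sub>C y) =
      adj x * x + \<i> *\<^sub>C (adj x * y) + ((- \<i>) *\<^sub>C (adj y * x) + adj y * y)"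
    by (simp add: adj_add adj_scaleC algebra_simps mult_scaleC_left mult_scaleC_right
        scaleC_scaleC scaleC_one scaleC_add_right)
  then have "\<omega> (adj (x + \<i> *\<^sub>C y) * (x + \<i> *\<^sub>C y)) =
      \<omega> (adj x * x) + \<i> * \<omega> (adj x * y) + (- \<i> * \<omega> (adj y * x) + \<omega> (adj y * y))"
    by (simp only: state_add state_scaleC)
  from arg_cong[OF this, of Im]
  have 2: "Re (\<omega> (adj x * y)) - Re (\<omega> (adj y * x)) = 0"
    using state_square(1)[of x] state_square(1)[of y] state_square(1)[of "x + \<i> *\<^sub>C y"]
    by (simp)
  from 1 2 show ?thesis by (auto simp: complex_eq_iff)
qed

lemma state_adj: "\<omega> (adj x) = cnj (\<omega> x)"
  using state_cross[of x 1] by (simp add: adj_one)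

lemma state_Cauchy_Schwarz:
  "(cmod (\<omega> (adj y * x)))\<^sup>2 \<le> Re (\<omega> (adj x * x)) * Re (\<omega> (adj y * y))"
proof -
  define p q c where "p = Re (\<omega> (adj x * x))" and "q = Re (\<omega> (adj y * y))"
    and "c = \<omega> (adj y * x)"
  have p: "\<omega> (adj x * x) = of_real p" and q: "\<omega> (adj y * y) = of_real q"
    and p0: "0 \<le> p" and q0: "0 \<le> q"
    using state_square by (auto simp: p_def q_def complex_eq_iff)
  have c': "\<omega> (adj x * y) = cnj c" using state_cross[of x y] by (simp add: c_def)
  \<comment> \<open>positivity at \<open>x - t c y\<close>; the choice \<open>t = 1 / q\<close> is optimal, and a large \<open>t\<close> gives \<open>c = 0\<close> if \<open>q = 0\<close>\<close>
  have key: "0 \<le> p - 2 * t * (cmod c)\<^sup>2 + t\<^sup>2 * (cmod c)\<^sup>2 * q" for t :: real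
  proof -
    define z where "z = of_real t * c"
    have "adj (x - z *\<^sub>C y) * (x - z *\<^sub>C y) =
        adj x * x - z *\<^sub>C (adj x * y) - (cnj z *\<^sub>C (adj y * x) - (z * cnj z) *\<^sub>C (adj y * y))"
      by (simp add: adj_diff adj_scaleC algebra_simps mult_scaleC_left mult_scaleC_right
          scaleC_scaleC scaleC_diff_right)
    then have "\<omega> (adj (x - z *\<^sub>C y) * (x - z *\<^sub>C y)) =
        of_real p - z * cnj c - (cnj z * c - (z * cnj z) * of_real q)"
      by (simp only: state_diff state_scaleC p q c' c_def[symmetric])
    also have "\<dots> = of_real (p - 2 * t * (cmod c)\<^sup>2 + t\<^sup>2 * (cmod c)\<^sup>2 * q)"
      by (simp add: z_def complex_norm_square power2_eq_square[of t] algebra_simps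
          flip: of_real_power)
    finally have "Re (\<omega> (adj (x - z *\<^sub>C y) * (x - z *\<^sub>C y))) =
        p - 2 * t * (cmod c)\<^sup>2 + t\<^sup>2 * (cmod c)\<^sup>2 * q"
      by (metis Re_complex_of_real)
    then show ?thesis using state_square(2)[of "x - z *\<^sub>C y"] by simp
  qed
  show ?thesis
  proof (cases "q = 0")
    case True
    have "c = 0"
    proof (rule ccontr)
      assume "c \<noteq> 0"
      then have "p - 2 * ((p + 1) / (2 * (cmod c)\<^sup>2)) * (cmod c)\<^sup>2 = - 1"
        by (simp add: field_simps)
      then show False using key[of "(p + 1) / (2 * (cmod c)\<^sup>2)"] True by simp
    qed
    then show ?thesis using p0 q0 by (simp add: c_def p_def q_def)
  next
    case False
    then have "0 < q" using q0 by simp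
    then have "0 \<le> p - (cmod c)\<^sup>2 / q"
      using key[of "1 / q"] by (simp add: field_simps power2_eq_square)
    then show ?thesis using \<open>0 < q\<close> by (simp add: field_simps c_def p_def q_def)
  qed
qed

text \<open>The factor \<open>r < 1\<close> makes the norm of \<open>r h\<close> strictly smaller than \<open>1\<close>, so that \<open>1 - r h\<close> is a
  square.\<close>

lemma state_self_adjoint_le:
  assumes "adj h = h" "norm h \<le> 1"
  shows "Re (\<omega> h) \<le> 1"
proof (rule field_le_mult_one_interval)
  fix r :: real assume r: "0 < r" "r < 1"
  have "adj (r *\<^sub>R h) = r *\<^sub>R h" by (simp add: adj_scaleR assms(1))
  moreover have "norm (r *\<^sub>R h) < 1"
  proof -
    have "norm (r *\<^sub>R h) = r * norm h" using r by simp
    also have "\<dots> \<le> r * 1" using r assms(2) by (intro mult_left_mono) auto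
    finally show ?thesis using r by linarith
  qed
  ultimately obtain k where k: "adj k = k" "1 - r *\<^sub>R h = k * k"
    by (rule one_minus_self_adjoint_square)
  have "0 \<le> Re (\<omega> (1 - r *\<^sub>R h))" using state_square(2)[of k] k by simp
  then show "r * Re (\<omega> h) \<le> 1" by (simp add: state_diff state_one state_scaleR)
qed

text \<open>Boundedness is automatic, since \<open>adj x * x\<close> scaled to norm at most \<open>1\<close> is covered by the
  previous estimate.\<close>

lemma state_square_le: "Re (\<omega> (adj x * x)) \<le> (norm x)\<^sup>2"
proof (cases "x = 0")
  case False
  define h where "h = (1 / (norm x)\<^sup>2) *\<^sub>R (adj x * x)"
  have "adj h = h" by (simp add: h_def adj_scaleR adj_mult adj_adj)
  moreover have "norm h \<le> 1" using False by (simp add: h_def cstar_identity)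
  ultimately have "Re (\<omega> h) \<le> 1" by (rule state_self_adjoint_le)
  then show ?thesis using False by (simp add: h_def state_scaleR field_simps)
qed (simp add: state_zero)

lemma state_norm_le: "cmod (\<omega> x) \<le> norm x"
proof -
  have "(cmod (\<omega> x))\<^sup>2 \<le> Re (\<omega> (adj x * x)) * 1"
    using state_Cauchy_Schwarz[of 1 x] by (simp add: adj_one state_one)
  also have "\<dots> \<le> (norm x)\<^sup>2" using state_square_le by simp
  finally show ?thesis by (simp add: power2_le_iff_abs_le)
qed

lemma state_bounded_linear: "bounded_linear \<omega>"
proof (rule bounded_linear_intro[where K = 1])
  show "\<omega> (r *\<^sub>R x) = r *\<^sub>R \<omega> x" for r x using state_scaleR[of r x] by (simp only: scaleR_conv_of_real[of r "\<omega> x"])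
qed (use state_add state_norm_le in auto)

end

lemma state_star_hom:
  assumes "state \<omega>" "star_hom \<phi>"
  shows "state (\<lambda>x. \<omega> (\<phi> x))"
proof -
  note h = assms(2)[unfolded star_hom_def] and s = assms(1)[unfolded state_def]
  show ?thesis unfolding state_def
  proof (intro conjI allI)
    fix x show "\<omega> (\<phi> (adj x * x)) \<in> \<real>\<^sub>\<ge>\<^sub>0" using s h by metis
  qed (use h s in auto)
qed

text \<open>A *-homomorphism pulls states back to states, which are contractive. So \<open>\<phi>\<close> is contractive as
  seen by any state, which serves as automatic continuity without spectral theory.\<close>

lemma state_star_hom_mult_le:
  assumes "state \<omega>" "star_hom \<phi>"
  shows "cmod (\<omega> (\<phi> x * b)) \<le> norm x * norm b"
proof -
  note h = assms(2)[unfolded star_hom_def]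
  have "(cmod (\<omega> (\<phi> x * b)))\<^sup>2 \<le> Re (\<omega> (adj b * b)) * Re (\<omega> (\<phi> x * adj (\<phi> x)))"
    using state_Cauchy_Schwarz[OF assms(1), of "adj (\<phi> x)" b] by (simp add: adj_adj)
  also have "\<phi> x * adj (\<phi> x) = \<phi> (adj (adj x) * adj x)" using h by (simp add: adj_adj)
  also have "Re (\<omega> (adj b * b)) * Re (\<omega> \<dots>) \<le> (norm b)\<^sup>2 * (norm (adj x))\<^sup>2"
    by (intro mult_mono state_square_le[OF assms(1)] state_square_le[OF state_star_hom[OF assms]]
        state_square[OF assms(1)] state_square[OF state_star_hom[OF assms]]) simp
  finally have "(cmod (\<omega> (\<phi> x * b)))\<^sup>2 \<le> (norm x * norm b)\<^sup>2"
    by (simp add: norm_adj power_mult_distrib mult.commute)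
  then show ?thesis by (rule power2_le_imp_le) simp
qed

lemma mult_star_hom_state_le:
  assumes "state \<omega>" "star_hom \<phi>"
  shows "cmod (\<omega> (b * \<phi> x)) \<le> norm x * norm b"
proof -
  have "b * \<phi> x = adj (\<phi> (adj x) * adj b)"
    using assms(2) by (simp add: star_hom_def adj_mult adj_adj)
  then show ?thesis
    using state_star_hom_mult_le[OF assms, of "adj x" "adj b"]
    by (simp add: state_adj[OF assms(1)] norm_adj)
qed

section \<open>Bounded entire functions on a strip\<close>

text \<open>The factor \<open>exp (- e z\<^sup>2)\<close> makes the function vanish at infinity in the strip, so that the
  maximum principle applies to a long rectangle; then \<open>e\<close> tends to \<open>0\<close>.\<close>

lemma strip_maximum_principle:
  fixes f :: "complex \<Rightarrow> complex"
  assumes hol: "f holomorphic_on UNIV"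
    and bd: "\<And>z. -1 \<le> Im z \<Longrightarrow> Im z \<le> 0 \<Longrightarrow> cmod (f z) \<le> M"
    and edge: "\<And>z. Im z = 0 \<or> Im z = -1 \<Longrightarrow> cmod (f z) \<le> B"
    and z: "-1 \<le> Im z" "Im z \<le> 0"
  shows "cmod (f z) \<le> B"
proof (rule field_le_epsilon)
  fix \<delta> :: real assume "0 < \<delta>"
  have B0: "0 \<le> B" using order_trans[OF norm_ge_zero edge[of 0]] by simp
  have M0: "0 \<le> M" using order_trans[OF norm_ge_zero bd[of 0]] by simp
  define C where "C = B + \<delta>"
  have C: "0 < C" "B \<le> C" using B0 \<open>0 < \<delta>\<close> by (auto simp: C_def)
  have norm_exp: "cmod (exp (- (of_real e * w\<^sup>2))) = exp (e * ((Im w)\<^sup>2 - (Re w)\<^sup>2))" for e w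
    by (simp add: power2_eq_square algebra_simps)
  have main: "cmod (f z) \<le> C * exp e * exp (e * ((Re z)\<^sup>2 - (Im z)\<^sup>2))" if e: "0 < e" for e :: real
  proof -
    have "((\<lambda>R. M * exp (- e * R\<^sup>2)) \<longlongrightarrow> 0) at_top" using e by real_asymp
    then have "eventually (\<lambda>R. M * exp (- e * R\<^sup>2) < C) at_top"
      using C(1) by (rule order_tendstoD)
    from eventually_happens[OF eventually_conj[OF this eventually_ge_at_top[of "\<bar>Re z\<bar>"]]]
    obtain R where R: "M * exp (- e * R\<^sup>2) < C" "\<bar>Re z\<bar> \<le> R" by auto
    define S where "S = cbox (Complex (- R) (- 1)) (Complex R 0)"
    have inS: "w \<in> S \<longleftrightarrow> - R \<le> Re w \<and> Re w \<le> R \<and> -1 \<le> Im w \<and> Im w \<le> 0" for w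
      by (auto simp: S_def in_cbox_complex_iff)
    define g where "g w = f w * exp (- (of_real e * w\<^sup>2))" for w
    have holg: "g holomorphic_on UNIV" unfolding g_def using hol by (intro holomorphic_intros)
    have "cmod (g z) \<le> C * exp e"
    proof (rule maximum_modulus_frontier[of g S])
      show "g holomorphic_on interior S" using holg holomorphic_on_subset by blast
      show "continuous_on (closure S) g"
        using holomorphic_on_imp_continuous_on[OF holg] continuous_on_subset by blast
      show "bounded S" by (simp add: S_def bounded_cbox)
      show "z \<in> S" using R z by (auto simp: inS)
      fix w assume "w \<in> frontier S"
      then have w: "w \<in> S" "w \<notin> box (Complex (- R) (- 1)) (Complex R 0)"
        by (auto simp: frontier_def S_def interior_cbox)
      have im: "(Im w)\<^sup>2 \<le> 1" using w(1) by (auto simp: inS abs_square_le_1)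
      have "cmod (f w) * exp (- e * (Re w)\<^sup>2) \<le> C"
      proof (cases "Im w = 0 \<or> Im w = -1")
        case True
        have "cmod (f w) * exp (- e * (Re w)\<^sup>2) \<le> B * 1"
          using edge[OF True] e B0 by (intro mult_mono) auto
        then show ?thesis using C by simp
      next
        case False
        then have "\<bar>Re w\<bar> = R" using w by (auto simp: inS in_box_complex_iff)
        then have "(Re w)\<^sup>2 = R\<^sup>2" by (metis power2_abs)
        moreover have "cmod (f w) \<le> M" using w by (intro bd) (auto simp: inS)
        ultimately have "cmod (f w) * exp (- e * (Re w)\<^sup>2) \<le> M * exp (- e * R\<^sup>2)"
          by (simp add: mult_right_mono)
        then show ?thesis using R(1) by simp
      qed
      then have "cmod (f w) * exp (- e * (Re w)\<^sup>2) * exp (e * (Im w)\<^sup>2) \<le> C * exp e"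
        using im e C by (intro mult_mono) auto
      then show "cmod (g w) \<le> C * exp e"
        unfolding g_def norm_mult norm_exp by (simp add: exp_add[symmetric] algebra_simps)
    qed
    then have "cmod (g z) * exp (e * ((Re z)\<^sup>2 - (Im z)\<^sup>2)) \<le> C * exp e * exp (e * ((Re z)\<^sup>2 - (Im z)\<^sup>2))"
      by (rule mult_right_mono) simp
    moreover have "cmod (g z) * exp (e * ((Re z)\<^sup>2 - (Im z)\<^sup>2)) = cmod (f z)"
      unfolding g_def norm_mult norm_exp by (simp add: mult.assoc exp_add[symmetric] algebra_simps)
    ultimately show ?thesis by simp
  qed
  have "((\<lambda>e. C * exp e * exp (e * ((Re z)\<^sup>2 - (Im z)\<^sup>2))) \<longlongrightarrow>
      C * exp 0 * exp (0 * ((Re z)\<^sup>2 - (Im z)\<^sup>2))) (at_right 0)"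
    by (intro tendsto_intros)
  then have "((\<lambda>e. C * exp e * exp (e * ((Re z)\<^sup>2 - (Im z)\<^sup>2))) \<longlongrightarrow> C) (at_right 0)" by simp
  then have "cmod (f z) \<le> C"
  proof (rule tendsto_lowerbound)
    show "\<forall>\<^sub>F e in at_right 0. cmod (f z) \<le> C * exp e * exp (e * ((Re z)\<^sup>2 - (Im z)\<^sup>2))"
      using eventually_at_right_less by (rule eventually_mono) (rule main)
  qed simp
  then show "cmod (f z) \<le> B + \<delta>" by (simp add: C_def)
qed

text \<open>The modulus of \<open>exp (- \<i> \<kappa> z)\<close> is \<open>1\<close> on the real axis and \<open>exp (- \<kappa>)\<close> on the other edge.
  Multiplying by it damps the edge on which the functions are only bounded, so the maximum principle
  gives the limit in the interior. The hypothesis on differences makes the convergence uniform up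
  to the other edge, which carries the limit over to it.\<close>

lemma strip_limit_other_edge:
  fixes E :: "nat \<Rightarrow> complex \<Rightarrow> complex" and b :: "nat \<Rightarrow> real"
  assumes hol: "\<And>k. E k holomorphic_on UNIV"
    and bd: "\<And>k. \<exists>M. \<forall>z. -1 \<le> Im z \<and> Im z \<le> 0 \<longrightarrow> cmod (E k z) \<le> M"
    and real: "\<And>k z. Im z = 0 \<Longrightarrow> cmod (E k z) \<le> b k"
    and cauchy: "\<And>j k z. Im z = -1 \<Longrightarrow> cmod (E j z - E k z) \<le> b j + b k"
    and b: "b \<longlonglongrightarrow> 0"
  shows "(\<lambda>k. E k (- \<i>)) \<longlonglongrightarrow> 0"
proof -
  obtain M where M: "\<And>k z. -1 \<le> Im z \<Longrightarrow> Im z \<le> 0 \<Longrightarrow> cmod (E k z) \<le> M k"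
    using bd by metis
  have diff: "cmod (E j z - E k z) \<le> b j + b k" if "-1 \<le> Im z" "Im z \<le> 0" for j k z
  proof (rule strip_maximum_principle[where f = "\<lambda>z. E j z - E k z" and M = "M j + M k"])
    show "(\<lambda>z. E j z - E k z) holomorphic_on UNIV" using hol by (intro holomorphic_intros)
    fix w
    show "cmod (E j w - E k w) \<le> M j + M k" if "-1 \<le> Im w" "Im w \<le> 0"
      using M[OF that, of j] M[OF that, of k] norm_triangle_ineq4[of "E j w" "E k w"] by linarith
    show "cmod (E j w - E k w) \<le> b j + b k" if "Im w = 0 \<or> Im w = -1"
      using that real[of w j] real[of w k] cauchy[of w j k] norm_triangle_ineq4[of "E j w" "E k w"]
      by (elim disjE) linarith+
  qed (use that in auto)
  have interior: "(\<lambda>k. E k z) \<longlonglongrightarrow> 0" if z: "-1 < Im z" "Im z \<le> 0" for z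
  proof (rule tendsto_norm_zero_cancel, rule LIMSEQ_I)
    fix \<eta> :: real assume \<eta>: "0 < \<eta>"
    obtain N0 where N0: "\<And>k. k \<ge> N0 \<Longrightarrow> \<bar>b k\<bar> < 1"
      using LIMSEQ_D[OF b, of 1] by auto
    define C where "C = M N0 + 2"
    have C: "cmod (E k w) \<le> C" if "Im w = -1" "k \<ge> N0" for k w
      using that M[of w N0] cauchy[of w k N0] N0[of k] N0[of N0] norm_triangle_sub[of "E k w" "E N0 w"]
      unfolding C_def by simp
    define y where "y = - Im z"
    have y: "0 \<le> y" "y < 1" using z by (auto simp: y_def)
    have "((\<lambda>\<kappa>. C * exp (- (1 - y) * \<kappa>)) \<longlongrightarrow> 0) at_top" using y by real_asymp
    then have "eventually (\<lambda>\<kappa>. C * exp (- (1 - y) * \<kappa>) < \<eta>) at_top"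
      using \<eta> by (rule order_tendstoD)
    from eventually_happens[OF eventually_conj[OF this eventually_ge_at_top[of 0]]]
    obtain \<kappa> where \<kappa>: "C * exp (- (1 - y) * \<kappa>) < \<eta>" "0 \<le> \<kappa>" by auto
    have "(\<lambda>k. b k * exp (\<kappa> * y)) \<longlonglongrightarrow> 0" using tendsto_mult_left_zero[OF b] by simp
    from order_tendstoD(2)[OF this \<eta>]
    obtain N1 where N1: "\<And>k. k \<ge> N1 \<Longrightarrow> b k * exp (\<kappa> * y) < \<eta>"
      unfolding eventually_sequentially by auto
    have "cmod (E k z) < \<eta>" if k: "k \<ge> max N0 N1" for k
    proof -
      let ?f = "\<lambda>w. E k w * exp (- \<i> * of_real \<kappa> * w)"
      have nf: "cmod (?f w) = cmod (E k w) * exp (\<kappa> * Im w)" for w by (simp add: norm_mult)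
      have "cmod (?f z) \<le> max (b k) (C * exp (- \<kappa>))"
      proof (rule strip_maximum_principle[where f = ?f and M = "M k"])
        show "?f holomorphic_on UNIV" using hol by (intro holomorphic_intros)
        fix w
        show "cmod (?f w) \<le> M k" if w: "-1 \<le> Im w" "Im w \<le> 0"
        proof -
          have "cmod (E k w) * exp (\<kappa> * Im w) \<le> cmod (E k w) * 1"
            using w \<kappa>(2) by (intro mult_left_mono) (auto simp: mult_nonneg_nonpos)
          then show ?thesis using M[OF w, of k] unfolding nf by simp
        qed
        show "cmod (?f w) \<le> max (b k) (C * exp (- \<kappa>))" if "Im w = 0 \<or> Im w = -1"
          using that
        proof
          assume "Im w = 0" then show ?thesis using real[of w k] unfolding nf by simp
        next
          assume "Im w = -1"
          then show ?thesis using mult_right_mono[OF C[of w k], of "exp (- \<kappa>)"] k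
            unfolding nf by (simp add: le_max_iff_disj)
        qed
      qed (use z in auto)
      then have "cmod (?f z) * exp (\<kappa> * y) \<le> max (b k) (C * exp (- \<kappa>)) * exp (\<kappa> * y)"
        by (rule mult_right_mono) simp
      also have "\<dots> = max (b k * exp (\<kappa> * y)) (C * exp (- \<kappa>) * exp (\<kappa> * y))"
        by (simp add: max_mult_distrib_right)
      also have "\<dots> < \<eta>" using \<kappa>(1) N1[of k] k by (simp add: mult.assoc exp_add[symmetric] algebra_simps)
      finally show ?thesis unfolding nf by (simp add: y_def mult.assoc exp_add[symmetric])
    qed
    then show "\<exists>no. \<forall>n\<ge>no. norm (norm (E n z) - 0) < \<eta>"
      by (intro exI[of _ "max N0 N1"]) simp
  qed
  have le: "cmod (E j (- \<i>)) \<le> b j" for j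
  proof -
    have *: "cmod (E j (- (of_real t * \<i>))) \<le> b j" if t: "0 \<le> t" "t < 1" for t
    proof -
      have "(\<lambda>k. cmod (E k (- (of_real t * \<i>))) + (b j + b k)) \<longlonglongrightarrow> 0 + (b j + 0)"
        using t by (intro tendsto_intros b tendsto_norm_zero interior) auto
      moreover have "cmod (E j (- (of_real t * \<i>))) \<le> cmod (E k (- (of_real t * \<i>))) + (b j + b k)" for k
        using diff[of "- (of_real t * \<i>)" j k] t
          norm_triangle_sub[of "E j (- (of_real t * \<i>))" "E k (- (of_real t * \<i>))"] by simp
      ultimately show ?thesis using LIMSEQ_le_const by (metis (no_types, lifting) add.left_neutral add.right_neutral)
    qed
    have "continuous_on UNIV (E j)" using hol holomorphic_on_imp_continuous_on by blast
    then have c: "isCont (E j) (- (of_real 1 * \<i>))" by (simp add: continuous_on_eq_continuous_at)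
    have "((\<lambda>t. - (of_real t * \<i>)) \<longlongrightarrow> - (of_real 1 * \<i>)) (at_left (1::real))"
      by (intro tendsto_intros)
    from tendsto_norm[OF isCont_tendsto_compose[OF c this]]
    have "((\<lambda>t::real. cmod (E j (- (of_real t * \<i>)))) \<longlongrightarrow> cmod (E j (- (of_real 1 * \<i>)))) (at_left 1)" .
    then have "cmod (E j (- (of_real 1 * \<i>))) \<le> b j"
      by (rule tendsto_upperbound) (auto intro!: eventually_at_leftI[of 0 1] *)
    then show ?thesis by simp
  qed
  show ?thesis by (rule Lim_null_comparison[OF _ b]) (use le in auto)
qed

section \<open>Continuous functions and measures on the shift space\<close>

lemma cylinder_eq_vimage: "cylinder w = (\<Inter>k<length w. (\<lambda>x. x k) -` {w ! k})"
  by (auto simp: cylinder_def)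

lemma closed_cylinder: "closed (cylinder w)"
  unfolding cylinder_eq_vimage by (intro closed_INT ballI closed_vimage) auto

lemma open_cylinder: "open (cylinder w)"
  unfolding cylinder_eq_vimage by (intro open_INT ballI open_vimage) (auto simp: Topological_Spaces.open_discrete)

lemma continuous_on_indicator_cylinder: "continuous_on S (indicator (cylinder w) :: _ \<Rightarrow> complex)"
proof -
  have "continuous_on (cylinder w \<union> - cylinder w) (\<lambda>x. if x \<in> cylinder w then 1 else 0 :: complex)"
    by (rule continuous_on_cases) (auto simp: closed_cylinder open_cylinder closed_Compl)
  moreover have "(\<lambda>x. if x \<in> cylinder w then 1 else 0 :: complex) = indicator (cylinder w)"
    by (auto simp: indicator_def)
  ultimately have "continuous_on UNIV (indicator (cylinder w) :: _ \<Rightarrow> complex)"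
    by (simp only: Compl_partition)
  then show ?thesis by (rule continuous_on_subset) simp
qed

lemma tendsto_sequence_iff:
  fixes f :: "'b \<Rightarrow> nat \<Rightarrow> nat"
  shows "(f \<longlongrightarrow> l) F \<longleftrightarrow> (\<forall>k. ((\<lambda>n. f n k) \<longlongrightarrow> l k) F)"
proof -
  have "(f \<longlongrightarrow> l) F \<longleftrightarrow> limitin (product_topology (\<lambda>_. euclidean) UNIV) f l F"
    by (simp add: euclidean_product_topology)
  also have "\<dots> \<longleftrightarrow> (\<forall>k. ((\<lambda>n. f n k) \<longlongrightarrow> l k) F)"
    by (simp add: limitin_componentwise)
  finally show ?thesis .
qed

lemma pow_mat_Suc_left:
  fixes A :: "'a::semiring_1 mat"
  assumes "A \<in> carrier_mat n n"
  shows "A ^\<^sub>m Suc k = A * A ^\<^sub>m k"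
proof (induction k)
  case (Suc k)
  have "A ^\<^sub>m Suc (Suc k) = A * A ^\<^sub>m k * A" using Suc by simp
  also have "\<dots> = A * (A ^\<^sub>m k * A)" using assms by (intro assoc_mult_mat[of _ n n _ n _ n]) auto
  finally show ?case by simp
qed (use assms in simp)

locale markov_shift =
  fixes A :: "nat mat" and d :: nat
  assumes d_pos: "0 < d" and carrier: "A \<in> carrier_mat d d" and zero_one: "zero_one_mat A"
    and aper: "aperiodic A"
begin

abbreviation \<Lambda> :: "(nat \<Rightarrow> nat) set" where "\<Lambda> \<equiv> shift_space A"

abbreviation follows :: "nat \<Rightarrow> nat \<Rightarrow> bool" where "follows i j \<equiv> A $$ (i, j) = 1"

lemma dim_row [simp]: "dim_row A = d" using carrier by auto

lemma entry_cases: "i < d \<Longrightarrow> j < d \<Longrightarrow> A $$ (i, j) = 0 \<or> follows i j"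
  using zero_one elements_matI[OF carrier, of i j] unfolding zero_one_mat_def by blast

text \<open>A zero row of \<open>A\<close> would be a zero row of every proper power.\<close>

lemma row_nonzero:
  assumes "i < d" obtains j where "j < d" "follows i j"
proof (rule ccontr)
  assume "\<not> thesis"
  then have z: "\<And>j. j < d \<Longrightarrow> A $$ (i, j) = 0" using that entry_cases[OF assms] by blast
  obtain N where N: "N > 0" "0 < (A ^\<^sub>m N) $$ (i, 0)"
    using aper assms d_pos unfolding aperiodic_def by auto
  then obtain n where "N = Suc n" by (cases N) auto
  then have "A ^\<^sub>m N = A * A ^\<^sub>m n" using pow_mat_Suc_left[OF carrier] by simp
  moreover have "(A * A ^\<^sub>m n) $$ (i, 0) = (\<Sum>j<d. A $$ (i, j) * (A ^\<^sub>m n) $$ (j, 0))"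
    using assms d_pos carrier by (simp add: scalar_prod_def atLeast0LessThan)
  ultimately show False using N(2) z by simp
qed

lemma shift_space_less: "x \<in> \<Lambda> \<Longrightarrow> x k < d"
  and shift_space_follows: "x \<in> \<Lambda> \<Longrightarrow> follows (x k) (x (Suc k))"
  unfolding shift_space_def using dim_row by simp_all

lemma shift_space_cons: "case_nat i x \<in> \<Lambda> \<longleftrightarrow> i < d \<and> follows i (x 0) \<and> x \<in> \<Lambda>"
proof
  assume *: "case_nat i x \<in> \<Lambda>"
  have "x \<in> \<Lambda>"
    using shift_space_less[OF *, of "Suc _"] shift_space_follows[OF *, of "Suc _"]
    by (simp add: shift_space_def)
  then show "i < d \<and> follows i (x 0) \<and> x \<in> \<Lambda>"
    using shift_space_less[OF *, of 0] shift_space_follows[OF *, of 0] by simp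
next
  assume *: "i < d \<and> follows i (x 0) \<and> x \<in> \<Lambda>"
  show "case_nat i x \<in> \<Lambda>"
    unfolding shift_space_def
  proof (rule CollectI, rule allI)
    fix k
    show "case_nat i x k < dim_row A \<and> A $$ (case_nat i x k, case_nat i x (Suc k)) = 1"
      using * shift_space_less[of x] shift_space_follows[of x] by (cases k) simp_all
  qed
qed

lemma shift_space_tail: "x \<in> \<Lambda> \<Longrightarrow> x \<circ> Suc \<in> \<Lambda>"
  unfolding shift_space_def by simp

lemma shift_space_nonempty: "\<Lambda> \<noteq> {}"
proof -
  have "\<forall>i. \<exists>j. i < d \<longrightarrow> j < d \<and> follows i j" using row_nonzero by blast
  then obtain g where g: "\<And>i. i < d \<Longrightarrow> g i < d \<and> follows i (g i)" by metis
  have "(g ^^ k) 0 < d" for k by (induction k) (use d_pos g in auto)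
  then have "(\<lambda>k. (g ^^ k) 0) \<in> \<Lambda>" using g unfolding shift_space_def by simp
  then show ?thesis by auto
qed

lemma closed_shift_space: "closed \<Lambda>"
proof -
  have "closed ((\<lambda>x::nat\<Rightarrow>nat. x k) -` {i})" for k i by (intro closed_vimage) auto
  then have "closed (\<Inter>k. \<Union>p\<in>{p. fst p < d \<and> snd p < d \<and> follows (fst p) (snd p)}.
      (\<lambda>x::nat\<Rightarrow>nat. x k) -` {fst p} \<inter> (\<lambda>x::nat\<Rightarrow>nat. x (Suc k)) -` {snd p})"
    by (intro closed_INT ballI closed_UN closed_Int)
      (auto intro: finite_subset[of _ "{..<d} \<times> {..<d}"])
  also have "(\<Inter>k. \<Union>p\<in>{p. fst p < d \<and> snd p < d \<and> follows (fst p) (snd p)}.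
      (\<lambda>x::nat\<Rightarrow>nat. x k) -` {fst p} \<inter> (\<lambda>x::nat\<Rightarrow>nat. x (Suc k)) -` {snd p}) = \<Lambda>"
    by (auto simp: shift_space_def)
  finally show ?thesis .
qed

lemma compact_shift_space: "compact \<Lambda>"
proof -
  have "compact (PiE UNIV (\<lambda>_::nat. {..<d}))"
    using compactin_PiE[of "\<lambda>_::nat. euclidean::nat topology" UNIV "\<lambda>_. {..<d}"]
    by (simp add: euclidean_product_topology finite_imp_compact)
  moreover have "\<Lambda> \<subseteq> PiE UNIV (\<lambda>_::nat. {..<d})" by (auto simp: shift_space_def)
  ultimately show ?thesis using closed_Int_compact[OF closed_shift_space] by (metis inf.absorb1)
qed

lemma cont_funs_const: "(\<lambda>x. c) \<in> cont_funs A"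
  by (simp add: cont_funs_def)

lemma cont_funs_cylinder: "(\<lambda>x. c * indicator (cylinder w) x) \<in> cont_funs A"
  unfolding cont_funs_def by (auto intro!: continuous_intros continuous_on_indicator_cylinder)

lemma cont_funs_add: "f \<in> cont_funs A \<Longrightarrow> g \<in> cont_funs A \<Longrightarrow> (\<lambda>x. f x + g x) \<in> cont_funs A"
  by (auto simp: cont_funs_def intro: continuous_intros)

lemma cont_funs_mult: "f \<in> cont_funs A \<Longrightarrow> g \<in> cont_funs A \<Longrightarrow> (\<lambda>x. f x * g x) \<in> cont_funs A"
  by (auto simp: cont_funs_def intro: continuous_intros)

lemma cont_funs_sum: "(\<And>i. i \<in> I \<Longrightarrow> f i \<in> cont_funs A) \<Longrightarrow> (\<lambda>x. \<Sum>i\<in>I. f i x) \<in> cont_funs A"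
  by (auto simp: cont_funs_def intro: continuous_on_sum)

lemma cont_funs_cong:
  assumes "\<And>x. x \<in> \<Lambda> \<Longrightarrow> f x = g x" shows "f \<in> cont_funs A \<longleftrightarrow> g \<in> cont_funs A"
  unfolding cont_funs_def using continuous_on_cong[of \<Lambda> \<Lambda> f g] assms by auto

lemma cont_funs_bounded:
  assumes "f \<in> cont_funs A" obtains B where "0 < B" "\<And>x. x \<in> \<Lambda> \<Longrightarrow> cmod (f x) \<le> B"
proof -
  have "compact (f ` \<Lambda>)"
    using compact_continuous_image compact_shift_space assms by (auto simp: cont_funs_def)
  then show ?thesis using that bounded_pos[of "f ` \<Lambda>"] compact_imp_bounded by auto
qed

lemma continuous_on_cons: "continuous_on S (case_nat i :: (nat \<Rightarrow> nat) \<Rightarrow> _)"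
proof (rule continuous_on_coordinatewise_then_product)
  fix k show "continuous_on S (\<lambda>x::nat\<Rightarrow>nat. case_nat i x k)"
    by (cases k) (auto intro: continuous_on_subset[OF continuous_on_product_coordinates])
qed

text \<open>The set of \<open>x\<close> on which the inverse branch \<open>x \<mapsto> ix\<close> is defined is clopen, so extending by zero
  keeps continuity.\<close>

lemma cont_funs_branch:
  assumes "f \<in> cont_funs A" "i < d"
  shows "(\<lambda>x. if follows i (x 0) then f (case_nat i x) else 0) \<in> cont_funs A"
proof -
  define S where "S = {j. j < d \<and> follows i j}"
  have op: "open ((\<lambda>x::nat\<Rightarrow>nat. x 0) -` T)" for T
    by (rule open_vimage) (auto intro: Topological_Spaces.open_discrete)
  have cl: "closed ((\<lambda>x::nat\<Rightarrow>nat. x 0) -` T)" for T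
    using op[of "- T"] by (simp add: closed_def vimage_Compl)
  have "continuous_on (\<Lambda> \<inter> ((\<lambda>x. x 0) -` S) \<union> \<Lambda> \<inter> ((\<lambda>x. x 0) -` (- S)))
      (\<lambda>x. if follows i (x 0) then f (case_nat i x) else 0)"
  proof (rule continuous_on_cases)
    show "closed (\<Lambda> \<inter> ((\<lambda>x. x 0) -` S))" "closed (\<Lambda> \<inter> ((\<lambda>x. x 0) -` (- S)))"
      using closed_shift_space cl by blast+
    show "continuous_on (\<Lambda> \<inter> ((\<lambda>x. x 0) -` S)) (\<lambda>x. f (case_nat i x))"
    proof (rule continuous_on_compose2[of \<Lambda> f])
      show "case_nat i ` (\<Lambda> \<inter> ((\<lambda>x. x 0) -` S)) \<subseteq> \<Lambda>"
        using assms(2) by (auto simp: shift_space_cons S_def)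
    qed (use assms in \<open>auto simp: cont_funs_def continuous_on_cons\<close>)
  qed (auto simp: S_def shift_space_less)
  then show ?thesis
    by (simp add: cont_funs_def Int_Un_distrib[symmetric] vimage_Un[symmetric])
qed

definition words :: "nat \<Rightarrow> nat list set" where
  "words n = {w. length w = n \<and> set w \<subseteq> {..<d}}"

lemma finite_words: "finite (words n)"
  unfolding words_def using finite_lists_length_eq[of "{..<d}" n] by (simp add: conj_commute)

lemma sum_cylinders:
  assumes "x \<in> \<Lambda>"
  shows "(\<Sum>w\<in>words n. c w * indicator (cylinder w) x) = (c (map x [0..<n]) :: complex)"
proof -
  have "x \<in> cylinder w \<longleftrightarrow> w = map x [0..<n]" if "w \<in> words n" for w
    using that by (auto simp: words_def cylinder_def list_eq_iff_nth_eq)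
  then have "(\<Sum>w\<in>words n. c w * indicator (cylinder w) x) =
      (\<Sum>w\<in>words n. if w = map x [0..<n] then c w else 0)"
    by (intro sum.cong) (auto simp: indicator_def)
  also have "\<dots> = c (map x [0..<n])"
    using shift_space_less[OF assms] by (simp add: finite_words) (auto simp: words_def)
  finally show ?thesis .
qed

text \<open>By compactness of \<open>\<Lambda>\<^sub>A\<close> a continuous function is uniformly close to a step function on
  cylinders: otherwise a sequence of pairs that agree on longer and longer prefixes has a common limit
  point.\<close>

lemma uniform_prefix_dependence:
  assumes f: "f \<in> cont_funs A" and e: "0 < e"
  shows "\<exists>n>0. \<forall>x\<in>\<Lambda>. \<forall>y\<in>\<Lambda>. (\<forall>k<n. x k = y k) \<longrightarrow> dist (f x) (f y) < e"
proof (rule ccontr)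
  assume "\<not> ?thesis"
  then have "\<exists>x y. x \<in> \<Lambda> \<and> y \<in> \<Lambda> \<and> (\<forall>k<Suc n. x k = y k) \<and> e \<le> dist (f x) (f y)" for n
    by (meson not_le zero_less_Suc)
  then obtain X Y where XY: "\<And>n. X n \<in> \<Lambda>" "\<And>n. Y n \<in> \<Lambda>"
    "\<And>n k. k < Suc n \<Longrightarrow> X n k = Y n k" "\<And>n. e \<le> dist (f (X n)) (f (Y n))"
    by metis
  obtain l r where l: "l \<in> \<Lambda>" and r: "strict_mono (r :: nat \<Rightarrow> nat)" and Xr: "(X \<circ> r) \<longlonglongrightarrow> l"
    by (rule seq_compactE[OF compact_imp_seq_compact[OF compact_shift_space], of X]) (use XY in auto)
  have Yr: "(Y \<circ> r) \<longlonglongrightarrow> l"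
    unfolding tendsto_sequence_iff
  proof
    fix k
    have eq: "\<forall>\<^sub>F n in sequentially. (X \<circ> r) n k = (Y \<circ> r) n k"
      using eventually_ge_at_top[of k]
    proof eventually_elim
      case (elim n)
      then have "k < Suc (r n)" using seq_suble[OF r, of n] by simp
      then show ?case using XY(3) by simp
    qed
    have "(\<lambda>n. (X \<circ> r) n k) \<longlonglongrightarrow> l k" using Xr unfolding tendsto_sequence_iff by blast
    then show "(\<lambda>n. (Y \<circ> r) n k) \<longlonglongrightarrow> l k" by (rule Lim_transform_eventually[OF _ eq])
  qed
  have "continuous_on \<Lambda> f" using f by (simp add: cont_funs_def)
  note lim = continuous_on_tendsto_compose[OF this _ l]
  have "(\<lambda>n. dist (f ((X \<circ> r) n)) (f ((Y \<circ> r) n))) \<longlonglongrightarrow> dist (f l) (f l)"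
    by (intro tendsto_dist lim Xr Yr) (use XY in auto)
  then have "e \<le> dist (f l) (f l)"
    by (rule LIMSEQ_le_const) (use XY(4) in auto)
  then show False using e by simp
qed

lemma step_function_approximation:
  assumes "f \<in> cont_funs A" "0 < e"
  shows "\<exists>n>0. \<exists>c. \<forall>x\<in>\<Lambda>. cmod (f x - (\<Sum>w\<in>words n. c w * indicator (cylinder w) x)) \<le> e"
proof -
  obtain n where n: "n > 0"
    "\<And>x y. x \<in> \<Lambda> \<Longrightarrow> y \<in> \<Lambda> \<Longrightarrow> (\<forall>k<n. x k = y k) \<Longrightarrow> dist (f x) (f y) < e"
    using uniform_prefix_dependence[OF assms] by blast
  define c where "c w = f (SOME y. y \<in> \<Lambda> \<and> map y [0..<n] = w)" for w
  show ?thesis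
  proof (intro exI conjI ballI)
    fix x assume x: "x \<in> \<Lambda>"
    define y where "y = (SOME y. y \<in> \<Lambda> \<and> map y [0..<n] = map x [0..<n])"
    have y: "y \<in> \<Lambda> \<and> map y [0..<n] = map x [0..<n]"
      unfolding y_def by (rule someI[of _ x]) (use x in simp)
    then have "x k = y k" if "k < n" for k
      using that by (auto simp: list_eq_iff_nth_eq)
    then have "dist (f x) (f y) < e" using y by (intro n(2)[OF x]) auto
    then show "cmod (f x - (\<Sum>w\<in>words n. c w * indicator (cylinder w) x)) \<le> e"
      unfolding sum_cylinders[OF x] by (simp add: c_def y_def dist_norm)
  qed (rule n(1))
qed

text \<open>Maps on \<open>C(\<Lambda>\<^sub>A)\<close> that are determined by their values on step functions, with values in
  \<open>\<complex>\<close> or in a C*-algebra. Asking for additivity only, and absorbing the coefficients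
  into the step functions, avoids a common notion of complex scalars for the two kinds of values.\<close>

definition sup_bounded_additive :: "(((nat \<Rightarrow> nat) \<Rightarrow> complex) \<Rightarrow> 'b::real_normed_vector) \<Rightarrow> bool" where
  "sup_bounded_additive T \<longleftrightarrow>
     (\<forall>f\<in>cont_funs A. \<forall>g\<in>cont_funs A. T (\<lambda>x. f x + g x) = T f + T g) \<and>
     (\<exists>K. \<forall>f\<in>cont_funs A. \<forall>B. (\<forall>x\<in>\<Lambda>. cmod (f x) \<le> B) \<longrightarrow> norm (T f) \<le> K * B)"

lemma sup_bounded_additiveI:
  assumes "\<And>f g. f \<in> cont_funs A \<Longrightarrow> g \<in> cont_funs A \<Longrightarrow> T (\<lambda>x. f x + g x) = T f + T g"
    and "\<And>f B. f \<in> cont_funs A \<Longrightarrow> (\<And>x. x \<in> \<Lambda> \<Longrightarrow> cmod (f x) \<le> B) \<Longrightarrow> norm (T f) \<le> K * B"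
  shows "sup_bounded_additive T"
  using assms unfolding sup_bounded_additive_def by blast

text \<open>Step functions on cylinders are uniformly dense, so identities on \<open>C(\<Lambda>\<^sub>A)\<close> only have to be
  checked on cylinders. Nonempty words suffice because step functions of any positive level
  are dense.\<close>

lemma cylinder_agreement:
  fixes T1 T2 :: "((nat \<Rightarrow> nat) \<Rightarrow> complex) \<Rightarrow> 'b::real_normed_vector"
  assumes T1: "sup_bounded_additive T1" and T2: "sup_bounded_additive T2"
    and agree: "\<And>c w. w \<noteq> [] \<Longrightarrow> set w \<subseteq> {..<d} \<Longrightarrow>
      T1 (\<lambda>x. c * indicator (cylinder w) x) = T2 (\<lambda>x. c * indicator (cylinder w) x)"
    and f: "f \<in> cont_funs A"
  shows "T1 f = T2 f"
proof -
  obtain K1 where K1: "\<And>f B. f \<in> cont_funs A \<Longrightarrow> (\<And>x. x \<in> \<Lambda> \<Longrightarrow> cmod (f x) \<le> B) \<Longrightarrow> norm (T1 f) \<le> K1 * B"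
    using T1 unfolding sup_bounded_additive_def by blast
  obtain K2 where K2: "\<And>f B. f \<in> cont_funs A \<Longrightarrow> (\<And>x. x \<in> \<Lambda> \<Longrightarrow> cmod (f x) \<le> B) \<Longrightarrow> norm (T2 f) \<le> K2 * B"
    using T2 unfolding sup_bounded_additive_def by blast
  have add: "T1 (\<lambda>x. f x + g x) = T1 f + T1 g" "T2 (\<lambda>x. f x + g x) = T2 f + T2 g"
    if "f \<in> cont_funs A" "g \<in> cont_funs A" for f g
    using T1 T2 that unfolding sup_bounded_additive_def by blast+
  have zero: "T1 (\<lambda>x. 0) = 0" "T2 (\<lambda>x. 0) = 0"
    using add[OF cont_funs_const[of 0] cont_funs_const[of 0]] by simp_all
  have step: "T1 (\<lambda>x. \<Sum>w\<in>W. c w * indicator (cylinder w) x) =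
      T2 (\<lambda>x. \<Sum>w\<in>W. c w * indicator (cylinder w) x)"
    if "finite W" "\<And>w. w \<in> W \<Longrightarrow> w \<noteq> [] \<and> set w \<subseteq> {..<d}" for W and c :: "nat list \<Rightarrow> complex"
    using that
  proof (induction W)
    case (insert w W)
    have w: "w \<noteq> []" "set w \<subseteq> {..<d}" using insert.prems by auto
    have "T1 (\<lambda>x. \<Sum>w\<in>W. c w * indicator (cylinder w) x) =
        T2 (\<lambda>x. \<Sum>w\<in>W. c w * indicator (cylinder w) x)"
      by (rule insert.IH) (use insert.prems in auto)
    then show ?case
      unfolding sum.insert[OF insert.hyps]
        add(1)[OF cont_funs_cylinder cont_funs_sum[OF cont_funs_cylinder]]
        add(2)[OF cont_funs_cylinder cont_funs_sum[OF cont_funs_cylinder]] agree[OF w] by simp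
  qed (simp add: zero)
  have "norm (T1 f - T2 f) \<le> 0 + e" if e: "0 < e" for e
  proof -
    define e' where "e' = e / (\<bar>K1\<bar> + \<bar>K2\<bar> + 1)"
    have pos: "0 < \<bar>K1\<bar> + \<bar>K2\<bar> + 1" by linarith
    then have e': "0 < e'" "(\<bar>K1\<bar> + \<bar>K2\<bar> + 1) * e' = e" using e by (auto simp: e'_def)
    obtain n c where n: "n > 0"
      "\<And>x. x \<in> \<Lambda> \<Longrightarrow> cmod (f x - (\<Sum>w\<in>words n. c w * indicator (cylinder w) x)) \<le> e'"
      using step_function_approximation[OF f e'(1)] by blast
    define g where "g x = (\<Sum>w\<in>words n. c w * indicator (cylinder w) x)" for x
    have g: "g \<in> cont_funs A" unfolding g_def by (intro cont_funs_sum cont_funs_cylinder)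
    have h: "(\<lambda>x. f x - g x) \<in> cont_funs A"
      using f g by (auto simp: cont_funs_def intro: continuous_intros)
    have "T1 g = T2 g" unfolding g_def
      by (rule step[OF finite_words]) (use n(1) in \<open>auto simp: words_def\<close>)
    moreover have "T1 f = T1 (\<lambda>x. f x - g x) + T1 g" "T2 f = T2 (\<lambda>x. f x - g x) + T2 g"
      using add[OF h g] by simp_all
    ultimately have "T1 f - T2 f = T1 (\<lambda>x. f x - g x) - T2 (\<lambda>x. f x - g x)" by simp
    also have "norm \<dots> \<le> K1 * e' + K2 * e'"
    proof -
      have *: "\<And>x. x \<in> \<Lambda> \<Longrightarrow> cmod (f x - g x) \<le> e'" using n(2) by (simp add: g_def)
      show ?thesis
        using K1[OF h *] K2[OF h *] norm_triangle_ineq4[of "T1 (\<lambda>x. f x - g x)" "T2 (\<lambda>x. f x - g x)"]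
        by simp
    qed
    also have "\<dots> = (K1 + K2) * e'" by (simp add: algebra_simps)
    also have "\<dots> \<le> (\<bar>K1\<bar> + \<bar>K2\<bar> + 1) * e'" using e'(1) by (intro mult_right_mono) auto
    finally show ?thesis using e'(2) by simp
  qed
  then have "norm (T1 f - T2 f) \<le> 0" by (rule field_le_epsilon)
  then show ?thesis by simp
qed

end

context markov_shift
begin

lemma sup_bounded_additive_add:
  assumes "sup_bounded_additive T" "f \<in> cont_funs A" "g \<in> cont_funs A"
  shows "T (\<lambda>x. f x + g x) = T f + T g"
  using assms(1) unfolding sup_bounded_additive_def by (rule conjE) (use assms(2,3) in auto)

lemma sup_bounded_additive_cong:
  assumes T: "sup_bounded_additive T" and f: "f \<in> cont_funs A" and eq: "\<And>x. x \<in> \<Lambda> \<Longrightarrow> f x = g x"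
  shows "T f = T g"
proof -
  obtain K where K: "\<And>f B. f \<in> cont_funs A \<Longrightarrow> (\<And>x. x \<in> \<Lambda> \<Longrightarrow> cmod (f x) \<le> B) \<Longrightarrow> norm (T f) \<le> K * B"
    using T unfolding sup_bounded_additive_def by blast
  have g: "g \<in> cont_funs A" using cont_funs_cong[of f g] eq f by blast
  have h: "(\<lambda>x. f x - g x) \<in> cont_funs A" using f g by (auto simp: cont_funs_def intro: continuous_intros)
  have "T (\<lambda>x. (f x - g x) + g x) = T (\<lambda>x. f x - g x) + T g"
    by (rule sup_bounded_additive_add[OF T h g])
  moreover have "norm (T (\<lambda>x. f x - g x)) \<le> K * 0" by (rule K[OF h]) (simp add: eq)
  ultimately show ?thesis by simp
qed

definition clopens :: "(nat \<Rightarrow> nat) set set" where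
  "clopens = {C. C \<subseteq> \<Lambda> \<and> (indicator C :: _ \<Rightarrow> complex) \<in> cont_funs A}"

lemma clopens_closed: assumes "C \<in> clopens" shows "closed C"
proof -
  have "closed (\<Lambda> \<inter> (indicator C :: _ \<Rightarrow> complex) -` {1})"
    using assms by (intro continuous_closed_preimage closed_shift_space) (auto simp: clopens_def cont_funs_def)
  moreover have "\<Lambda> \<inter> (indicator C :: _ \<Rightarrow> complex) -` {1} = C"
    using assms by (auto simp: clopens_def indicator_def split: if_splits)
  ultimately show ?thesis by simp
qed

lemma clopens_coordinate: "{x \<in> \<Lambda>. x k \<in> S} \<in> clopens"
proof -
  have "continuous_on \<Lambda> ((indicator S :: nat \<Rightarrow> complex) \<circ> (\<lambda>x. x k))"
    by (intro continuous_on_compose continuous_on_subset[OF continuous_on_product_coordinates])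
      simp_all
  then have "((indicator S :: nat \<Rightarrow> complex) \<circ> (\<lambda>x. x k)) \<in> cont_funs A"
    by (simp add: cont_funs_def)
  moreover have "((indicator S :: nat \<Rightarrow> complex) \<circ> (\<lambda>x. x k)) x = indicator {x \<in> \<Lambda>. x k \<in> S} x"
    if "x \<in> \<Lambda>" for x using that by (simp add: indicator_def)
  ultimately show ?thesis
    unfolding clopens_def using cont_funs_cong by blast
qed

lemma clopens_cylinder: "cylinder w \<inter> \<Lambda> \<in> clopens"
proof -
  have "(indicator (cylinder w) :: _ \<Rightarrow> complex) \<in> cont_funs A"
    by (simp add: cont_funs_def continuous_on_indicator_cylinder)
  moreover have "(indicator (cylinder w) x :: complex) = indicator (cylinder w \<inter> \<Lambda>) x"
    if "x \<in> \<Lambda>" for x using that by (simp add: indicator_def)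
  ultimately show ?thesis
    unfolding clopens_def using cont_funs_cong by blast
qed

lemma clopens_Int: assumes "C \<in> clopens" "D \<in> clopens" shows "C \<inter> D \<in> clopens"
proof -
  have "(\<lambda>x. indicator C x * indicator D x :: complex) \<in> cont_funs A"
    using assms by (intro cont_funs_mult) (auto simp: clopens_def)
  moreover have "(\<lambda>x. indicator C x * indicator D x :: complex) = indicator (C \<inter> D)"
    by (auto simp: indicator_def)
  ultimately show ?thesis using assms by (auto simp: clopens_def)
qed

lemma clopens_Diff: assumes "C \<in> clopens" "D \<in> clopens" shows "C - D \<in> clopens"
proof -
  have "(\<lambda>x. indicator C x + (- 1) * (indicator C x * indicator D x) :: complex) \<in> cont_funs A"
    using assms by (intro cont_funs_add cont_funs_mult cont_funs_const) (auto simp: clopens_def)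
  moreover have "(\<lambda>x. indicator C x + (- 1) * (indicator C x * indicator D x) :: complex) = indicator (C - D)"
    by (auto simp: indicator_def)
  ultimately show ?thesis using assms by (auto simp: clopens_def)
qed

lemma clopens_space: "\<Lambda> \<in> clopens"
  using clopens_coordinate[of 0 UNIV] by simp

lemma ring_of_sets_clopens: "ring_of_sets \<Lambda> clopens"
proof -
  have empty: "{} \<in> clopens" using clopens_coordinate[of 0 "{}"] by simp
  have "C \<union> D \<in> clopens" if "C \<in> clopens" "D \<in> clopens" for C D
  proof -
    have "\<Lambda> - ((\<Lambda> - C) \<inter> (\<Lambda> - D)) \<in> clopens"
      using that by (intro clopens_Diff clopens_Int clopens_space)
    moreover have "\<Lambda> - ((\<Lambda> - C) \<inter> (\<Lambda> - D)) = C \<union> D" using that by (auto simp: clopens_def)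
    ultimately show ?thesis by simp
  qed
  then show ?thesis
    unfolding ring_of_sets_iff using empty clopens_Diff by (auto simp: clopens_def)
qed

text \<open>The coordinates, hence the identity into the Borel space of sequences, are measurable for the
  \<open>\<sigma>\<close>-algebra generated by the clopen sets.\<close>

lemma sigma_sets_clopens: "sigma_sets \<Lambda> clopens = sets (restrict_space borel \<Lambda>)"
proof
  have "clopens \<subseteq> sets (restrict_space borel \<Lambda>)"
  proof
    fix C assume C: "C \<in> clopens"
    then have "C = C \<inter> \<Lambda>" by (auto simp: clopens_def)
    moreover have "C \<in> sets borel" using clopens_closed[OF C] by simp
    ultimately show "C \<in> sets (restrict_space borel \<Lambda>)"
      by (auto simp: sets_restrict_space)
  qed
  from sets.sigma_sets_subset[OF this]
  show "sigma_sets \<Lambda> clopens \<subseteq> sets (restrict_space borel \<Lambda>)" by (simp add: space_restrict_space)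
next
  define N where "N = sigma \<Lambda> clopens"
  have sub: "clopens \<subseteq> Pow \<Lambda>" by (auto simp: clopens_def)
  have N: "space N = \<Lambda>" "sets N = sigma_sets \<Lambda> clopens" using sub by (auto simp: N_def)
  have "(\<lambda>x. x) \<in> borel_measurable N"
  proof (rule measurable_coordinatewise_then_product, rule borel_measurableI)
    fix k and S :: "nat set"
    have "(\<lambda>x. x k) -` S \<inter> space N = {x \<in> \<Lambda>. x k \<in> S}" by (auto simp: N)
    then show "(\<lambda>x. x k) -` S \<inter> space N \<in> sets N"
      using clopens_coordinate by (simp add: N sigma_sets.Basic)
  qed
  then have "B \<inter> \<Lambda> \<in> sigma_sets \<Lambda> clopens" if "B \<in> sets borel" for B
    using measurable_sets[OF _ that, of "\<lambda>x. x" N] by (simp add: N)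
  then show "sets (restrict_space borel \<Lambda>) \<subseteq> sigma_sets \<Lambda> clopens"
    by (auto simp: sets_restrict_space Int_commute)
qed

context
  fixes \<mu> assumes \<mu>: "\<mu> \<in> prob_measures A"
begin

lemma prob_measures_sets: "sets \<mu> = sets (restrict_space borel \<Lambda>)"
  using \<mu> by (simp add: prob_measures_def)

lemma prob_measures_space: "space \<mu> = \<Lambda>"
  using sets_eq_imp_space_eq[OF prob_measures_sets] by (simp add: space_restrict_space)

lemma prob_measures_prob_space: "prob_space \<mu>"
  using \<mu> by (simp add: prob_measures_def)

lemma cont_funs_integrable:
  assumes "f \<in> cont_funs A" shows "integrable \<mu> f"
proof -
  interpret prob_space \<mu> by (rule prob_measures_prob_space)
  obtain B where B: "\<And>x. x \<in> \<Lambda> \<Longrightarrow> cmod (f x) \<le> B" using cont_funs_bounded[OF assms] by blast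
  have "f \<in> borel_measurable (restrict_space borel \<Lambda>)"
    using assms by (intro borel_measurable_continuous_on_restrict) (simp add: cont_funs_def)
  then have "f \<in> borel_measurable \<mu>"
    using measurable_cong_sets[OF prob_measures_sets refl] by blast
  then show ?thesis using B by (intro integrable_const_bound[where B = B]) (auto simp: prob_measures_space)
qed

lemma functional_of_cong: "(\<And>x. x \<in> \<Lambda> \<Longrightarrow> f x = g x) \<Longrightarrow> functional_of \<mu> f = functional_of \<mu> g"
  unfolding functional_of_def by (intro Bochner_Integration.integral_cong) (auto simp: prob_measures_space)

lemma functional_of_add:
  "f \<in> cont_funs A \<Longrightarrow> g \<in> cont_funs A \<Longrightarrow>
    functional_of \<mu> (\<lambda>x. f x + g x) = functional_of \<mu> f + functional_of \<mu> g"
  unfolding functional_of_def using cont_funs_integrable by (intro Bochner_Integration.integral_add) auto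

lemma functional_of_scale: "functional_of \<mu> (\<lambda>x. c * f x) = c * functional_of \<mu> f"
  unfolding functional_of_def by simp

lemma functional_of_norm_le:
  assumes "f \<in> cont_funs A" "\<And>x. x \<in> \<Lambda> \<Longrightarrow> cmod (f x) \<le> B"
  shows "cmod (functional_of \<mu> f) \<le> B"
proof -
  interpret prob_space \<mu> by (rule prob_measures_prob_space)
  have "cmod (functional_of \<mu> f) \<le> (\<integral>x. cmod (f x) \<partial>\<mu>)"
    unfolding functional_of_def by (rule integral_norm_bound)
  also have "\<dots> \<le> (\<integral>x. B \<partial>\<mu>)"
    using assms cont_funs_integrable by (intro integral_mono) (auto simp: prob_measures_space)
  finally show ?thesis by (simp add: prob_space)
qed

lemma functional_of_sup_bounded_additive: "sup_bounded_additive (functional_of \<mu>)"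
  by (rule sup_bounded_additiveI[where K = 1]) (auto simp: functional_of_add functional_of_norm_le)

lemma functional_of_clopen:
  assumes "C \<in> clopens" shows "functional_of \<mu> (indicator C) = of_real (measure \<mu> C)"
proof -
  interpret prob_space \<mu> by (rule prob_measures_prob_space)
  have "C \<in> sets \<mu>"
    using assms sigma_sets_clopens prob_measures_sets by (auto intro: sigma_sets.Basic)
  moreover from this have "C \<inter> space \<mu> = C" using sets.sets_into_space by blast
  ultimately have "(\<integral>x. indicator C x *\<^sub>R (1::complex) \<partial>\<mu>) = measure \<mu> C *\<^sub>R 1"
    by (subst integral_scaleR_left) (auto simp: emeasure_eq_measure)
  moreover have "(\<lambda>x. indicator C x *\<^sub>R (1::complex)) = indicator C" by (auto simp: indicator_def)
  ultimately show ?thesis by (simp add: functional_of_def of_real_def)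
qed

end

text \<open>The clopen sets are a generator of the Borel sets that is closed under intersections, and their
  indicators are continuous.\<close>

lemma prob_measures_eqI:
  assumes \<mu>: "\<mu> \<in> prob_measures A" and \<nu>: "\<nu> \<in> prob_measures A"
    and eq: "\<And>f. f \<in> cont_funs A \<Longrightarrow> functional_of \<mu> f = functional_of \<nu> f"
  shows "\<mu> = \<nu>"
proof (rule measure_eqI_generator_eq[where \<Omega> = \<Lambda> and E = clopens and A = "\<lambda>_. \<Lambda>"])
  show "Int_stable clopens" by (auto simp: Int_stable_def clopens_Int)
  show "clopens \<subseteq> Pow \<Lambda>" by (auto simp: clopens_def)
  interpret m: prob_space \<mu> by (rule prob_measures_prob_space[OF \<mu>])
  interpret n: prob_space \<nu> by (rule prob_measures_prob_space[OF \<nu>])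
  fix C assume C: "C \<in> clopens"
  then have "indicator C \<in> cont_funs A" by (simp add: clopens_def)
  from eq[OF this] show "emeasure \<mu> C = emeasure \<nu> C"
    using functional_of_clopen[OF \<mu> C] functional_of_clopen[OF \<nu> C]
    by (simp add: m.emeasure_eq_measure n.emeasure_eq_measure)
next
  interpret m: prob_space \<mu> by (rule prob_measures_prob_space[OF \<mu>])
  show "emeasure \<mu> \<Lambda> \<noteq> \<infinity>" by simp
qed (use clopens_space sigma_sets_clopens prob_measures_sets[OF \<mu>] prob_measures_sets[OF \<nu>] in auto)

text \<open>Riesz representation on the zero-dimensional space \<open>\<Lambda>\<^sub>A\<close>: the functional is a finitely
  additive set function on the clopen sets, and by compactness a decreasing sequence of clopen sets
  with empty intersection is eventually empty, so Caratheodory's theorem applies.\<close>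

lemma shift_space_Riesz:
  fixes \<Phi> :: "((nat \<Rightarrow> nat) \<Rightarrow> complex) \<Rightarrow> complex"
  assumes sba: "sup_bounded_additive \<Phi>"
    and scale: "\<And>c f. f \<in> cont_funs A \<Longrightarrow> \<Phi> (\<lambda>x. c * f x) = c * \<Phi> f"
    and nonneg: "\<And>C. C \<in> clopens \<Longrightarrow> \<Phi> (indicator C) \<in> \<real>\<^sub>\<ge>\<^sub>0"
    and one: "\<Phi> (\<lambda>x. 1) = 1"
  shows "\<exists>\<mu>\<in>prob_measures A. \<forall>f\<in>cont_funs A. \<Phi> f = functional_of \<mu> f"
proof -
  define m where "m C = Re (\<Phi> (indicator C))" for C
  have m: "\<Phi> (indicator C) = of_real (m C)" "0 \<le> m C" if "C \<in> clopens" for C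
    using nonneg[OF that] by (auto simp: m_def complex_nonneg_Reals_iff complex_eq_iff)
  have ind: "indicator C \<in> cont_funs A" if "C \<in> clopens" for C
    using that by (simp add: clopens_def)
  have add: "m (C \<union> D) = m C + m D" if "C \<in> clopens" "D \<in> clopens" "C \<inter> D = {}" for C D
  proof -
    have "(indicator (C \<union> D) :: _ \<Rightarrow> complex) = (\<lambda>x. indicator C x + indicator D x)"
      using that by (intro ext) (auto simp: indicator_def)
    then show ?thesis
      using sup_bounded_additive_add[OF sba ind ind] that by (simp add: m_def)
  qed
  have empty: "{} \<in> clopens" using clopens_coordinate[of 0 "{}"] by simp
  then have m0: "m {} = 0" using add[of "{}" "{}"] by simp
  interpret ring_of_sets \<Lambda> clopens by (rule ring_of_sets_clopens)
  have "\<exists>\<mu>::_ \<Rightarrow> ennreal. (\<forall>C\<in>clopens. \<mu> C = ennreal (m C)) \<and> measure_space \<Lambda> (sigma_sets \<Lambda> clopens) \<mu>"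
  proof (rule caratheodory_empty_continuous)
    show "positive clopens (\<lambda>C. ennreal (m C))" by (simp add: positive_def m0)
    show "additive clopens (\<lambda>C. ennreal (m C))"
      using m(2) by (auto simp: additive_def add ennreal_plus)
    show "ennreal (m C) \<noteq> \<infinity>" for C by simp
    fix C :: "nat \<Rightarrow> _" assume C: "range C \<subseteq> clopens" "decseq C" "(\<Inter>i. C i) = {}"
    have "\<exists>N. C N = {}"
    proof (rule ccontr)
      assume nonempty: "\<nexists>N. C N = {}"
      have "\<Lambda> \<inter> \<Inter>(range C) \<noteq> {}"
      proof (rule compact_imp_fip[OF compact_shift_space])
        show "closed T" if "T \<in> range C" for T using that C(1) clopens_closed by blast
        fix F' assume F': "finite F'" "F' \<subseteq> range C"
        then obtain I where I: "finite I" "F' = C ` I" using finite_subset_image by (metis subset_UNIV)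
        have "C (Max (insert 0 I)) \<subseteq> \<Lambda> \<inter> \<Inter>F'"
        proof -
          have "C (Max (insert 0 I)) \<subseteq> C i" if "i \<in> I" for i
            using C(2) I(1) that unfolding decseq_def by (auto intro: Max_ge)
          moreover have "C (Max (insert 0 I)) \<subseteq> \<Lambda>" using C(1) by (auto simp: clopens_def)
          ultimately show ?thesis using I(2) by blast
        qed
        then show "\<Lambda> \<inter> \<Inter>F' \<noteq> {}" using nonempty by blast
      qed
      then show False using C(3) by blast
    qed
    then obtain N where "C N = {}" by blast
    then have "C i = {}" if "i \<ge> N" for i using C(2) that unfolding decseq_def by blast
    then have "\<forall>\<^sub>F i in sequentially. ennreal (m (C i)) = 0"
      unfolding eventually_sequentially using m0 by (intro exI[of _ N]) simp
    then show "(\<lambda>i. ennreal (m (C i))) \<longlonglongrightarrow> 0" by (rule tendsto_eventually)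
  qed
  then obtain \<mu>0 :: "_ \<Rightarrow> ennreal" where \<mu>0: "\<And>C. C \<in> clopens \<Longrightarrow> \<mu>0 C = ennreal (m C)"
    "measure_space \<Lambda> (sigma_sets \<Lambda> clopens) \<mu>0" by blast
  define \<mu> where "\<mu> = measure_of \<Lambda> clopens \<mu>0"
  have sub: "clopens \<subseteq> Pow \<Lambda>" by (auto simp: clopens_def)
  have sets: "sets \<mu> = sigma_sets \<Lambda> clopens" using sub by (simp add: \<mu>_def)
  have em: "emeasure \<mu> C = ennreal (m C)" if "C \<in> clopens" for C
  proof -
    have "emeasure \<mu> C = \<mu>0 C"
      using \<mu>0(2) that
      by (intro emeasure_measure_of[OF \<mu>_def sub]) (auto simp: sets measure_space_def intro: sigma_sets.Basic)
    then show ?thesis using \<mu>0(1) that by simp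
  qed
  have "m \<Lambda> = 1"
  proof -
    have "\<Phi> (\<lambda>x. 1) = \<Phi> (indicator \<Lambda>)"
      by (rule sup_bounded_additive_cong[OF sba cont_funs_const]) simp
    then show ?thesis using one by (simp add: m_def)
  qed
  then have "prob_space \<mu>"
    using em[OF clopens_space] sub by (intro prob_spaceI) (simp add: \<mu>_def)
  then have \<mu>: "\<mu> \<in> prob_measures A"
    by (simp add: prob_measures_def sets sigma_sets_clopens)
  have "\<Phi> f = functional_of \<mu> f" if f: "f \<in> cont_funs A" for f
  proof (rule cylinder_agreement[OF sba functional_of_sup_bounded_additive[OF \<mu>] _ f])
    fix c and w :: "nat list"
    have ic: "(indicator (cylinder w) :: _ \<Rightarrow> complex) \<in> cont_funs A"
      by (simp add: cont_funs_def continuous_on_indicator_cylinder)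
    have e: "(indicator (cylinder w) x :: complex) = indicator (cylinder w \<inter> \<Lambda>) x" if "x \<in> \<Lambda>" for x
      using that by (simp add: indicator_def)
    have "\<Phi> (indicator (cylinder w)) = \<Phi> (indicator (cylinder w \<inter> \<Lambda>))"
      by (rule sup_bounded_additive_cong[OF sba ic e])
    also have "\<dots> = of_real (measure \<mu> (cylinder w \<inter> \<Lambda>))"
      using m[OF clopens_cylinder] em[OF clopens_cylinder] by (simp add: measure_def)
    also have "\<dots> = functional_of \<mu> (indicator (cylinder w \<inter> \<Lambda>))"
      by (rule functional_of_clopen[OF \<mu> clopens_cylinder, symmetric])
    also have "\<dots> = functional_of \<mu> (indicator (cylinder w))"
      by (rule functional_of_cong[OF \<mu> e[symmetric]])
    finally show "\<Phi> (\<lambda>x. c * indicator (cylinder w) x) = functional_of \<mu> (\<lambda>x. c * indicator (cylinder w) x)"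
      by (simp only: scale[OF ic] functional_of_scale[OF \<mu>])
  qed
  then show ?thesis using \<mu> by blast
qed

end

section \<open>A representation on functions on \<open>\<Lambda>\<^sub>A \<times> \<int>\<close>\<close>

context markov_shift
begin

type_synonym vec = "(nat \<Rightarrow> nat) \<times> int \<Rightarrow> complex"

definition supp :: "vec \<Rightarrow> ((nat \<Rightarrow> nat) \<times> int) set" where "supp f = {p. f p \<noteq> 0}"

text \<open>A dense subspace of \<open>\<ell>\<^sup>2(\<Lambda>\<^sub>A \<times> \<int>)\<close>. An operator seminorm does not see the completion, so the
  finitely supported functions are enough. The integer coordinate records the degree; without it
  words in the generators would have nonzero diagonal matrix entries at periodic points.\<close>

definition vecs :: "vec set" where "vecs = {f. finite (supp f) \<and> fst ` supp f \<subseteq> \<Lambda>}"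

definition push :: "nat \<Rightarrow> (nat \<Rightarrow> nat) \<times> int \<Rightarrow> (nat \<Rightarrow> nat) \<times> int" where
  "push i p = (case_nat i (fst p), snd p + 1)"

definition pop :: "(nat \<Rightarrow> nat) \<times> int \<Rightarrow> (nat \<Rightarrow> nat) \<times> int" where
  "pop p = (fst p \<circ> Suc, snd p - 1)"

text \<open>The images of \<open>s\<^sub>i\<close> and \<open>s\<^sub>i\<^sup>*\<close>: \<open>creation i\<close> sends the point mass at \<open>p\<close> to that at
  \<open>push i p\<close>, or to zero if \<open>push i p\<close> leaves \<open>\<Lambda>\<^sub>A \<times> \<int>\<close>.\<close>

definition creation :: "nat \<Rightarrow> vec \<Rightarrow> vec" where
  "creation i f p = (if fst p \<in> \<Lambda> \<and> fst p 0 = i then f (pop p) else 0)"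

definition annihilation :: "nat \<Rightarrow> vec \<Rightarrow> vec" where
  "annihilation i f p = (if fst (push i p) \<in> \<Lambda> then f (push i p) else 0)"

lemma pop_push [simp]: "pop (push i p) = p"
  by (simp add: pop_def push_def o_def prod_eq_iff)

lemma push_zero [simp]: "fst (push i p) 0 = i"
  by (simp add: push_def)

lemma push_pop: "fst p 0 = i \<Longrightarrow> push i (pop p) = p"
  by (auto simp: pop_def push_def prod_eq_iff fun_eq_iff split: nat.split)

lemma inj_push: "inj (push i)"
  by (rule inj_on_inverseI[where g = pop]) simp

lemma fst_push: "fst (push i p) \<in> \<Lambda> \<longleftrightarrow> i < d \<and> follows i (fst p 0) \<and> fst p \<in> \<Lambda>"
  by (simp add: push_def shift_space_cons)

lemma creation_push: "creation i f (push i p) = (if fst (push i p) \<in> \<Lambda> then f p else 0)"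
  by (simp add: creation_def)

lemma supp_annihilation: "push i ` supp (annihilation i f) = {p \<in> supp f. fst p \<in> \<Lambda> \<and> fst p 0 = i}"
proof (intro equalityI subsetI)
  fix p assume p: "p \<in> {p \<in> supp f. fst p \<in> \<Lambda> \<and> fst p 0 = i}"
  then have "pop p \<in> supp (annihilation i f)"
    by (simp add: supp_def annihilation_def push_pop)
  then show "p \<in> push i ` supp (annihilation i f)"
    using p push_pop[of p i] by (metis (mono_tags, lifting) image_eqI mem_Collect_eq)
qed (auto simp: supp_def annihilation_def split: if_splits)

lemma supp_creation: "supp (creation i f) \<subseteq> push i ` supp f"
proof
  fix p assume "p \<in> supp (creation i f)"
  then have p: "fst p 0 = i" "pop p \<in> supp f" by (auto simp: supp_def creation_def split: if_splits)
  then show "p \<in> push i ` supp f" using push_pop[of p i] by (metis image_eqI)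
qed

lemma creation_vecs: "f \<in> vecs \<Longrightarrow> creation i f \<in> vecs"
  unfolding vecs_def using finite_subset[OF supp_creation]
  by (auto simp: supp_def creation_def split: if_splits)

lemma annihilation_vecs: "f \<in> vecs \<Longrightarrow> annihilation i f \<in> vecs"
proof -
  assume f: "f \<in> vecs"
  have "finite (push i ` supp (annihilation i f))"
    unfolding supp_annihilation using f by (auto simp: vecs_def)
  then have "finite (supp (annihilation i f))" by (rule finite_imageD[OF _ inj_on_subset[OF inj_push]]) simp
  moreover have "fst ` supp (annihilation i f) \<subseteq> \<Lambda>"
    by (auto simp: supp_def annihilation_def fst_push split: if_splits)
  ultimately show ?thesis by (simp add: vecs_def)
qed

text \<open>Summing over the support of the second argument makes the form linear in an arbitrary first
  argument.\<close>

definition inner :: "vec \<Rightarrow> vec \<Rightarrow> complex" where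
  "inner f g = (\<Sum>p\<in>supp g. f p * cnj (g p))"

definition vnorm :: "vec \<Rightarrow> real" where "vnorm f = L2_set (\<lambda>p. cmod (f p)) (supp f)"

lemma inner_superset: "finite S \<Longrightarrow> supp g \<subseteq> S \<Longrightarrow> inner f g = (\<Sum>p\<in>S. f p * cnj (g p))"
  unfolding inner_def by (intro sum.mono_neutral_left) (auto simp: supp_def)

lemma vnorm_superset: "finite S \<Longrightarrow> supp f \<subseteq> S \<Longrightarrow> vnorm f = L2_set (\<lambda>p. cmod (f p)) S"
  unfolding vnorm_def L2_set_def
  by (intro arg_cong[where f = sqrt] sum.mono_neutral_left) (auto simp: supp_def)

lemma vnorm_nonneg [simp]: "0 \<le> vnorm f" by (simp add: vnorm_def L2_set_nonneg)

lemma inner_commute: "f \<in> vecs \<Longrightarrow> g \<in> vecs \<Longrightarrow> inner g f = cnj (inner f g)"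
  by (simp add: vecs_def inner_superset[of "supp f \<union> supp g"] mult.commute)

lemma inner_self: "inner f f = of_real ((vnorm f)\<^sup>2)"
  by (simp add: inner_def vnorm_def L2_set_def sum_nonneg complex_norm_square del: of_real_power)

lemma inner_norm_le:
  assumes "f \<in> vecs" "g \<in> vecs" shows "cmod (inner f g) \<le> vnorm f * vnorm g"
proof -
  let ?S = "supp f \<union> supp g"
  have fin: "finite ?S" using assms by (simp add: vecs_def)
  have "cmod (inner f g) \<le> (\<Sum>p\<in>?S. \<bar>cmod (f p)\<bar> * \<bar>cmod (g p)\<bar>)"
    unfolding inner_superset[OF fin Un_upper2] by (rule order_trans[OF norm_sum]) (simp add: norm_mult)
  also have "\<dots> \<le> vnorm f * vnorm g"
    unfolding vnorm_superset[OF fin Un_upper1] vnorm_superset[OF fin Un_upper2]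
    by (rule L2_set_mult_ineq)
  finally show ?thesis .
qed

lemma vnorm_add:
  assumes "f \<in> vecs" "g \<in> vecs" shows "vnorm (\<lambda>p. f p + g p) \<le> vnorm f + vnorm g"
proof -
  let ?S = "supp f \<union> supp g"
  have fin: "finite ?S" using assms by (simp add: vecs_def)
  have "supp (\<lambda>p. f p + g p) \<subseteq> ?S" by (auto simp: supp_def)
  then have "vnorm (\<lambda>p. f p + g p) = L2_set (\<lambda>p. cmod (f p + g p)) ?S" by (rule vnorm_superset[OF fin])
  also have "\<dots> \<le> L2_set (\<lambda>p. cmod (f p) + cmod (g p)) ?S"
    by (intro L2_set_mono norm_triangle_ineq) simp
  also have "\<dots> \<le> L2_set (\<lambda>p. cmod (f p)) ?S + L2_set (\<lambda>p. cmod (g p)) ?S"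
    by (rule L2_set_triangle_ineq)
  finally show ?thesis
    unfolding vnorm_superset[OF fin Un_upper1] vnorm_superset[OF fin Un_upper2] .
qed

lemma vecs_zero: "(\<lambda>p. 0) \<in> vecs" by (simp add: vecs_def supp_def)

lemma vnorm_zero: "vnorm (\<lambda>p. 0) = 0" by (simp add: vnorm_def supp_def)

lemma vecs_scale: "f \<in> vecs \<Longrightarrow> (\<lambda>p. c * f p) \<in> vecs"
  by (auto simp: vecs_def supp_def)

lemma vnorm_scale: "f \<in> vecs \<Longrightarrow> vnorm (\<lambda>p. c * f p) = cmod c * vnorm f"
proof -
  assume f: "f \<in> vecs"
  have "supp (\<lambda>p. c * f p) \<subseteq> supp f" by (auto simp: supp_def)
  then have "vnorm (\<lambda>p. c * f p) = L2_set (\<lambda>p. cmod c * cmod (f p)) (supp f)"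
    using f by (simp add: vnorm_superset[of "supp f"] vecs_def norm_mult)
  then show ?thesis by (simp add: vnorm_def L2_set_right_distrib)
qed

lemma vecs_add: "f \<in> vecs \<Longrightarrow> g \<in> vecs \<Longrightarrow> (\<lambda>p. f p + g p) \<in> vecs"
proof -
  have "supp (\<lambda>p. f p + g p) \<subseteq> supp f \<union> supp g" by (auto simp: supp_def)
  then show "f \<in> vecs \<Longrightarrow> g \<in> vecs \<Longrightarrow> ?thesis"
    unfolding vecs_def using finite_subset by blast
qed

lemma vecs_sum:
  assumes "\<And>j. j \<in> J \<Longrightarrow> f j \<in> vecs" shows "(\<lambda>p. \<Sum>j\<in>J. c j * f j p) \<in> vecs"
  using assms
proof (induction J rule: infinite_finite_induct)
  case (insert j J)
  then show ?case using vecs_add[OF vecs_scale[of "f j" "c j"]] by simp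
qed (simp_all add: vecs_zero)

text \<open>Both sides are sums over the same partial bijection \<open>push i\<close>, read in the two directions.\<close>

lemma inner_creation:
  assumes "g \<in> vecs" shows "inner (creation i f) g = inner f (annihilation i g)"
proof -
  have "inner (creation i f) g = (\<Sum>p\<in>push i ` supp (annihilation i g). creation i f p * cnj (g p))"
    unfolding inner_def supp_annihilation
    by (rule sum.mono_neutral_right) (use assms in \<open>auto simp: vecs_def creation_def\<close>)
  also have "\<dots> = (\<Sum>p\<in>supp (annihilation i g). creation i f (push i p) * cnj (g (push i p)))"
    by (rule sum.reindex[OF inj_on_subset[OF inj_push subset_UNIV], unfolded o_def])
  also have "\<dots> = inner f (annihilation i g)"
    unfolding inner_def by (rule sum.cong) (auto simp: creation_push annihilation_def supp_def)
  finally show ?thesis .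
qed

lemma inner_annihilation:
  assumes "f \<in> vecs" "g \<in> vecs" shows "inner (annihilation i f) g = inner f (creation i g)"
  using inner_commute[of "annihilation i f" g] inner_commute[of "creation i g" f]
    inner_creation[OF assms(1), of i g] annihilation_vecs creation_vecs assms
  by (metis complex_cnj_cnj)

lemma vnorm_annihilation: assumes "f \<in> vecs" shows "vnorm (annihilation i f) \<le> vnorm f"
proof -
  have "(\<Sum>p\<in>supp (annihilation i f). (cmod (annihilation i f p))\<^sup>2)
      = (\<Sum>p\<in>supp (annihilation i f). (cmod (f (push i p)))\<^sup>2)"
    by (rule sum.cong) (auto simp: annihilation_def supp_def)
  also have "\<dots> = (\<Sum>p\<in>push i ` supp (annihilation i f). (cmod (f p))\<^sup>2)"
    by (rule sum.reindex[OF inj_on_subset[OF inj_push subset_UNIV], unfolded o_def, symmetric])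
  also have "\<dots> \<le> (\<Sum>p\<in>supp f. (cmod (f p))\<^sup>2)"
    unfolding supp_annihilation using assms by (intro sum_mono2) (auto simp: vecs_def)
  finally show ?thesis by (simp add: vnorm_def L2_set_def)
qed

text \<open>The adjoint of a contraction is a contraction.\<close>

lemma vnorm_creation: assumes "f \<in> vecs" shows "vnorm (creation i f) \<le> vnorm f"
proof -
  have "(vnorm (creation i f))\<^sup>2 = cmod (inner (creation i f) (creation i f))"
    unfolding inner_self by (simp only: norm_of_real abs_power2)
  also have "\<dots> = cmod (inner (annihilation i (creation i f)) f)"
    using inner_annihilation[OF creation_vecs[OF assms] assms, of i i] by simp
  also have "\<dots> \<le> vnorm (annihilation i (creation i f)) * vnorm f"
    by (intro inner_norm_le annihilation_vecs creation_vecs assms)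
  also have "\<dots> \<le> vnorm (creation i f) * vnorm f"
    by (intro mult_right_mono vnorm_annihilation creation_vecs assms) simp
  finally show ?thesis
    by (metis linorder_not_le mult_le_cancel_left power2_eq_square vnorm_nonneg not_le order_trans)
qed

primrec letters_op :: "(nat \<times> bool) list \<Rightarrow> vec \<Rightarrow> vec" where
  "letters_op [] f = f"
| "letters_op (l # ls) f = (if snd l then annihilation (fst l) else creation (fst l)) (letters_op ls f)"

definition word_op :: "star_word \<Rightarrow> vec \<Rightarrow> vec" where "word_op w = letters_op (letters w)"

definition poly_op :: "star_poly \<Rightarrow> vec \<Rightarrow> vec" where
  "poly_op p f x = (\<Sum>w\<in>Poly_Mapping.keys p. Poly_Mapping.lookup p w * word_op w f x)"

lemma letters_op_append: "letters_op (l @ m) f = letters_op l (letters_op m f)"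
  by (induction l) auto

lemma letters_op_vecs: "f \<in> vecs \<Longrightarrow> letters_op l f \<in> vecs"
  by (induction l) (auto simp: creation_vecs annihilation_vecs)

lemma letters_op_linear:
  "letters_op l (\<lambda>x. \<Sum>j\<in>J. c j * f j x) = (\<lambda>x. \<Sum>j\<in>J. c j * letters_op l (f j) x)"
proof (induction l)
  case (Cons a l)
  show ?case unfolding letters_op.simps Cons.IH by (intro ext) (auto simp: creation_def annihilation_def)
qed simp

lemma letters_op_norm: "f \<in> vecs \<Longrightarrow> vnorm (letters_op l f) \<le> vnorm f"
proof (induction l)
  case (Cons a l)
  then show ?case
    using vnorm_creation[OF letters_op_vecs[OF Cons.prems], of "fst a" l]
      vnorm_annihilation[OF letters_op_vecs[OF Cons.prems], of "fst a" l] by auto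
qed simp

lemma letters_op_adjoint:
  "f \<in> vecs \<Longrightarrow> g \<in> vecs \<Longrightarrow>
    inner (letters_op l f) g = inner f (letters_op (rev (map (\<lambda>(i, b). (i, \<not> b)) l)) g)"
proof (induction l arbitrary: g)
  case (Cons a l)
  then show ?case
    by (auto simp: letters_op_append inner_creation inner_annihilation letters_op_vecs
        annihilation_vecs creation_vecs split: prod.split)
qed simp

lemma word_op_zero: "word_op 0 f = f" by (simp add: word_op_def zero_star_word_def)

lemma word_op_add: "word_op (v + w) f = word_op v (word_op w f)"
  by (simp add: word_op_def plus_star_word_def letters_op_append)

lemma poly_op_superset:
  assumes "finite F" "Poly_Mapping.keys p \<subseteq> F"
  shows "poly_op p f x = (\<Sum>w\<in>F. Poly_Mapping.lookup p w * word_op w f x)"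
  unfolding poly_op_def by (rule sum.mono_neutral_left) (use assms in \<open>auto simp: in_keys_iff\<close>)

lemma poly_op_add: "poly_op (p + p') f x = poly_op p f x + poly_op p' f x"
proof -
  let ?F = "Poly_Mapping.keys p \<union> Poly_Mapping.keys p'"
  have "poly_op (p + p') f x = (\<Sum>w\<in>?F. Poly_Mapping.lookup (p + p') w * word_op w f x)"
    by (rule poly_op_superset) (use Poly_Mapping.keys_add[of p p'] in auto)
  then show ?thesis
    by (simp add: poly_op_superset[of ?F] lookup_add distrib_right sum.distrib)
qed

lemma poly_op_zero: "poly_op 0 f x = 0" by (simp add: poly_op_def)

lemma poly_op_sum: "poly_op (sum h J) f x = (\<Sum>j\<in>J. poly_op (h j) f x)"
  by (induction J rule: infinite_finite_induct) (auto simp: poly_op_zero poly_op_add)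

lemma poly_op_single: "poly_op (Poly_Mapping.single w c) f x = c * word_op w f x"
  by (subst poly_op_superset[of "{w}"]) auto

lemma poly_op_one: "poly_op 1 f x = f x"
  using poly_op_single[of 0 1 f x] by (simp add: word_op_zero)

lemma word_op_sum: "word_op w (\<lambda>x. \<Sum>j\<in>J. c j * f j x) x = (\<Sum>j\<in>J. c j * word_op w (f j) x)"
  unfolding word_op_def by (simp add: letters_op_linear)

lemma poly_op_mult: "poly_op (p * p') f = poly_op p (poly_op p' f)"
proof
  fix x
  have "p * p' = (\<Sum>v\<in>Poly_Mapping.keys p. Poly_Mapping.single v (Poly_Mapping.lookup p v)) *
     (\<Sum>w\<in>Poly_Mapping.keys p'. Poly_Mapping.single w (Poly_Mapping.lookup p' w))"
    by (simp add: sum_keys_single)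
  also have "\<dots> = (\<Sum>v\<in>Poly_Mapping.keys p. \<Sum>w\<in>Poly_Mapping.keys p'.
     Poly_Mapping.single (v + w) (Poly_Mapping.lookup p v * Poly_Mapping.lookup p' w))"
    by (simp add: sum_product mult_single)
  finally have "poly_op (p * p') f x = (\<Sum>v\<in>Poly_Mapping.keys p. \<Sum>w\<in>Poly_Mapping.keys p'.
      Poly_Mapping.lookup p v * Poly_Mapping.lookup p' w * word_op v (word_op w f) x)"
    by (simp add: poly_op_sum poly_op_single word_op_add)
  also have "\<dots> = poly_op p (poly_op p' f) x"
  proof -
    have "poly_op p' f = (\<lambda>x. \<Sum>w\<in>Poly_Mapping.keys p'. Poly_Mapping.lookup p' w * word_op w f x)"
      by (rule ext) (simp add: poly_op_def)
    then show ?thesis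
      by (simp only: poly_op_def[of p] word_op_sum sum_distrib_left mult.assoc)
  qed
  finally show "poly_op (p * p') f x = poly_op p (poly_op p' f) x" .
qed

lemma poly_op_scale: "poly_op (Poly_Mapping.single 0 c * p) f x = c * poly_op p f x"
  by (simp add: poly_op_mult poly_op_single word_op_zero)

lemma poly_op_diff: "poly_op (p - p') f x = poly_op p f x - poly_op p' f x"
  using poly_op_add[of "p - p'" p' f x] by simp

lemma poly_op_of_nat: "poly_op (of_nat n) f x = of_nat n * f x"
  by (induction n) (auto simp: poly_op_zero poly_op_one poly_op_add algebra_simps)

lemma poly_op_gen: "poly_op (gen i) f = creation i f"
  by (rule ext) (simp add: gen_def poly_op_single word_op_def)

lemma poly_op_adj_gen: "poly_op (poly_adj (gen i)) f = annihilation i f"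
  by (rule ext) (simp add: gen_def poly_adj_def poly_op_single word_op_def word_adj_def)

lemma poly_op_vecs: "f \<in> vecs \<Longrightarrow> poly_op p f \<in> vecs"
  unfolding poly_op_def word_op_def by (intro vecs_sum letters_op_vecs)

lemma poly_op_adjoint:
  assumes "f \<in> vecs" "g \<in> vecs" shows "inner (poly_op p f) g = inner f (poly_op (poly_adj p) g)"
proof -
  have lin: "inner (\<lambda>x. \<Sum>j\<in>J. c j * h j x) g = (\<Sum>j\<in>J. c j * inner (h j) g)" for J c h g
    unfolding inner_def sum_distrib_right sum_distrib_left
    by (subst sum.swap) (simp add: mult.assoc)
  have ext: "poly_op p f = (\<lambda>x. \<Sum>w\<in>Poly_Mapping.keys p. Poly_Mapping.lookup p w * word_op w f x)"
    "poly_op (poly_adj p) g =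
      (\<lambda>x. \<Sum>w\<in>Poly_Mapping.keys p. cnj (Poly_Mapping.lookup p w) * word_op (word_adj w) g x)"
    by (rule ext, simp add: poly_op_def, rule ext, simp add: poly_adj_def poly_op_sum poly_op_single)
  have vec: "word_op w h \<in> vecs" if "h \<in> vecs" for w h
    using that by (simp add: word_op_def letters_op_vecs)
  have "inner (poly_op p f) g = (\<Sum>w\<in>Poly_Mapping.keys p. Poly_Mapping.lookup p w * inner (word_op w f) g)"
    unfolding ext(1) by (rule lin)
  also have "\<dots> = (\<Sum>w\<in>Poly_Mapping.keys p. Poly_Mapping.lookup p w * inner f (word_op (word_adj w) g))"
    using assms by (simp add: word_op_def word_adj_def letters_op_adjoint)
  also have "\<dots> = cnj (\<Sum>w\<in>Poly_Mapping.keys p. cnj (Poly_Mapping.lookup p w) * inner (word_op (word_adj w) g) f)"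
    using assms vec by (simp add: inner_commute[of f])
  also have "\<dots> = cnj (inner (poly_op (poly_adj p) g) f)" unfolding ext(2) lin ..
  also have "\<dots> = inner f (poly_op (poly_adj p) g)"
    using assms poly_op_vecs inner_commute by metis
  finally show ?thesis .
qed

definition op_norm :: "star_poly \<Rightarrow> real" where
  "op_norm p = (SUP f\<in>{f \<in> vecs. vnorm f \<le> 1}. vnorm (poly_op p f))"

lemma poly_op_bounded:
  assumes "f \<in> vecs"
  shows "vnorm (poly_op p f) \<le> (\<Sum>w\<in>Poly_Mapping.keys p. cmod (Poly_Mapping.lookup p w)) * vnorm f"
proof -
  have "finite W \<Longrightarrow> vnorm (\<lambda>x. \<Sum>w\<in>W. c w * word_op w f x) \<le> (\<Sum>w\<in>W. cmod (c w)) * vnorm f" for c W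
  proof (induction W rule: finite_induct)
    case (insert w W)
    have v: "word_op w f \<in> vecs" for w using assms by (simp add: word_op_def letters_op_vecs)
    have "vnorm (\<lambda>x. c w * word_op w f x + (\<Sum>w\<in>W. c w * word_op w f x))
      \<le> vnorm (\<lambda>x. c w * word_op w f x) + vnorm (\<lambda>x. \<Sum>w\<in>W. c w * word_op w f x)"
      by (intro vnorm_add vecs_scale vecs_sum v)
    also have "\<dots> \<le> cmod (c w) * vnorm f + (\<Sum>w\<in>W. cmod (c w)) * vnorm f"
      unfolding vnorm_scale[OF v] using insert.IH letters_op_norm[OF assms]
      by (intro add_mono mult_left_mono) (auto simp: word_op_def)
    finally show ?case using insert.hyps by (simp add: distrib_right)
  qed (simp add: vnorm_zero)
  then show ?thesis unfolding poly_op_def by simp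
qed

lemma op_norm_nonempty: "(\<lambda>p. 0) \<in> {f \<in> vecs. vnorm f \<le> 1}"
  by (simp add: vecs_zero vnorm_zero)

lemma op_norm_bdd: "bdd_above ((\<lambda>f. vnorm (poly_op p f)) ` {f \<in> vecs. vnorm f \<le> 1})"
proof (rule bdd_aboveI2)
  fix f assume "f \<in> {f \<in> vecs. vnorm f \<le> 1}"
  then have f: "f \<in> vecs" "vnorm f \<le> 1" by auto
  have "vnorm (poly_op p f) \<le> (\<Sum>w\<in>Poly_Mapping.keys p. cmod (Poly_Mapping.lookup p w)) * vnorm f"
    by (rule poly_op_bounded[OF f(1)])
  also have "\<dots> \<le> (\<Sum>w\<in>Poly_Mapping.keys p. cmod (Poly_Mapping.lookup p w)) * 1"
    using f(2) by (intro mult_left_mono) (auto intro: sum_nonneg)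
  finally show "vnorm (poly_op p f) \<le> (\<Sum>w\<in>Poly_Mapping.keys p. cmod (Poly_Mapping.lookup p w)) * 1" .
qed

lemma op_norm_nonneg: "0 \<le> op_norm p"
  unfolding op_norm_def
  by (rule cSUP_upper2[OF op_norm_bdd op_norm_nonempty]) simp

lemma poly_op_scale_vec: "poly_op p (\<lambda>x. c * f x) = (\<lambda>x. c * poly_op p f x)"
  using word_op_sum[of _ "\<lambda>_. c" "\<lambda>_. f" "{()}"]
  by (auto simp: poly_op_def fun_eq_iff sum_distrib_left algebra_simps)

lemma poly_op_norm_le: assumes "f \<in> vecs" shows "vnorm (poly_op p f) \<le> op_norm p * vnorm f"
proof (cases "vnorm f = 0")
  case True
  then show ?thesis using poly_op_bounded[OF assms, of p] by simp
next
  case False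
  then have pos: "0 < vnorm f" using vnorm_nonneg[of f] by linarith
  let ?c = "of_real (1 / vnorm f) :: complex"
  have c: "cmod ?c = 1 / vnorm f" using pos by (simp add: norm_of_real del: of_real_divide)
  have "vnorm (poly_op p (\<lambda>x. ?c * f x)) \<le> op_norm p"
    unfolding op_norm_def
  proof (rule cSUP_upper[OF _ op_norm_bdd])
    have "vnorm (\<lambda>x. ?c * f x) \<le> 1" unfolding vnorm_scale[OF assms] c using pos by simp
    then show "(\<lambda>x. ?c * f x) \<in> {f \<in> vecs. vnorm f \<le> 1}" using vecs_scale[OF assms] by blast
  qed
  then have "(1 / vnorm f) * vnorm (poly_op p f) \<le> op_norm p"
    unfolding poly_op_scale_vec vnorm_scale[OF poly_op_vecs[OF assms]] c .
  then show ?thesis using pos by (simp add: field_simps)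
qed

lemma op_norm_least:
  assumes "\<And>f. f \<in> vecs \<Longrightarrow> vnorm (poly_op p f) \<le> K * vnorm f" "0 \<le> K" shows "op_norm p \<le> K"
  unfolding op_norm_def
proof (rule cSUP_least)
  fix f assume "f \<in> {f \<in> vecs. vnorm f \<le> 1}"
  then have f: "f \<in> vecs" "vnorm f \<le> 1" by auto
  have "K * vnorm f \<le> K * 1" by (rule mult_left_mono[OF f(2) assms(2)])
  then show "vnorm (poly_op p f) \<le> K" using assms(1)[OF f(1)] by linarith
qed (use op_norm_nonempty in blast)

lemma op_norm_adj_le: "op_norm (poly_adj p) \<le> op_norm p"
proof (rule op_norm_least[OF _ op_norm_nonneg])
  fix f assume f: "f \<in> vecs"
  define g where "g = poly_op (poly_adj p) f"
  have g: "g \<in> vecs" unfolding g_def by (rule poly_op_vecs[OF f])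
  have "(vnorm g)\<^sup>2 = cmod (inner g (poly_op (poly_adj p) f))"
    unfolding g_def[symmetric] inner_self by (simp only: norm_of_real abs_power2)
  also have "\<dots> = cmod (inner (poly_op p g) f)" using poly_op_adjoint[OF g f] by simp
  also have "\<dots> \<le> vnorm (poly_op p g) * vnorm f" by (intro inner_norm_le poly_op_vecs f g)
  also have "\<dots> \<le> op_norm p * vnorm g * vnorm f" by (intro mult_right_mono poly_op_norm_le g) simp
  finally have "vnorm g * vnorm g \<le> vnorm g * (op_norm p * vnorm f)"
    by (simp add: power2_eq_square mult.commute mult.left_commute)
  then show "vnorm g \<le> op_norm p * vnorm f"
    using op_norm_nonneg[of p] vnorm_nonneg[of g]
    by (cases "vnorm g = 0") (auto simp: mult_le_cancel_left)
qed

text \<open>The C*-identity holds because \<open>poly_op (poly_adj p)\<close> is the adjoint of \<open>poly_op p\<close>: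
  \<open>(norm (p f))\<^sup>2 = \<langle>f, p\<^sup>* p f\<rangle> \<le> norm (p\<^sup>* p) (norm f)\<^sup>2\<close>.\<close>

lemma cstar_seminorm_op_norm: "cstar_seminorm op_norm"
  unfolding cstar_seminorm_def
proof (intro conjI allI)
  fix p p' :: star_poly and c :: complex
  show "0 \<le> op_norm p" by (rule op_norm_nonneg)
  show "op_norm (p + p') \<le> op_norm p + op_norm p'"
  proof (rule op_norm_least)
    fix f assume f: "f \<in> vecs"
    have "vnorm (poly_op (p + p') f) = vnorm (\<lambda>x. poly_op p f x + poly_op p' f x)"
      by (rule arg_cong[where f = vnorm], rule ext) (rule poly_op_add)
    also have "\<dots> \<le> vnorm (poly_op p f) + vnorm (poly_op p' f)"
      by (intro vnorm_add poly_op_vecs f)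
    also have "\<dots> \<le> op_norm p * vnorm f + op_norm p' * vnorm f"
      by (intro add_mono poly_op_norm_le f)
    finally show "vnorm (poly_op (p + p') f) \<le> (op_norm p + op_norm p') * vnorm f"
      by (simp add: distrib_right)
  qed (simp add: op_norm_nonneg)
  show "op_norm (p * p') \<le> op_norm p * op_norm p'" for p p'
  proof (rule op_norm_least)
    fix f assume f: "f \<in> vecs"
    have "vnorm (poly_op (p * p') f) \<le> op_norm p * vnorm (poly_op p' f)"
      unfolding poly_op_mult by (intro poly_op_norm_le poly_op_vecs f)
    also have "\<dots> \<le> op_norm p * (op_norm p' * vnorm f)"
      by (intro mult_left_mono poly_op_norm_le f op_norm_nonneg)
    finally show "vnorm (poly_op (p * p') f) \<le> op_norm p * op_norm p' * vnorm f"
      by (simp add: mult.assoc)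
  qed (simp add: op_norm_nonneg)
  note submult = this
  have scale_le: "op_norm (Poly_Mapping.single 0 c * p) \<le> cmod c * op_norm p" for c p
  proof (rule op_norm_least)
    fix f assume f: "f \<in> vecs"
    have "poly_op (Poly_Mapping.single 0 c * p) f = (\<lambda>x. c * poly_op p f x)"
      by (rule ext) (rule poly_op_scale)
    then have "vnorm (poly_op (Poly_Mapping.single 0 c * p) f) = cmod c * vnorm (poly_op p f)"
      by (simp add: vnorm_scale poly_op_vecs f)
    also have "\<dots> \<le> cmod c * (op_norm p * vnorm f)" by (intro mult_left_mono poly_op_norm_le f) simp
    finally show "vnorm (poly_op (Poly_Mapping.single 0 c * p) f) \<le> cmod c * op_norm p * vnorm f"
      by (simp add: mult.assoc)
  qed (simp add: op_norm_nonneg)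
  show "op_norm (Poly_Mapping.single 0 c * p) = cmod c * op_norm p"
  proof (cases "c = 0")
    case True
    then show ?thesis using scale_le[of c p] op_norm_nonneg[of "Poly_Mapping.single 0 c * p"] by simp
  next
    case False
    have "Poly_Mapping.single 0 (1 / c) * (Poly_Mapping.single 0 c * p) = p"
      using False by (simp add: mult.assoc[symmetric] mult_single)
    then have "op_norm p \<le> cmod (1 / c) * op_norm (Poly_Mapping.single 0 c * p)"
      using scale_le[of "1 / c" "Poly_Mapping.single 0 c * p"] by simp
    then have "cmod c * op_norm p \<le> op_norm (Poly_Mapping.single 0 c * p)"
      using False by (simp add: norm_divide field_simps)
    then show ?thesis using scale_le[of c p] by simp
  qed
  show "op_norm (poly_adj p * p) = (op_norm p)\<^sup>2"
  proof (rule antisym)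
    have "op_norm (poly_adj p * p) \<le> op_norm (poly_adj p) * op_norm p" by (rule submult)
    also have "\<dots> \<le> op_norm p * op_norm p" by (intro mult_right_mono op_norm_adj_le op_norm_nonneg)
    finally show "op_norm (poly_adj p * p) \<le> (op_norm p)\<^sup>2" by (simp add: power2_eq_square)
    have "op_norm p \<le> sqrt (op_norm (poly_adj p * p))"
    proof (rule op_norm_least)
      fix f assume f: "f \<in> vecs"
      note pf = poly_op_vecs[OF f, of p]
      have "(vnorm (poly_op p f))\<^sup>2 = cmod (inner (poly_op p f) (poly_op p f))"
        unfolding inner_self by (simp only: norm_of_real abs_power2)
      also have "\<dots> = cmod (inner f (poly_op (poly_adj p * p) f))"
        using poly_op_adjoint[OF f pf] by (simp add: poly_op_mult)
      also have "\<dots> \<le> vnorm f * vnorm (poly_op (poly_adj p * p) f)"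
        by (intro inner_norm_le poly_op_vecs f)
      also have "\<dots> \<le> vnorm f * (op_norm (poly_adj p * p) * vnorm f)"
        by (intro mult_left_mono poly_op_norm_le f) simp
      also have "\<dots> = (sqrt (op_norm (poly_adj p * p)) * vnorm f)\<^sup>2"
        by (simp add: power_mult_distrib op_norm_nonneg power2_eq_square[of "vnorm f"])
      finally show "vnorm (poly_op p f) \<le> sqrt (op_norm (poly_adj p * p)) * vnorm f"
        by (rule power2_le_imp_le) (simp add: op_norm_nonneg)
    qed (simp add: op_norm_nonneg)
    then show "(op_norm p)\<^sup>2 \<le> op_norm (poly_adj p * p)"
      using op_norm_nonneg by (simp add: real_le_rsqrt power_mono sqrt_le_D real_le_lsqrt sqrt_ge_absD)
  qed
qed

lemma vecs_outside: "f \<in> vecs \<Longrightarrow> fst p \<notin> \<Lambda> \<Longrightarrow> f p = 0"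
  by (auto simp: vecs_def supp_def)

lemma creation_annihilation:
  "creation i (annihilation i f) p = (if fst p \<in> \<Lambda> \<and> fst p 0 = i then f p else 0)"
  using push_pop[of p i] by (simp add: creation_def annihilation_def)

lemma annihilation_creation:
  "annihilation i (creation i f) p = (if fst (push i p) \<in> \<Lambda> then f p else 0)"
  by (simp add: creation_def annihilation_def)

text \<open>On functions supported on \<open>\<Lambda>\<^sub>A \<times> \<int>\<close> the operators satisfy the Cuntz-Krieger relations:
  \<open>s\<^sub>i s\<^sub>i\<^sup>*\<close> restricts to the points whose first letter is \<open>i\<close>, and \<open>s\<^sub>i\<^sup>* s\<^sub>i\<close> to those that \<open>i\<close> may
  precede.\<close>

lemma op_norm_relators:
  assumes "r \<in> cuntz_krieger_relators A" shows "op_norm r = 0"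
proof -
  have "poly_op r f x = 0" if f: "f \<in> vecs" for f x
  proof -
    have sum: "(\<Sum>j<d. of_nat (A $$ (i, j)) * (if fst x \<in> \<Lambda> \<and> fst x 0 = j then f x else 0)) =
        (if fst x \<in> \<Lambda> then of_nat (A $$ (i, fst x 0)) * f x else 0)" for i
      using shift_space_less[of "fst x" 0]
      by (cases "fst x \<in> \<Lambda>") (simp_all add: if_distrib[of "\<lambda>z. of_nat _ * z"] cong: if_cong)
    have sum1: "(\<Sum>j<d. if fst x \<in> \<Lambda> \<and> fst x 0 = j then f x else 0) = f x"
      using shift_space_less[of "fst x" 0] vecs_outside[OF f, of x]
      by (cases "fst x \<in> \<Lambda>") simp_all
    consider (partial) i where "r = gen i * poly_adj (gen i) * gen i - gen i"
      | (unit) "r = (\<Sum>i<d. gen i * poly_adj (gen i)) - 1"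
      | (rows) i where "i < d"
        "r = poly_adj (gen i) * gen i - (\<Sum>j<d. of_nat (A $$ (i, j)) * (gen j * poly_adj (gen j)))"
      using assms by (auto simp: cuntz_krieger_relators_def)
    then show ?thesis
    proof cases
      case partial
      then show ?thesis
        by (simp add: poly_op_diff poly_op_mult poly_op_gen poly_op_adj_gen creation_annihilation)
          (simp add: creation_def)
    next
      case unit
      then show ?thesis
        by (simp add: poly_op_diff poly_op_sum poly_op_mult poly_op_gen poly_op_adj_gen poly_op_one
            creation_annihilation sum1)
    next
      case rows
      have "poly_op r f x = (if fst (push i x) \<in> \<Lambda> then f x else 0) -
          (\<Sum>j<d. of_nat (A $$ (i, j)) * (if fst x \<in> \<Lambda> \<and> fst x 0 = j then f x else 0))"
        unfolding rows
        by (simp add: poly_op_diff poly_op_sum poly_op_mult poly_op_gen poly_op_adj_gen poly_op_of_nat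
            creation_annihilation annihilation_creation)
      also have "\<dots> = 0"
        unfolding sum fst_push using entry_cases[OF rows(1), of "fst x 0"] rows(1) shift_space_less[of "fst x" 0]
        by auto
      finally show ?thesis .
    qed
  qed
  then have "vnorm (poly_op r f) \<le> 0 * vnorm f" if "f \<in> vecs" for f
    using that vnorm_zero by (simp add: vnorm_def supp_def)
  then have "op_norm r \<le> 0" by (rule op_norm_least) simp_all
  then show ?thesis using op_norm_nonneg[of r] by simp
qed

end

context markov_shift
begin

definition delta :: "(nat \<Rightarrow> nat) \<Rightarrow> int \<Rightarrow> vec" where
  "delta x n p = (if p = (x, n) then 1 else 0)"

lemma supp_delta: "supp (delta x n) = {(x, n)}"
  by (auto simp: supp_def delta_def)

lemma delta_vecs: "x \<in> \<Lambda> \<Longrightarrow> delta x n \<in> vecs"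
  by (simp add: vecs_def supp_delta)

lemma vnorm_delta: "vnorm (delta x n) = 1"
  by (simp add: vnorm_def supp_delta) (simp add: delta_def)

definition vector_functional :: "(nat \<Rightarrow> nat) \<Rightarrow> star_poly \<Rightarrow> complex" where
  "vector_functional x p = poly_op p (delta x 0) (x, 0)"

lemma vector_functional_inner: "vector_functional x p = inner (poly_op p (delta x 0)) (delta x 0)"
  by (simp add: inner_def supp_delta vector_functional_def) (simp add: delta_def)

lemma vector_functional_le:
  assumes "x \<in> \<Lambda>" shows "cmod (vector_functional x p) \<le> op_norm p"
proof -
  note v = delta_vecs[OF assms, of 0]
  have "cmod (vector_functional x p) \<le> vnorm (poly_op p (delta x 0)) * vnorm (delta x 0)"
    unfolding vector_functional_inner by (intro inner_norm_le poly_op_vecs v)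
  also have "\<dots> \<le> op_norm p" using poly_op_norm_le[OF v, of p] by (simp add: vnorm_delta)
  finally show ?thesis .
qed

lemma vector_functional_square:
  assumes "x \<in> \<Lambda>" shows "vector_functional x (poly_adj p * p) \<in> \<real>\<^sub>\<ge>\<^sub>0"
proof -
  note v = delta_vecs[OF assms, of 0]
  let ?g = "poly_op p (delta x 0)"
  have "inner ?g ?g = inner (delta x 0) (poly_op (poly_adj p) ?g)"
    by (rule poly_op_adjoint[OF v poly_op_vecs[OF v]])
  then have "vector_functional x (poly_adj p * p) = cnj (inner ?g ?g)"
    unfolding vector_functional_inner poly_op_mult
    using inner_commute[OF v poly_op_vecs[OF poly_op_vecs[OF v]]] by simp
  then show ?thesis by (simp add: inner_self)
qed

lemma cylinder_Cons: "x \<in> cylinder (i # u) \<longleftrightarrow> x 0 = i \<and> x \<circ> Suc \<in> cylinder u"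
  by (auto simp: cylinder_def less_Suc_eq_0_disj)

lemma cylinder_same_length: "x \<in> cylinder u \<Longrightarrow> x \<in> cylinder v \<Longrightarrow> length u = length v \<Longrightarrow> u = v"
  by (auto simp: cylinder_def list_eq_iff_nth_eq)

lemma letters_op_word:
  assumes "fst p \<in> \<Lambda>"
  shows "letters_op (map (\<lambda>i. (i, False)) u) f p =
    (if fst p \<in> cylinder u then f ((pop ^^ length u) p) else 0)"
  using assms
proof (induction u arbitrary: p)
  case Nil
  then show ?case by (simp add: cylinder_def)
next
  case (Cons i u)
  have "fst (pop p) \<in> \<Lambda>" using shift_space_tail[OF Cons.prems] by (simp add: pop_def)
  from Cons.IH[OF this] show ?case
    using Cons.prems by (simp add: creation_def cylinder_Cons funpow_swap1) (simp add: pop_def)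
qed

lemma letters_op_adj_word:
  assumes "fst p \<in> \<Lambda>"
  shows "letters_op (rev (map (\<lambda>i. (i, True)) v)) f p =
    (if fst (foldr push v p) \<in> \<Lambda> then f (foldr push v p) else 0)"
proof (induction v arbitrary: f)
  case Nil
  then show ?case using assms by simp
next
  case (Cons i v)
  have "letters_op (rev (map (\<lambda>i. (i, True)) (i # v))) f p =
      letters_op (rev (map (\<lambda>i. (i, True)) v)) (annihilation i f) p"
    by (simp add: letters_op_append)
  also have "\<dots> = (if fst (foldr push v p) \<in> \<Lambda> then annihilation i f (foldr push v p) else 0)"
    by (rule Cons.IH)
  also have "\<dots> = (if fst (push i (foldr push v p)) \<in> \<Lambda> then f (push i (foldr push v p)) else 0)"
    by (simp add: annihilation_def fst_push)
  finally show ?case by simp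
qed

lemma foldr_push: "fst (foldr push v p) \<in> cylinder v" "snd (foldr push v p) = snd p + int (length v)"
proof (induction v)
  case (Cons i v)
  { case 1 then show ?case using Cons by (simp add: cylinder_Cons push_def o_def) }
  { case 2 then show ?case using Cons by (simp add: push_def) }
qed (simp_all add: cylinder_def)

lemma foldr_push_pop: "fst p \<in> cylinder u \<Longrightarrow> foldr push u ((pop ^^ length u) p) = p"
proof (induction u arbitrary: p)
  case (Cons i u)
  then have "fst p 0 = i" "fst (pop p) \<in> cylinder u" by (simp_all add: cylinder_Cons pop_def)
  then show ?case using Cons.IH[of "pop p"] push_pop[of p i] by (simp add: funpow_swap1)
qed simp

lemma snd_pop: "snd ((pop ^^ n) p) = snd p - int n"
  by (induction n) (auto simp: pop_def)

text \<open>\<open>s\<^sub>u s\<^sub>v\<^sup>*\<close> moves \<open>(x, 0)\<close> by replacing a prefix \<open>v\<close> of \<open>x\<close> by \<open>u\<close> and changes the degree by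
  \<open>length u - length v\<close>, so it can only fix \<open>(x, 0)\<close> if \<open>u = v\<close>.\<close>

lemma vector_functional_matrix_unit:
  assumes "x \<in> \<Lambda>"
  shows "vector_functional x (Poly_Mapping.single
      (Word (map (\<lambda>i. (i, False)) u @ rev (map (\<lambda>i. (i, True)) v))) 1) =
    (if u = v \<and> x \<in> cylinder u then 1 else 0)"
proof -
  define q where "q = foldr push v ((pop ^^ length u) (x, 0::int))"
  have tail: "fst ((pop ^^ n) p) \<in> \<Lambda>" if "fst p \<in> \<Lambda>" for n p
    using that by (induction n) (auto simp: pop_def shift_space_tail[unfolded o_def] o_def)
  have val: "vector_functional x (Poly_Mapping.single
      (Word (map (\<lambda>i. (i, False)) u @ rev (map (\<lambda>i. (i, True)) v))) 1) =
    (if x \<in> cylinder u then if fst q \<in> \<Lambda> then delta x 0 q else 0 else 0)"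
    unfolding vector_functional_def poly_op_single word_op_def star_word.sel letters_op_append
    using assms by (simp add: letters_op_word letters_op_adj_word tail q_def)
  have eq: "u = v" if "x \<in> cylinder u" "q = (x, 0)"
  proof (rule cylinder_same_length[OF that(1)])
    show "x \<in> cylinder v" using foldr_push(1)[of v] that(2) unfolding q_def by (metis fst_conv)
    have "snd q = - int (length u) + int (length v)"
      unfolding q_def foldr_push(2) snd_pop by simp
    then show "length u = length v" using that(2) by simp
  qed
  show ?thesis
  proof (cases "u = v \<and> x \<in> cylinder u")
    case True
    then have "q = (x, 0)" unfolding q_def by (metis foldr_push_pop fst_conv)
    then show ?thesis unfolding val using True assms by (simp add: delta_def)
  next
    case False
    then have "x \<notin> cylinder u \<or> q \<noteq> (x, 0)" using eq by blast
    then show ?thesis unfolding val if_not_P[OF False] by (auto simp: delta_def)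
  qed
qed

lemma poly_op_degree_shift:
  "poly_op p (\<lambda>q. f (fst q, snd q - 1)) = (\<lambda>q. poly_op p f (fst q, snd q - 1))"
proof -
  have *: "letters_op l (\<lambda>q. f (fst q, snd q - 1)) = (\<lambda>q. letters_op l f (fst q, snd q - 1))" for l
  proof (induction l)
    case (Cons a l)
    show ?case unfolding letters_op.simps Cons.IH
      by (intro ext) (auto simp: creation_def annihilation_def push_def pop_def)
  qed simp
  show ?thesis by (intro ext) (simp add: poly_op_def word_op_def *)
qed

text \<open>\<open>s\<^sub>i\<close> sends the point mass at \<open>(x, 0)\<close> to that at \<open>(ix, 1)\<close>, and all operators commute with the
  translation of the integer coordinate, which brings \<open>(ix, 1)\<close> back to \<open>(ix, 0)\<close>.\<close>

lemma vector_functional_gen: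
  assumes "x \<in> \<Lambda>"
  shows "vector_functional x (p * gen i) =
    (if case_nat i x \<in> \<Lambda> then vector_functional (case_nat i x) (gen i * p) else 0)"
proof (cases "case_nat i x \<in> \<Lambda>")
  case True
  have "creation i (delta x 0) = (\<lambda>q. delta (case_nat i x) 0 (fst q, snd q - 1))"
  proof
    fix q :: "(nat \<Rightarrow> nat) \<times> int"
    have "fst q \<in> \<Lambda> \<and> fst q 0 = i \<and> pop q = (x, 0) \<longleftrightarrow> q = push i (x, 0)"
    proof
      assume "q = push i (x, 0)"
      moreover have "fst (push i (x, 0)) \<in> \<Lambda>" using True by (simp add: push_def)
      ultimately show "fst q \<in> \<Lambda> \<and> fst q 0 = i \<and> pop q = (x, 0)" by simp
    qed (metis push_pop)
    moreover have "q = push i (x, 0) \<longleftrightarrow> (fst q, snd q - 1) = (case_nat i x, 0)"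
      by (auto simp: push_def prod_eq_iff)
    ultimately show "creation i (delta x 0) q = delta (case_nat i x) 0 (fst q, snd q - 1)"
      unfolding creation_def delta_def by argo
  qed
  then show ?thesis using True
    by (simp add: vector_functional_def poly_op_mult poly_op_gen poly_op_degree_shift creation_def pop_def o_def)
next
  case False
  have "creation i (delta x 0) = (\<lambda>q. 0 * delta x 0 q)"
  proof
    fix q :: "(nat \<Rightarrow> nat) \<times> int"
    have "\<not> (fst q \<in> \<Lambda> \<and> fst q 0 = i \<and> pop q = (x, 0))"
    proof
      assume q: "fst q \<in> \<Lambda> \<and> fst q 0 = i \<and> pop q = (x, 0)"
      then have "q = push i (x, 0)" using push_pop[of q i] by simp
      then have "fst q = case_nat i x" by (simp add: push_def)
      then show False using q False by simp
    qed
    then show "creation i (delta x 0) q = 0 * delta x 0 q" by (auto simp: creation_def delta_def)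
  qed
  then show ?thesis using False
    by (simp only: vector_functional_def poly_op_mult poly_op_gen poly_op_scale_vec) simp
qed

end

section \<open>States on the Cuntz-Krieger algebra\<close>

lemma dense_polynomials:
  fixes s :: "nat \<Rightarrow> 'a::unital_cstar_algebra"
  assumes "cstar_generated (s ` {..<d}) = UNIV"
  shows "closure (poly_eval s ` star_polys d) = UNIV"
proof -
  let ?X = "poly_eval s ` star_polys d"
  have "cstar_subalgebra (closure ?X)"
  proof (rule cstar_subalgebra_closure)
    show "0 \<in> ?X" using star_polys_zero poly_eval_zero[of s] by (metis imageI)
    fix x y assume "x \<in> ?X" "y \<in> ?X"
    then obtain p q where "p \<in> star_polys d" "q \<in> star_polys d" "x = poly_eval s p" "y = poly_eval s q" by auto
    then show "x + y \<in> ?X" "x * y \<in> ?X"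
      using star_polys_add star_polys_mult by (metis imageI poly_eval_add, metis imageI poly_eval_mult)
  next
    fix c x assume "x \<in> ?X"
    then obtain p where "p \<in> star_polys d" "x = poly_eval s p" by auto
    then show "c *\<^sub>C x \<in> ?X" using star_polys_scale by (metis imageI poly_eval_scale)
  next
    fix x assume "x \<in> ?X"
    then obtain p where "p \<in> star_polys d" "x = poly_eval s p" by auto
    then show "adj x \<in> ?X" using star_polys_adj by (metis imageI poly_eval_adj)
  qed
  moreover have "s ` {..<d} \<subseteq> closure ?X"
  proof -
    have "s i \<in> ?X" if "i < d" for i using star_polys_gen[OF that] poly_eval_gen[of s i] by (metis imageI)
    then show ?thesis using closure_subset by blast
  qed
  ultimately show ?thesis using assms unfolding cstar_generated_def by blast
qed

text \<open>Domination by the norm makes the functional well defined and Lipschitz on the dense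
  subalgebra of polynomials; the state axioms are closed conditions.\<close>

lemma state_extension:
  fixes s :: "nat \<Rightarrow> 'a::unital_cstar_algebra" and \<phi> :: "star_poly \<Rightarrow> complex"
  assumes dense: "closure (poly_eval s ` star_polys d) = UNIV"
    and add: "\<And>p q. \<phi> (p + q) = \<phi> p + \<phi> q"
    and scale: "\<And>c p. \<phi> (Poly_Mapping.single 0 c * p) = c * \<phi> p"
    and pos: "\<And>p. p \<in> star_polys d \<Longrightarrow> \<phi> (poly_adj p * p) \<in> \<real>\<^sub>\<ge>\<^sub>0"
    and one: "\<phi> 1 = 1"
    and le: "\<And>p. p \<in> star_polys d \<Longrightarrow> cmod (\<phi> p) \<le> norm (poly_eval s p)"
  shows "\<exists>\<omega>. state \<omega> \<and> (\<forall>p\<in>star_polys d. \<omega> (poly_eval s p) = \<phi> p)"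
proof -
  define P where "P = star_polys d"
  define X where "X = poly_eval s ` P"
  note P = star_polys_zero star_polys_add star_polys_mult star_polys_scale star_polys_adj
    star_polys_one star_polys_gen star_polys_diff
  have diff: "\<phi> (p - q) = \<phi> p - \<phi> q" for p q using add[of "p - q" q] by simp
  have wd: "\<phi> p = \<phi> q" if "p \<in> P" "q \<in> P" "poly_eval s p = poly_eval s q" for p q
    using le[of "p - q"] that P by (simp add: poly_eval_diff P_def diff)
  define \<phi>0 where "\<phi>0 x = \<phi> (SOME p. p \<in> P \<and> poly_eval s p = x)" for x
  have \<phi>0: "\<phi>0 (poly_eval s p) = \<phi> p" if "p \<in> P" for p
  proof -
    have "(SOME q. q \<in> P \<and> poly_eval s q = poly_eval s p) \<in> P \<and>
      poly_eval s (SOME q. q \<in> P \<and> poly_eval s q = poly_eval s p) = poly_eval s p"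
      by (rule someI[of _ p]) (use that in simp)
    then show ?thesis unfolding \<phi>0_def using wd that by blast
  qed
  have "1-lipschitz_on X \<phi>0"
  proof (rule lipschitz_onI)
    fix x y assume "x \<in> X" "y \<in> X"
    then obtain p q where pq: "p \<in> P" "q \<in> P" "x = poly_eval s p" "y = poly_eval s q"
      by (auto simp: X_def)
    then have "p - q \<in> P" using P(8) by (simp add: P_def)
    then show "dist (\<phi>0 x) (\<phi>0 y) \<le> 1 * dist x y"
      using le[of "p - q"] pq \<phi>0 by (simp add: dist_norm poly_eval_diff diff P_def)
  qed simp
  then obtain \<omega> where "uniformly_continuous_on (closure X) \<omega>" and ext: "\<And>x. x \<in> X \<Longrightarrow> \<phi>0 x = \<omega> x"
    using uniformly_continuous_on_extension_on_closure[OF lipschitz_on_uniformly_continuous] by metis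
  then have cont: "continuous_on UNIV \<omega>"
    using dense uniformly_continuous_imp_continuous unfolding X_def P_def by force
  have ev: "\<omega> (poly_eval s p) = \<phi> p" if "p \<in> P" for p
    using \<phi>0[OF that] ext that by (simp add: X_def)
  have lim: "(\<lambda>n. \<omega> (u n)) \<longlonglongrightarrow> \<omega> x" if "u \<longlonglongrightarrow> x" for u x
    by (rule continuous_on_tendsto_compose[OF cont that]) auto
  have app: "\<exists>p. (\<forall>n. p n \<in> P) \<and> (\<lambda>n. poly_eval s (p n)) \<longlonglongrightarrow> x" for x
  proof -
    have "x \<in> closure X" using dense by (simp add: X_def P_def)
    then obtain u where u: "\<And>n. u n \<in> X" "u \<longlonglongrightarrow> x" unfolding closure_sequential by blast
    then have "\<forall>n. \<exists>p. p \<in> P \<and> u n = poly_eval s p" by (auto simp: X_def)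
    then obtain p where "\<forall>n. p n \<in> P \<and> u n = poly_eval s (p n)" by metis
    moreover from this have "u = (\<lambda>n. poly_eval s (p n))" by auto
    ultimately show ?thesis using u(2) by blast
  qed
  have "state \<omega>" unfolding state_def
  proof (intro conjI allI)
    fix x y c
    obtain p q where p: "\<And>n. p n \<in> P" "(\<lambda>n. poly_eval s (p n)) \<longlonglongrightarrow> x"
      and q: "\<And>n. q n \<in> P" "(\<lambda>n. poly_eval s (q n)) \<longlonglongrightarrow> y"
      using app by meson
    have px: "(\<lambda>n. \<phi> (p n)) \<longlonglongrightarrow> \<omega> x" and qy: "(\<lambda>n. \<phi> (q n)) \<longlonglongrightarrow> \<omega> y"
      using lim[OF p(2)] lim[OF q(2)] ev p(1) q(1) by auto
    have "(\<lambda>n. \<phi> (p n) + \<phi> (q n)) \<longlonglongrightarrow> \<omega> (x + y)"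
      using lim[OF tendsto_add[OF p(2) q(2)]] ev p(1) q(1) P(2)
      by (simp add: P_def poly_eval_add[of s, symmetric] add)
    then show "\<omega> (x + y) = \<omega> x + \<omega> y" using LIMSEQ_unique tendsto_add[OF px qy] by blast
    have "(\<lambda>n. c * \<phi> (p n)) \<longlonglongrightarrow> \<omega> (c *\<^sub>C x)"
      using lim[OF bounded_linear.tendsto[OF bounded_linear_scaleC p(2)]] ev p(1) P(4)
      by (simp add: P_def poly_eval_scale[of s, symmetric] scale)
    then show "\<omega> (c *\<^sub>C x) = c * \<omega> x" using LIMSEQ_unique tendsto_mult_left[OF px] by blast
    have L: "(\<lambda>n. \<phi> (poly_adj (p n) * p n)) \<longlonglongrightarrow> \<omega> (adj x * x)"
      using lim[OF tendsto_mult[OF bounded_linear.tendsto[OF bounded_linear_adj p(2)] p(2)]] ev p(1) P(3,5)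
      by (simp add: P_def poly_eval_adj[of s, symmetric] poly_eval_mult[of s, symmetric])
    have "\<phi> (poly_adj (p n) * p n) \<in> \<real>\<^sub>\<ge>\<^sub>0" for n
      using pos p(1) by (simp add: P_def)
    then show "\<omega> (adj x * x) \<in> \<real>\<^sub>\<ge>\<^sub>0"
      by (rule closed_sequentially[OF closed_nonneg_Reals_complex _ L])
    show "\<omega> 1 = 1" using ev[of 1] P(6) one by (simp add: P_def poly_eval_one)
  qed
  then show ?thesis using ev by (auto simp: P_def)
qed

locale cuntz_krieger_algebra = markov_shift A d for A d +
  fixes s :: "nat \<Rightarrow> 'a::unital_cstar_algebra"
    and \<iota> :: "((nat \<Rightarrow> nat) \<Rightarrow> complex) \<Rightarrow> 'a"
  assumes univ: "universal_cuntz_krieger A s" and diag: "diagonal_identification A s \<iota>"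
begin

lemma dense_polys: "closure (poly_eval s ` star_polys d) = UNIV"
  using univ dense_polynomials[of s d] by (simp add: universal_cuntz_krieger_def)

lemma continuous_polys_eqI:
  fixes f g :: "'a \<Rightarrow> 'b::t2_space"
  assumes f: "continuous_on UNIV f" and g: "continuous_on UNIV g"
    and eq: "\<And>p. p \<in> star_polys d \<Longrightarrow> f (poly_eval s p) = g (poly_eval s p)"
  shows "f x = g x"
proof -
  have "closed {x. f x = g x}" using f g by (rule closed_Collect_eq)
  then have "closure (poly_eval s ` star_polys d) \<subseteq> {x. f x = g x}"
    by (intro closure_minimal) (auto simp: eq)
  then show ?thesis using dense_polys by auto
qed

text \<open>The conditional expectation onto \<open>C(\<Lambda>\<^sub>A)\<close>, followed by evaluation at \<open>x\<close>.\<close>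

definition vector_state :: "(nat \<Rightarrow> nat) \<Rightarrow> 'a \<Rightarrow> complex" where
  "vector_state x = (SOME \<omega>. state \<omega> \<and> (\<forall>p\<in>star_polys d. \<omega> (poly_eval s p) = vector_functional x p))"

lemma vector_state:
  assumes "x \<in> \<Lambda>"
  shows "state (vector_state x)"
    and "p \<in> star_polys d \<Longrightarrow> vector_state x (poly_eval s p) = vector_functional x p"
proof -
  have le: "op_norm p \<le> norm (poly_eval s p)" if "p \<in> star_polys d" for p
    using univ that cstar_seminorm_op_norm op_norm_relators unfolding universal_cuntz_krieger_def by simp
  have "\<exists>\<omega>. state \<omega> \<and> (\<forall>p\<in>star_polys d. \<omega> (poly_eval s p) = vector_functional x p)"
  proof (rule state_extension[OF dense_polys])
    show "vector_functional x 1 = 1"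
      by (simp add: vector_functional_def poly_op_one) (simp add: delta_def)
    show "cmod (vector_functional x p) \<le> norm (poly_eval s p)" if "p \<in> star_polys d" for p
      using vector_functional_le[OF assms, of p] le[OF that] by linarith
  qed (use vector_functional_square[OF assms] in
      \<open>auto simp: vector_functional_def poly_op_add poly_op_scale\<close>)
  from someI_ex[OF this, folded vector_state_def]
  show "state (vector_state x)"
    "p \<in> star_polys d \<Longrightarrow> vector_state x (poly_eval s p) = vector_functional x p" by auto
qed

lemma state_continuous: "state \<omega> \<Longrightarrow> continuous_on UNIV (\<omega> :: 'a \<Rightarrow> complex)"
  by (rule linear_continuous_on[OF state_bounded_linear])

lemma state_continuous_mult:
  "state \<omega> \<Longrightarrow> continuous_on UNIV (\<lambda>b. \<omega> (b * c) :: complex)"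
  "state \<omega> \<Longrightarrow> continuous_on UNIV (\<lambda>b. \<omega> (c * b :: 'a))"
  by (rule continuous_on_compose2[OF state_continuous], auto intro: continuous_intros)+

lemma vector_state_gen:
  assumes "x \<in> \<Lambda>" "i < d"
  shows "vector_state x (b * s i) =
    (if follows i (x 0) then vector_state (case_nat i x) (s i * b) else 0)"
proof (cases "follows i (x 0)")
  case True
  then have ix: "case_nat i x \<in> \<Lambda>" using assms by (simp add: shift_space_cons)
  have "vector_state x (b * s i) = vector_state (case_nat i x) (s i * b)"
  proof (rule continuous_polys_eqI[where f = "\<lambda>b. vector_state x (b * s i)"])
    fix p assume p: "p \<in> star_polys d"
    have "vector_state x (poly_eval s (p * gen i)) = vector_state (case_nat i x) (poly_eval s (gen i * p))"
      using vector_functional_gen[OF assms(1), of p i] ix p star_polys_mult star_polys_gen[OF assms(2)]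
      by (simp add: vector_state(2)[OF assms(1)] vector_state(2)[OF ix])
    then show "vector_state x (poly_eval s p * s i) = vector_state (case_nat i x) (s i * poly_eval s p)"
      by (simp add: poly_eval_mult poly_eval_gen)
  qed (intro state_continuous_mult vector_state ix assms)+
  then show ?thesis using True by simp
next
  case False
  then have ix: "case_nat i x \<notin> \<Lambda>" using assms by (simp add: shift_space_cons)
  have "vector_state x (b * s i) = 0"
  proof (rule continuous_polys_eqI[where f = "\<lambda>b. vector_state x (b * s i)"])
    fix p assume p: "p \<in> star_polys d"
    have "vector_state x (poly_eval s (p * gen i)) = 0"
      using vector_functional_gen[OF assms(1), of p i] ix p star_polys_mult star_polys_gen[OF assms(2)]
      by (simp add: vector_state(2)[OF assms(1)])
    then show "vector_state x (poly_eval s p * s i) = 0" by (simp add: poly_eval_mult poly_eval_gen)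
  qed (intro state_continuous_mult vector_state assms continuous_intros)+
  then show ?thesis using False by simp
qed

abbreviation word :: "nat list \<Rightarrow> 'a" where "word \<equiv> word_prod s"

lemma word_Nil: "word [] = 1" and word_Cons: "word (i # w) = s i * word w"
  and word_append: "word (u @ v) = word u * word v"
  by (simp_all add: word_prod_def)

lemma vector_state_matrix_unit:
  assumes "x \<in> \<Lambda>" "set u \<subseteq> {..<d}" "set v \<subseteq> {..<d}"
  shows "vector_state x (word u * adj (word v)) = (if u = v \<and> x \<in> cylinder u then 1 else 0)"
proof -
  let ?w = "Word (map (\<lambda>i. (i, False)) u @ rev (map (\<lambda>i. (i, True)) v))"
  have 1: "prod_list (map (\<lambda>(i, b). if b then adj (s i) else s i) (map (\<lambda>i. (i, False)) u)) = word u"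
    by (simp add: word_prod_def o_def)
  have 2: "prod_list (map (\<lambda>(i, b). if b then adj (s i) else s i) (rev (map (\<lambda>i. (i, True)) v))) = adj (word v)"
    by (induction v) (auto simp: word_prod_def adj_one adj_mult)
  have "poly_eval s (Poly_Mapping.single ?w 1) = word u * adj (word v)"
    unfolding poly_eval_single word_eval_def star_word.sel map_append prod_list.append 1 2 by (rule scaleC_one)
  moreover have "Poly_Mapping.single ?w 1 \<in> star_polys d"
    by (rule star_polys_single) (use assms in auto)
  ultimately show ?thesis
    using vector_state(2)[OF assms(1), of "Poly_Mapping.single ?w 1"]
      vector_functional_matrix_unit[OF assms(1), of u v] by simp
qed

end

section \<open>Functional calculus in \<open>C(\<Lambda>\<^sub>A)\<close>\<close>

lemma has_derivative_quadratic:
  fixes f :: "'a::real_normed_vector \<Rightarrow> 'b::real_normed_vector"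
  assumes L: "bounded_linear L"
    and le: "\<And>h. norm h \<le> 1 \<Longrightarrow> norm (f (x + h) - f x - L h) \<le> K * (norm h)\<^sup>2"
  shows "(f has_derivative L) (at x)"
  unfolding has_derivative_at
proof (intro conjI L)
  show "(\<lambda>h. norm (f (x + h) - f x - L h) / norm h) \<midarrow>0\<rightarrow> 0"
  proof (rule Lim_null_comparison)
    show "((\<lambda>h::'a. K * norm h) \<longlongrightarrow> 0) (at 0)" by (rule tendsto_eq_intros | simp)+
    have "\<forall>\<^sub>F h::'a in at 0. norm h \<le> 1"
      unfolding eventually_at by (intro exI[of _ 1]) auto
    then show "\<forall>\<^sub>F h in at 0. norm (norm (f (x + h) - f x - L h) / norm h) \<le> K * norm h"
    proof eventually_elim
      case (elim h)
      from le[OF elim] show ?case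
        by (cases "h = 0") (simp_all add: field_simps power2_eq_square)
    qed
  qed
qed

lemma bounded_linear_scaleC_left: "bounded_linear (\<lambda>h. h *\<^sub>C (D::'a::unital_cstar_algebra))"
proof (rule bounded_linear_intro[where K = "norm D"])
  show "(r *\<^sub>R h) *\<^sub>C D = r *\<^sub>R (h *\<^sub>C D)" for r h
    by (simp add: scaleC_of_real[symmetric] scaleC_scaleC scaleR_conv_of_real)
qed (simp_all add: scaleC_add_left norm_scaleC)

definition entire :: "(complex \<Rightarrow> 'a::unital_cstar_algebra) \<Rightarrow> bool" where
  "entire F \<longleftrightarrow> (\<forall>z. \<exists>D. (F has_derivative (\<lambda>h. h *\<^sub>C D)) (at z))"

lemma entire_const: "entire (\<lambda>z. c)"
  unfolding entire_def
  by (intro allI exI[of _ 0]) (simp add: scaleC_zero_right)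

lemma entire_add:
  assumes "entire F" "entire G" shows "entire (\<lambda>z. F z + G z)"
  unfolding entire_def
proof
  fix z
  obtain D E where "(F has_derivative (\<lambda>h. h *\<^sub>C D)) (at z)" "(G has_derivative (\<lambda>h. h *\<^sub>C E)) (at z)"
    using assms unfolding entire_def by blast
  from has_derivative_add[OF this]
  show "\<exists>D. ((\<lambda>z. F z + G z) has_derivative (\<lambda>h. h *\<^sub>C D)) (at z)"
    unfolding scaleC_add_right[symmetric] by blast
qed

lemma entire_mult:
  assumes "entire F" "entire G" shows "entire (\<lambda>z. F z * G z)"
  unfolding entire_def
proof
  fix z
  obtain D E where "(F has_derivative (\<lambda>h. h *\<^sub>C D)) (at z)" "(G has_derivative (\<lambda>h. h *\<^sub>C E)) (at z)"
    using assms unfolding entire_def by blast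
  from has_derivative_mult[OF this]
  show "\<exists>D. ((\<lambda>z. F z * G z) has_derivative (\<lambda>h. h *\<^sub>C D)) (at z)"
    unfolding mult_scaleC_left mult_scaleC_right scaleC_add_right[symmetric] by blast
qed

lemma entire_scale: "entire F \<Longrightarrow> entire (\<lambda>z. c *\<^sub>C F z)"
  using entire_mult[OF entire_const[of "c *\<^sub>C 1"], of F] by (simp add: mult_scaleC_left)

lemma entire_state_holomorphic:
  assumes "state \<omega>" "entire F" shows "(\<lambda>z. \<omega> (F z)) holomorphic_on UNIV"
  unfolding holomorphic_on_def field_differentiable_def
proof
  fix z
  obtain D where D: "(F has_derivative (\<lambda>h. h *\<^sub>C D)) (at z)"
    using assms(2) unfolding entire_def by blast
  from bounded_linear.has_derivative[OF state_bounded_linear[OF assms(1)] this]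
  have "((\<lambda>z. \<omega> (F z)) has_derivative (\<lambda>h. \<omega> D * h)) (at z)"
    by (simp add: state_scaleC[OF assms(1)] mult.commute)
  then show "\<exists>f'. ((\<lambda>z. \<omega> (F z)) has_field_derivative f') (at z within UNIV)"
    unfolding has_field_derivative_def by auto
qed

context cuntz_krieger_algebra
begin

lemma iota_add: "f \<in> cont_funs A \<Longrightarrow> g \<in> cont_funs A \<Longrightarrow> \<iota> (\<lambda>x. f x + g x) = \<iota> f + \<iota> g"
  and iota_mult: "f \<in> cont_funs A \<Longrightarrow> g \<in> cont_funs A \<Longrightarrow> \<iota> (\<lambda>x. f x * g x) = \<iota> f * \<iota> g"
  and iota_scale: "f \<in> cont_funs A \<Longrightarrow> \<iota> (\<lambda>x. c * f x) = c *\<^sub>C \<iota> f"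
  and iota_adj: "f \<in> cont_funs A \<Longrightarrow> \<iota> (\<lambda>x. cnj (f x)) = adj (\<iota> f)"
  and iota_cylinder: "set w \<subseteq> {..<d} \<Longrightarrow> \<iota> (indicator (cylinder w)) = word w * adj (word w)"
  using diag unfolding diagonal_identification_def by simp_all

lemma iota_norm_le:
  assumes "f \<in> cont_funs A" "\<And>x. x \<in> \<Lambda> \<Longrightarrow> cmod (f x) \<le> B" shows "norm (\<iota> f) \<le> B"
proof -
  have "norm (\<iota> f) = (SUP x\<in>\<Lambda>. cmod (f x))"
    using diag assms(1) unfolding diagonal_identification_def by blast
  also have "\<dots> \<le> B" using shift_space_nonempty assms(2) by (intro cSUP_least)
  finally show ?thesis .
qed

lemma iota_sup_bounded_additive: "sup_bounded_additive \<iota>"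
  by (rule sup_bounded_additiveI[where K = 1]) (auto simp: iota_add iota_norm_le)

lemma iota_cong: "f \<in> cont_funs A \<Longrightarrow> (\<And>x. x \<in> \<Lambda> \<Longrightarrow> f x = g x) \<Longrightarrow> \<iota> f = \<iota> g"
  by (rule sup_bounded_additive_cong[OF iota_sup_bounded_additive])

lemma cont_funs_indicator: "(indicator (cylinder w) :: _ \<Rightarrow> complex) \<in> cont_funs A"
  by (simp add: cont_funs_def continuous_on_indicator_cylinder)

lemma cont_funs_scale: "f \<in> cont_funs A \<Longrightarrow> (\<lambda>x. c * f x) \<in> cont_funs A"
  by (intro cont_funs_mult cont_funs_const)

lemma cont_funs_diff: "f \<in> cont_funs A \<Longrightarrow> g \<in> cont_funs A \<Longrightarrow> (\<lambda>x. f x - g x) \<in> cont_funs A"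
  by (auto simp: cont_funs_def intro: continuous_intros)

lemma cont_funs_power: "f \<in> cont_funs A \<Longrightarrow> (\<lambda>x. f x ^ n) \<in> cont_funs A"
  by (auto simp: cont_funs_def intro: continuous_intros)

lemma cont_funs_exp: "f \<in> cont_funs A \<Longrightarrow> (\<lambda>x. exp (f x)) \<in> cont_funs A"
  by (auto simp: cont_funs_def intro: continuous_intros)

lemma iota_one: "\<iota> (\<lambda>x. 1) = 1"
proof -
  have "(\<lambda>x. 1) = (indicator (cylinder []) :: _ \<Rightarrow> complex)" by (auto simp: cylinder_def)
  then show ?thesis using iota_cylinder[of "[]"] by (simp add: word_Nil adj_one)
qed

lemma iota_const: "\<iota> (\<lambda>x. c) = c *\<^sub>C 1"
  using iota_scale[OF cont_funs_const[of 1], of c] by (simp add: iota_one)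

lemma iota_diff: "f \<in> cont_funs A \<Longrightarrow> g \<in> cont_funs A \<Longrightarrow> \<iota> (\<lambda>x. f x - g x) = \<iota> f - \<iota> g"
  using iota_add[OF cont_funs_diff, of f g g] by simp

lemma iota_sum: "(\<And>j. j \<in> J \<Longrightarrow> f j \<in> cont_funs A) \<Longrightarrow> \<iota> (\<lambda>x. \<Sum>j\<in>J. f j x) = (\<Sum>j\<in>J. \<iota> (f j))"
proof (induction J rule: infinite_finite_induct)
  case (insert j J)
  have "\<iota> (\<lambda>x. f j x + (\<Sum>j\<in>J. f j x)) = \<iota> (f j) + \<iota> (\<lambda>x. \<Sum>j\<in>J. f j x)"
    using insert.prems by (intro iota_add cont_funs_sum) auto
  then show ?case using insert by simp
qed (simp_all add: iota_const scaleC_zero_left)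

lemma iota_power: "f \<in> cont_funs A \<Longrightarrow> \<iota> (\<lambda>x. f x ^ n) = \<iota> f ^ n"
  by (induction n) (simp_all add: iota_one iota_mult cont_funs_power)

lemma cuntz_krieger_family: "cuntz_krieger_family A s"
  using univ by (simp add: universal_cuntz_krieger_def)

lemma gen_partial: "i < d \<Longrightarrow> s i * (adj (s i) * s i) = s i"
  using cuntz_krieger_family dim_row
  unfolding cuntz_krieger_family_def partial_isometry_def mult.assoc by blast

lemma gen_square_sum: "i < d \<Longrightarrow> adj (s i) * s i = (\<Sum>j<d. of_nat (A $$ (i, j)) * (s j * adj (s j)))"
  using cuntz_krieger_family dim_row unfolding cuntz_krieger_family_def by blast

lemma gen_proj: "i < d \<Longrightarrow> s i * adj (s i) = \<iota> (indicator (cylinder [i]))"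
  using iota_cylinder[of "[i]"] by (simp add: word_Cons word_Nil)

text \<open>The range projections of \<open>s\<^sub>i\<close> and \<open>s\<^sub>j\<close> are the indicators of disjoint cylinders.\<close>

lemma gen_orthogonal:
  assumes "i < d" "j < d" "i \<noteq> j" shows "adj (s i) * s j = 0"
proof -
  have "(s i * adj (s i)) * (s j * adj (s j)) =
      \<iota> (\<lambda>x. indicator (cylinder [i]) x * indicator (cylinder [j]) x)"
    unfolding gen_proj[OF assms(1)] gen_proj[OF assms(2)]
    by (rule iota_mult[OF cont_funs_indicator cont_funs_indicator, symmetric])
  also have "(\<lambda>x. indicator (cylinder [i]) x * indicator (cylinder [j]) x :: complex) = (\<lambda>x. 0)"
    using assms(3) by (auto simp: cylinder_def indicator_def fun_eq_iff)
  finally have 0: "(s i * adj (s i)) * (s j * adj (s j)) = 0" by (simp add: iota_const scaleC_zero_left)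
  have adj: "adj (s i) = adj (s i) * (s i * adj (s i))"
    using arg_cong[OF gen_partial[OF assms(1)], of adj] by (simp add: adj_mult adj_adj mult.assoc)
  have "adj (s i) * s j = (adj (s i) * (s i * adj (s i))) * (s j * (adj (s j) * s j))"
    using adj gen_partial[OF assms(2)] by simp
  also have "\<dots> = adj (s i) * ((s i * adj (s i)) * (s j * adj (s j))) * s j" by (simp add: mult.assoc)
  finally show ?thesis using 0 by simp
qed

definition branch :: "nat \<Rightarrow> ((nat \<Rightarrow> nat) \<Rightarrow> complex) \<Rightarrow> (nat \<Rightarrow> nat) \<Rightarrow> complex" where
  "branch i f x = (if follows i (x 0) then f (case_nat i x) else 0)"

lemma branch_cont_funs: "f \<in> cont_funs A \<Longrightarrow> i < d \<Longrightarrow> branch i f \<in> cont_funs A"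
  using cont_funs_branch[of f i] by (simp add: branch_def[abs_def])

lemma of_nat_mult_scaleC: "of_nat n * (x::'a) = of_nat n *\<^sub>C x"
  using scaleC_of_real[of "real n" x] by (simp add: scaleR_conv_of_real)

lemma gen_square: assumes "i < d" shows "adj (s i) * s i = \<iota> (branch i (\<lambda>x. 1))"
proof -
  have "adj (s i) * s i = (\<Sum>j<d. \<iota> (\<lambda>x. of_nat (A $$ (i, j)) * indicator (cylinder [j]) x))"
    unfolding gen_square_sum[OF assms]
    by (intro sum.cong) (auto simp: gen_proj of_nat_mult_scaleC iota_scale cont_funs_indicator)
  also have "\<dots> = \<iota> (\<lambda>x. \<Sum>j<d. of_nat (A $$ (i, j)) * indicator (cylinder [j]) x)"
    by (rule iota_sum[symmetric]) (rule cont_funs_cylinder)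
  also have "\<dots> = \<iota> (branch i (\<lambda>x. 1))"
  proof (rule iota_cong)
    fix x assume x: "x \<in> \<Lambda>"
    have "(\<Sum>j<d. of_nat (A $$ (i, j)) * indicator (cylinder [j]) x) =
        (\<Sum>j<d. if j = x 0 then of_nat (A $$ (i, j)) else 0 :: complex)"
      by (rule sum.cong) (auto simp: cylinder_def indicator_def)
    also have "\<dots> = of_nat (A $$ (i, x 0))" using shift_space_less[OF x, of 0] by simp
    finally show "(\<Sum>j<d. of_nat (A $$ (i, j)) * indicator (cylinder [j]) x) = branch i (\<lambda>x. 1) x"
      using entry_cases[OF assms shift_space_less[OF x, of 0]] by (auto simp: branch_def)
  qed (intro cont_funs_sum cont_funs_cylinder)
  finally show ?thesis .
qed

text \<open>Compression by \<open>s\<^sub>i\<close> is composition with the inverse branch \<open>x \<mapsto> ix\<close>; for the cylinder of a word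
  \<open>iu\<close> this is \<open>s\<^sub>i\<^sup>* s\<^sub>i\<^sub>u s\<^sub>i\<^sub>u\<^sup>* s\<^sub>i = q s\<^sub>u s\<^sub>u\<^sup>* q\<close> with \<open>q = s\<^sub>i\<^sup>* s\<^sub>i\<close>.\<close>

lemma iota_branch:
  assumes f: "f \<in> cont_funs A" and i: "i < d"
  shows "adj (s i) * \<iota> f * s i = \<iota> (branch i f)"
proof (rule cylinder_agreement[OF _ _ _ f])
  show "sup_bounded_additive (\<lambda>f. adj (s i) * \<iota> f * s i)"
  proof (rule sup_bounded_additiveI[where K = "norm (s i) * norm (s i)"])
    fix f B assume f: "f \<in> cont_funs A" "\<And>x. x \<in> \<Lambda> \<Longrightarrow> cmod (f x) \<le> B"
    have "norm (adj (s i) * \<iota> f * s i) \<le> norm (adj (s i)) * norm (\<iota> f) * norm (s i)"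
      by (meson norm_mult_ineq order_trans mult_right_mono norm_ge_zero)
    also have "\<dots> \<le> norm (s i) * B * norm (s i)"
      unfolding norm_adj by (intro mult_right_mono mult_left_mono iota_norm_le f) auto
    finally show "norm (adj (s i) * \<iota> f * s i) \<le> norm (s i) * norm (s i) * B" by (simp add: mult_ac)
  qed (simp add: iota_add algebra_simps)
  show "sup_bounded_additive (\<lambda>f. \<iota> (branch i f))"
  proof (rule sup_bounded_additiveI[where K = 1])
    fix f g assume "f \<in> cont_funs A" "g \<in> cont_funs A"
    then have "\<iota> (\<lambda>x. branch i f x + branch i g x) = \<iota> (branch i f) + \<iota> (branch i g)"
      by (intro iota_add branch_cont_funs i)
    moreover have "(\<lambda>x. branch i f x + branch i g x) = branch i (\<lambda>x. f x + g x)"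
      by (auto simp: branch_def)
    ultimately show "\<iota> (branch i (\<lambda>x. f x + g x)) = \<iota> (branch i f) + \<iota> (branch i g)" by simp
  next
    fix f B assume f: "f \<in> cont_funs A" "\<And>x. x \<in> \<Lambda> \<Longrightarrow> cmod (f x) \<le> B"
    obtain y where y: "y \<in> \<Lambda>" using shift_space_nonempty by blast
    have B: "0 \<le> B" using order_trans[OF norm_ge_zero f(2)[OF y]] .
    have "cmod (branch i f x) \<le> B" if "x \<in> \<Lambda>" for x
      using f(2)[of "case_nat i x"] that B i by (auto simp: branch_def shift_space_cons)
    then show "norm (\<iota> (branch i f)) \<le> 1 * B" using iota_norm_le[OF branch_cont_funs[OF f(1) i]] by simp
  qed
  fix c and w :: "nat list" assume w: "w \<noteq> []" "set w \<subseteq> {..<d}"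
  then obtain j u where ju: "w = j # u" "j < d" "set u \<subseteq> {..<d}" by (cases w) auto
  have "adj (s i) * \<iota> (indicator (cylinder w)) * s i = \<iota> (branch i (indicator (cylinder w)))"
  proof (cases "i = j")
    case True
    have "adj (s i) * \<iota> (indicator (cylinder w)) * s i =
        (adj (s i) * s i) * (word u * adj (word u)) * (adj (s i) * s i)"
      using w ju True by (simp add: iota_cylinder word_Cons adj_mult mult.assoc)
    also have "\<dots> = \<iota> (\<lambda>x. branch i (\<lambda>x. 1) x * indicator (cylinder u) x * branch i (\<lambda>x. 1) x)"
      unfolding gen_square[OF i] iota_cylinder[OF ju(3), symmetric]
      by (simp add: iota_mult cont_funs_mult branch_cont_funs cont_funs_const cont_funs_indicator i)
    also have "(\<lambda>x. branch i (\<lambda>x. 1) x * indicator (cylinder u) x * branch i (\<lambda>x. 1) x) =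
        branch i (indicator (cylinder w))"
      by (rule ext) (simp add: ju True branch_def indicator_def cylinder_Cons o_def)
    finally show ?thesis .
  next
    case False
    have "adj (s i) * \<iota> (indicator (cylinder w)) * s i =
        (adj (s i) * s j) * (word u * adj (word w)) * s i"
      using w ju by (simp add: iota_cylinder word_Cons mult.assoc)
    moreover have "branch i (indicator (cylinder w)) = (\<lambda>x. 0)"
      by (rule ext) (simp add: ju False branch_def indicator_def cylinder_Cons)
    ultimately show ?thesis
      using gen_orthogonal[OF i ju(2) False] by (simp add: iota_const scaleC_zero_left)
  qed
  moreover have "branch i (\<lambda>x. c * indicator (cylinder w) x) = (\<lambda>x. c * branch i (indicator (cylinder w)) x)"
    by (auto simp: branch_def)
  ultimately show "adj (s i) * \<iota> (\<lambda>x. c * indicator (cylinder w) x) * s i =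
      \<iota> (branch i (\<lambda>x. c * indicator (cylinder w) x))"
    by (simp add: iota_scale cont_funs_indicator branch_cont_funs i mult_scaleC_left mult_scaleC_right)
qed

lemma iota_gen:
  assumes f: "f \<in> cont_funs A" and i: "i < d"
  shows "\<iota> f * s i = s i * \<iota> (branch i f)"
proof -
  have comm: "\<iota> f * (s i * adj (s i)) = s i * adj (s i) * \<iota> f"
    unfolding gen_proj[OF i] iota_mult[OF f cont_funs_indicator, symmetric]
      iota_mult[OF cont_funs_indicator f, symmetric] by (simp add: mult.commute)
  have "\<iota> f * s i = \<iota> f * (s i * adj (s i)) * s i"
    unfolding mult.assoc gen_partial[OF i] ..
  also have "\<dots> = s i * (adj (s i) * \<iota> f * s i)"
    unfolding comm by (simp only: mult.assoc)
  finally show ?thesis unfolding iota_branch[OF f i] .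
qed

text \<open>The exponential series of \<open>f\<close> converges uniformly on \<open>\<Lambda>\<^sub>A\<close>.\<close>

lemma iota_exp:
  assumes f: "f \<in> cont_funs A" shows "exp (\<iota> f) = \<iota> (\<lambda>x. exp (f x))"
proof -
  obtain B where B: "0 < B" "\<And>x. x \<in> \<Lambda> \<Longrightarrow> cmod (f x) \<le> B" using cont_funs_bounded[OF f] by blast
  define p where "p n x = (\<Sum>k\<le>n. f x ^ k / fact k)" for n x
  have summand: "(\<lambda>x. f x ^ k / fact k) \<in> cont_funs A" for k
    using cont_funs_scale[OF cont_funs_power[OF f], of "1 / fact k"] by simp
  have p: "p n \<in> cont_funs A" for n unfolding p_def[abs_def] by (intro cont_funs_sum summand)
  have ip: "\<iota> (p n) = (\<Sum>k\<le>n. \<iota> f ^ k /\<^sub>R fact k)" for n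
  proof -
    have "\<iota> (\<lambda>x. f x ^ k / fact k) = \<iota> f ^ k /\<^sub>R fact k" for k
    proof -
      have "(\<lambda>x. f x ^ k / fact k) = (\<lambda>x. of_real (inverse (fact k)) * f x ^ k)"
        by (simp add: divide_inverse mult.commute)
      then show ?thesis
        by (simp only: iota_scale[OF cont_funs_power[OF f]] iota_power[OF f] scaleC_of_real)
    qed
    then show ?thesis unfolding p_def[abs_def] by (simp add: iota_sum summand)
  qed
  have "(\<lambda>n. norm (\<iota> (\<lambda>x. exp (f x)) - \<iota> (p n))) \<longlonglongrightarrow> 0"
  proof (rule Lim_null_comparison)
    have "(\<lambda>n. B ^ n /\<^sub>R fact n) \<longlonglongrightarrow> 0"
      by (rule summable_LIMSEQ_zero) (rule summable_exp_generic)
    then have "(\<lambda>n. exp B * B * (B ^ n /\<^sub>R fact n)) \<longlonglongrightarrow> 0" by (rule tendsto_mult_right_zero)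
    then show "(\<lambda>n. exp B * B ^ Suc n / fact n) \<longlonglongrightarrow> 0"
      by (simp add: divide_inverse mult_ac)
    have "norm (\<iota> (\<lambda>x. exp (f x)) - \<iota> (p n)) \<le> exp B * B ^ Suc n / fact n" for n
      unfolding iota_diff[OF cont_funs_exp[OF f] p, symmetric]
    proof (rule iota_norm_le)
      fix x assume x: "x \<in> \<Lambda>"
      have "cmod (exp (f x) - p n x) \<le> exp \<bar>Re (f x)\<bar> * cmod (f x) ^ Suc n / fact n"
        unfolding p_def by (rule Taylor_exp)
      also have "\<dots> \<le> exp B * B ^ Suc n / fact n"
        using B(2)[OF x] abs_Re_le_cmod[of "f x"] B(1)
        by (intro divide_right_mono mult_mono power_mono) auto
      finally show "cmod (exp (f x) - p n x) \<le> exp B * B ^ Suc n / fact n" .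
    qed (intro cont_funs_diff cont_funs_exp f p)
    then show "\<forall>\<^sub>F n in sequentially. norm (norm (\<iota> (\<lambda>x. exp (f x)) - \<iota> (p n))) \<le> exp B * B ^ Suc n / fact n"
      by simp
  qed
  then have "(\<lambda>n. \<iota> (\<lambda>x. exp (f x)) - \<iota> (p n)) \<longlonglongrightarrow> 0" by (rule tendsto_norm_zero_cancel)
  from tendsto_diff[OF tendsto_const[of "\<iota> (\<lambda>x. exp (f x))"] this]
  have "(\<lambda>n. \<iota> (p n)) \<longlonglongrightarrow> \<iota> (\<lambda>x. exp (f x))" by simp
  moreover have "(\<lambda>n. \<iota> (p n)) \<longlonglongrightarrow> exp (\<iota> f)"
    unfolding ip using exp_converges[of "\<iota> f"] by (simp add: sums_def_le)
  ultimately show ?thesis using LIMSEQ_unique by blast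
qed

text \<open>Taylor's formula for the scalar exponential gives a remainder that is quadratic in \<open>h\<close>,
  uniformly on \<open>\<Lambda>\<^sub>A\<close>.\<close>

lemma entire_iota_exp:
  assumes f: "f \<in> cont_funs A" shows "entire (\<lambda>z. \<iota> (\<lambda>x. exp (z * f x)))"
  unfolding entire_def
proof
  fix z :: complex
  obtain B where B: "0 < B" "\<And>x. x \<in> \<Lambda> \<Longrightarrow> cmod (f x) \<le> B" using cont_funs_bounded[OF f] by blast
  have e: "(\<lambda>x. exp (z * f x)) \<in> cont_funs A" for z by (intro cont_funs_exp cont_funs_scale f)
  obtain C where C: "0 < C" "\<And>x. x \<in> \<Lambda> \<Longrightarrow> cmod (exp (z * f x)) \<le> C" using cont_funs_bounded[OF e] by blast
  define D where "D = \<iota> (\<lambda>x. f x * exp (z * f x))"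
  have fe: "(\<lambda>x. f x * exp (z * f x)) \<in> cont_funs A" by (intro cont_funs_mult f e)
  have "((\<lambda>z. \<iota> (\<lambda>x. exp (z * f x))) has_derivative (\<lambda>h. h *\<^sub>C D)) (at z)"
  proof (rule has_derivative_quadratic[OF bounded_linear_scaleC_left, where K = "C * (exp B * B\<^sup>2)"])
    fix h :: complex assume h: "norm h \<le> 1"
    have "\<iota> (\<lambda>x. exp ((z + h) * f x)) - \<iota> (\<lambda>x. exp (z * f x)) - h *\<^sub>C D =
        \<iota> (\<lambda>x. exp ((z + h) * f x) - exp (z * f x) - h * (f x * exp (z * f x)))"
      unfolding D_def by (simp add: iota_diff iota_scale cont_funs_diff cont_funs_scale e fe)
    also have "norm \<dots> \<le> C * (exp B * B\<^sup>2) * (norm h)\<^sup>2"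
    proof (rule iota_norm_le)
      fix x assume x: "x \<in> \<Lambda>"
      have hf: "cmod (h * f x) \<le> cmod h * B" using B(2)[OF x] by (simp add: norm_mult mult_left_mono)
      also have "\<dots> \<le> 1 * B" using h B(1) by (intro mult_right_mono) auto
      finally have hf': "\<bar>Re (h * f x)\<bar> \<le> B" using abs_Re_le_cmod[of "h * f x"] by linarith
      have "cmod (exp (h * f x) - (\<Sum>k\<le>1. (h * f x) ^ k / fact k)) \<le>
          exp \<bar>Re (h * f x)\<bar> * cmod (h * f x) ^ Suc 1 / fact 1"
        by (rule Taylor_exp)
      also have "\<dots> \<le> exp B * (cmod h * B)\<^sup>2"
        using hf hf' by (auto simp: power2_eq_square intro!: mult_mono)
      finally have t: "cmod (exp (h * f x) - 1 - h * f x) \<le> exp B * (cmod h * B)\<^sup>2"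
        by (simp add: algebra_simps)
      have "exp ((z + h) * f x) - exp (z * f x) - h * (f x * exp (z * f x)) =
          exp (z * f x) * (exp (h * f x) - 1 - h * f x)"
        by (simp add: distrib_right exp_add algebra_simps)
      also have "cmod \<dots> \<le> C * (exp B * (cmod h * B)\<^sup>2)"
        unfolding norm_mult using C(1) C(2)[OF x] t by (intro mult_mono) auto
      finally show "cmod (exp ((z + h) * f x) - exp (z * f x) - h * (f x * exp (z * f x))) \<le>
          C * (exp B * B\<^sup>2) * (norm h)\<^sup>2" by (simp add: power_mult_distrib mult_ac)
    qed (intro cont_funs_diff cont_funs_scale e fe)
    finally show "norm (\<iota> (\<lambda>x. exp ((z + h) * f x)) - \<iota> (\<lambda>x. exp (z * f x)) - h *\<^sub>C D) \<le>
        C * (exp B * B\<^sup>2) * (norm h)\<^sup>2" .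
  qed
  then show "\<exists>D. ((\<lambda>z. \<iota> (\<lambda>x. exp (z * f x))) has_derivative (\<lambda>h. h *\<^sub>C D)) (at z)" by blast
qed

end

section \<open>Matrix units and the multiplicative domain\<close>

lemma state_projection_zero:
  assumes "state \<omega>" "adj p = p" "p * p = p" "\<omega> p = 0" shows "\<omega> (p * b) = 0"
proof -
  have "(cmod (\<omega> (adj p * b)))\<^sup>2 \<le> Re (\<omega> (adj b * b)) * Re (\<omega> (adj p * p))"
    by (rule state_Cauchy_Schwarz[OF assms(1)])
  then show ?thesis using assms(2-4) by simp
qed

lemma state_projection_one:
  assumes "state \<omega>" "adj p = p" "p * p = p" "\<omega> p = 1" shows "\<omega> (p * b) = \<omega> b"
proof -
  have "\<omega> ((1 - p) * b) = 0"
    by (rule state_projection_zero[OF assms(1)])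
      (use assms(2-4) in \<open>simp_all add: adj_diff adj_one algebra_simps state_diff[OF assms(1)] state_one[OF assms(1)]\<close>)
  then show ?thesis by (simp add: left_diff_distrib state_diff[OF assms(1)])
qed

context cuntz_krieger_algebra
begin

inductive_set unit_span :: "'a set" where
  zero: "0 \<in> unit_span"
| add: "set u \<subseteq> {..<d} \<Longrightarrow> set v \<subseteq> {..<d} \<Longrightarrow> x \<in> unit_span \<Longrightarrow>
    c *\<^sub>C (word u * adj (word v)) + x \<in> unit_span"

lemma unit_span_add: "x \<in> unit_span \<Longrightarrow> y \<in> unit_span \<Longrightarrow> x + y \<in> unit_span"
  by (induction rule: unit_span.induct) (auto simp: add.assoc intro: unit_span.add)

lemma unit_span_scale: "x \<in> unit_span \<Longrightarrow> c *\<^sub>C x \<in> unit_span"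
  by (induction rule: unit_span.induct)
    (auto simp: scaleC_zero_right scaleC_add_right scaleC_scaleC intro: unit_span.intros)

lemma unit_span_unit: "set u \<subseteq> {..<d} \<Longrightarrow> set v \<subseteq> {..<d} \<Longrightarrow> word u * adj (word v) \<in> unit_span"
  using unit_span.add[OF _ _ unit_span.zero, of u v 1] by (simp add: scaleC_one)

lemma unit_span_sum: "(\<And>j. j \<in> J \<Longrightarrow> f j \<in> unit_span) \<Longrightarrow> sum f J \<in> unit_span"
  by (induction J rule: infinite_finite_induct) (auto intro: unit_span_add unit_span.zero)

lemma unit_span_left:
  assumes "\<And>u v. set u \<subseteq> {..<d} \<Longrightarrow> set v \<subseteq> {..<d} \<Longrightarrow> y * (word u * adj (word v)) \<in> unit_span"
    and "x \<in> unit_span"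
  shows "y * x \<in> unit_span"
  using assms(2)
  by induction (auto simp: distrib_left mult_scaleC_right unit_span.zero intro!: unit_span_add unit_span_scale assms(1))

lemma gen_unit_span: assumes "i < d" "x \<in> unit_span" shows "s i * x \<in> unit_span"
proof (rule unit_span_left[OF _ assms(2)])
  fix u v assume "set u \<subseteq> {..<d}" "set v \<subseteq> {..<d}"
  then show "s i * (word u * adj (word v)) \<in> unit_span"
    using unit_span_unit[of "i # u" v] assms(1) by (simp add: word_Cons mult.assoc)
qed

text \<open>Only the term \<open>j = k\<close> of \<open>s\<^sub>i\<^sup>* s\<^sub>i = \<Sum>\<^sub>j A\<^sub>i\<^sub>j s\<^sub>j s\<^sub>j\<^sup>*\<close> survives the multiplication by \<open>s\<^sub>k\<close>.\<close>

lemma gen_square_gen: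
  assumes "i < d" "k < d" shows "adj (s i) * s i * s k = of_nat (A $$ (i, k)) * s k"
proof -
  have "adj (s i) * s i * s k = (\<Sum>j<d. of_nat (A $$ (i, j)) * (s j * (adj (s j) * s k)))"
    unfolding gen_square_sum[OF assms(1)] by (simp add: sum_distrib_right mult.assoc)
  also have "\<dots> = (\<Sum>j<d. if j = k then of_nat (A $$ (i, k)) * s k else 0)"
    using assms by (intro sum.cong) (auto simp: gen_orthogonal gen_partial)
  also have "\<dots> = of_nat (A $$ (i, k)) * s k" using assms(2) by simp
  finally show ?thesis .
qed

lemma gen_adj_unit_span: assumes "i < d" "x \<in> unit_span" shows "adj (s i) * x \<in> unit_span"
proof (rule unit_span_left[OF _ assms(2)])
  fix u v assume u: "set u \<subseteq> {..<d}" and v: "set v \<subseteq> {..<d}"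
  show "adj (s i) * (word u * adj (word v)) \<in> unit_span"
  proof (cases u)
    case Nil
    then show ?thesis using unit_span_unit[of "[]" "v @ [i]"] v assms(1)
      by (simp add: word_Nil word_Cons word_append adj_mult)
  next
    case (Cons j u')
    then have j: "j < d" and u': "set u' \<subseteq> {..<d}" using u by auto
    show ?thesis
    proof (cases "i = j")
      case False
      have "adj (s i) * (word u * adj (word v)) = (adj (s i) * s j) * (word u' * adj (word v))"
        by (simp add: Cons word_Cons mult.assoc)
      then show ?thesis using gen_orthogonal[OF assms(1) j False] by (simp add: unit_span.zero)
    next
      case True
      have eq: "adj (s i) * (word u * adj (word v)) = adj (s i) * s i * (word u' * adj (word v))"
        by (simp add: Cons True word_Cons mult.assoc)
      show ?thesis
      proof (cases u')
        case Nil
        have "adj (s i) * s i * (word u' * adj (word v)) =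
            (\<Sum>k<d. of_nat (A $$ (i, k)) *\<^sub>C (word [k] * adj (word (v @ [k]))))"
          unfolding gen_square_sum[OF assms(1)]
          by (simp add: Nil word_Nil word_Cons word_append adj_mult sum_distrib_right mult.assoc
              of_nat_mult_scaleC mult_scaleC_left)
        also have "\<dots> \<in> unit_span" using v by (intro unit_span_sum unit_span_scale unit_span_unit) auto
        finally show ?thesis using eq by simp
      next
        case (Cons k w)
        then have k: "k < d" using u' by auto
        have "adj (s i) * s i * (word u' * adj (word v)) = (adj (s i) * s i * s k) * (word w * adj (word v))"
          by (simp add: Cons word_Cons mult.assoc)
        also have "\<dots> = of_nat (A $$ (i, k)) *\<^sub>C (word u' * adj (word v))"
          unfolding gen_square_gen[OF assms(1) k]
          by (simp add: Cons word_Cons mult.assoc of_nat_mult_scaleC mult_scaleC_left)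
        also have "\<dots> \<in> unit_span" by (intro unit_span_scale unit_span_unit u' v)
        finally show ?thesis using eq by simp
      qed
    qed
  qed
qed

text \<open>The relations allow every word in the generators and their adjoints to be rewritten as a
  combination of the matrix units \<open>s\<^sub>u s\<^sub>v\<^sup>*\<close>.\<close>

lemma poly_eval_unit_span: assumes "p \<in> star_polys d" shows "poly_eval s p \<in> unit_span"
proof -
  have "prod_list (map (\<lambda>(i, b). if b then adj (s i) else s i) l) \<in> unit_span"
    if "fst ` set l \<subseteq> {..<d}" for l
    using that
  proof (induction l)
    case Nil
    then show ?case using unit_span_unit[of "[]" "[]"] by (simp add: word_Nil adj_one)
  next
    case (Cons l ls)
    then show ?case by (cases l) (auto simp: gen_unit_span gen_adj_unit_span)
  qed
  then show ?thesis
    using assms unfolding poly_eval_def word_eval_def star_polys_def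
    by (intro unit_span_sum unit_span_scale) auto
qed

text \<open>Induction for closed properties of all elements of the algebra, along the dense span of the
  matrix units.\<close>

lemma dense_unit_induct:
  assumes "closed {x. P x}" "P 0"
    and "\<And>c u v x. set u \<subseteq> {..<d} \<Longrightarrow> set v \<subseteq> {..<d} \<Longrightarrow> P x \<Longrightarrow> P (c *\<^sub>C (word u * adj (word v)) + x)"
  shows "P x"
proof -
  have "P x" if "x \<in> unit_span" for x
    using that by induction (use assms in auto)
  then have "closure (poly_eval s ` star_polys d) \<subseteq> {x. P x}"
    using poly_eval_unit_span assms(1) by (intro closure_minimal) auto
  then show ?thesis using dense_polys by auto
qed

lemma state_iota_sup_bounded_additive:
  assumes "state \<omega>"
  shows "sup_bounded_additive (\<lambda>f. \<omega> (\<iota> f * b))" "sup_bounded_additive (\<lambda>f. \<omega> (b * \<iota> f))"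
proof -
  have le: "cmod (\<omega> (x * y)) \<le> norm x * norm y" for x y
    using state_norm_le[OF assms, of "x * y"] norm_mult_ineq[of x y] by linarith
  show "sup_bounded_additive (\<lambda>f. \<omega> (\<iota> f * b))"
  proof (rule sup_bounded_additiveI[where K = "norm b"])
    fix f B assume "f \<in> cont_funs A" "\<And>x. x \<in> \<Lambda> \<Longrightarrow> cmod (f x) \<le> B"
    then have "norm (\<iota> f) * norm b \<le> B * norm b" by (intro mult_right_mono iota_norm_le) auto
    then show "cmod (\<omega> (\<iota> f * b)) \<le> norm b * B" using le[of "\<iota> f" b] by (simp add: mult.commute)
  qed (simp add: iota_add distrib_right state_add[OF assms])
  show "sup_bounded_additive (\<lambda>f. \<omega> (b * \<iota> f))"
  proof (rule sup_bounded_additiveI[where K = "norm b"])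
    fix f B assume "f \<in> cont_funs A" "\<And>x. x \<in> \<Lambda> \<Longrightarrow> cmod (f x) \<le> B"
    then have "norm b * norm (\<iota> f) \<le> norm b * B" by (intro mult_left_mono iota_norm_le) auto
    then show "cmod (\<omega> (b * \<iota> f)) \<le> norm b * B" using le[of b "\<iota> f"] by linarith
  qed (simp add: iota_add distrib_left state_add[OF assms])
qed

lemma iota_indicator_projection:
  "adj (\<iota> (indicator (cylinder w))) = \<iota> (indicator (cylinder w))"
  "\<iota> (indicator (cylinder w)) * \<iota> (indicator (cylinder w)) = \<iota> (indicator (cylinder w))"
proof -
  have "(\<lambda>x. cnj (indicator (cylinder w) x)) = (indicator (cylinder w) :: _ \<Rightarrow> complex)"
    by (auto simp: indicator_def)
  then show "adj (\<iota> (indicator (cylinder w))) = \<iota> (indicator (cylinder w))"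
    using iota_adj[OF cont_funs_indicator, of w] by simp
  have "(\<lambda>x. indicator (cylinder w) x * indicator (cylinder w) x) = (indicator (cylinder w) :: _ \<Rightarrow> complex)"
    by (auto simp: indicator_def)
  then show "\<iota> (indicator (cylinder w)) * \<iota> (indicator (cylinder w)) = \<iota> (indicator (cylinder w))"
    using iota_mult[OF cont_funs_indicator cont_funs_indicator, of w w] by simp
qed

text \<open>The vector state at \<open>x\<close> takes the value \<open>0\<close> or \<open>1\<close> on the projection of a cylinder. By the
  Cauchy-Schwarz inequality such a projection lies in the multiplicative domain.\<close>

lemma vector_state_iota:
  assumes x: "x \<in> \<Lambda>" and f: "f \<in> cont_funs A"
  shows "vector_state x (\<iota> f * b) = f x * vector_state x b"
proof (rule cylinder_agreement[OF _ _ _ f])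
  note st = vector_state(1)[OF x]
  show "sup_bounded_additive (\<lambda>f. vector_state x (\<iota> f * b))"
    by (rule state_iota_sup_bounded_additive[OF st])
  show "sup_bounded_additive (\<lambda>f. f x * vector_state x b)"
  proof (rule sup_bounded_additiveI[where K = "cmod (vector_state x b)"])
    fix f B assume "\<And>x. x \<in> \<Lambda> \<Longrightarrow> cmod (f x) \<le> B"
    then have "cmod (f x) * cmod (vector_state x b) \<le> B * cmod (vector_state x b)"
      using x by (intro mult_right_mono) auto
    then show "cmod (f x * vector_state x b) \<le> cmod (vector_state x b) * B"
      by (simp add: norm_mult mult.commute)
  qed (simp add: distrib_right)
  fix c and w :: "nat list" assume w: "set w \<subseteq> {..<d}"
  let ?p = "\<iota> (indicator (cylinder w))"
  have val: "vector_state x ?p = (if x \<in> cylinder w then 1 else 0)"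
    unfolding iota_cylinder[OF w] using vector_state_matrix_unit[OF x w w] by simp
  have "vector_state x (?p * b) = indicator (cylinder w) x * vector_state x b"
  proof (cases "x \<in> cylinder w")
    case True
    then show ?thesis
      using state_projection_one[OF st iota_indicator_projection[of w], of b] val by simp
  next
    case False
    then show ?thesis
      using state_projection_zero[OF st iota_indicator_projection[of w], of b] val by simp
  qed
  then show "vector_state x (\<iota> (\<lambda>x. c * indicator (cylinder w) x) * b) =
      c * indicator (cylinder w) x * vector_state x b"
    by (simp only: iota_scale[OF cont_funs_indicator] mult_scaleC_left state_scaleC[OF st] mult.assoc)
qed

lemma vector_state_iota_right:
  assumes x: "x \<in> \<Lambda>" and f: "f \<in> cont_funs A"
  shows "vector_state x (b * \<iota> f) = vector_state x b * f x"
proof -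
  have f': "(\<lambda>x. cnj (f x)) \<in> cont_funs A"
    using f by (auto simp: cont_funs_def intro: continuous_intros)
  have "b * \<iota> f = adj (\<iota> (\<lambda>x. cnj (f x)) * adj b)"
    using iota_adj[OF f'] by (simp add: adj_mult adj_adj)
  then show ?thesis
    using vector_state_iota[OF x f', of "adj b"] by (simp add: state_adj[OF vector_state(1)[OF x]])
qed

text \<open>On matrix units the function is zero or the indicator of a cylinder, and the limits are uniform
  in \<open>x\<close> because states are contractive.\<close>

lemma vector_state_cont_funs: "(\<lambda>x. vector_state x b) \<in> cont_funs A"
proof (rule dense_unit_induct[where P = "\<lambda>b. (\<lambda>x. vector_state x b) \<in> cont_funs A"])
  show "closed {b. (\<lambda>x. vector_state x b) \<in> cont_funs A}"
    unfolding closed_sequential_limits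
  proof (intro allI impI, elim conjE)
    fix u :: "nat \<Rightarrow> 'a" and b
    assume u: "\<forall>n. u n \<in> {b. (\<lambda>x. vector_state x b) \<in> cont_funs A}" and lim: "u \<longlonglongrightarrow> b"
    have "continuous_on \<Lambda> (\<lambda>x. vector_state x b)"
    proof (rule uniform_limit_theorem)
      show "\<forall>\<^sub>F n in sequentially. continuous_on \<Lambda> (\<lambda>x. vector_state x (u n))"
        using u by (simp add: cont_funs_def)
      show "uniform_limit \<Lambda> (\<lambda>n x. vector_state x (u n)) (\<lambda>x. vector_state x b) sequentially"
      proof (rule uniform_limitI)
        fix e :: real assume "0 < e"
        then have "\<forall>\<^sub>F n in sequentially. dist (u n) b < e" using lim by (rule tendstoD[rotated])
        then show "\<forall>\<^sub>F n in sequentially. \<forall>x\<in>\<Lambda>. dist (vector_state x (u n)) (vector_state x b) < e"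
        proof eventually_elim
          case (elim n)
          show ?case
          proof
            fix x assume x: "x \<in> \<Lambda>"
            have "dist (vector_state x (u n)) (vector_state x b) = cmod (vector_state x (u n - b))"
              by (simp add: dist_norm state_diff[OF vector_state(1)[OF x]])
            also have "\<dots> \<le> dist (u n) b"
              unfolding dist_norm by (rule state_norm_le[OF vector_state(1)[OF x]])
            finally show "dist (vector_state x (u n)) (vector_state x b) < e" using elim by linarith
          qed
        qed
      qed
    qed simp
    then show "b \<in> {b. (\<lambda>x. vector_state x b) \<in> cont_funs A}" by (simp add: cont_funs_def)
  qed
  have "(\<lambda>x. vector_state x 0) \<in> cont_funs A \<longleftrightarrow> (\<lambda>x. 0) \<in> cont_funs A"
    by (rule cont_funs_cong) (simp add: state_zero[OF vector_state(1)])
  then show "(\<lambda>x. vector_state x 0) \<in> cont_funs A" using cont_funs_const by blast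
  fix c b and u v :: "nat list"
  assume u: "set u \<subseteq> {..<d}" and v: "set v \<subseteq> {..<d}" and b: "(\<lambda>x. vector_state x b) \<in> cont_funs A"
  have "(\<lambda>x. vector_state x (c *\<^sub>C (word u * adj (word v)) + b)) \<in> cont_funs A \<longleftrightarrow>
      (\<lambda>x. (if u = v then c else 0) * indicator (cylinder u) x + vector_state x b) \<in> cont_funs A"
  proof (rule cont_funs_cong)
    fix x assume x: "x \<in> \<Lambda>"
    show "vector_state x (c *\<^sub>C (word u * adj (word v)) + b) =
        (if u = v then c else 0) * indicator (cylinder u) x + vector_state x b"
      by (simp add: state_add[OF vector_state(1)[OF x]] state_scaleC[OF vector_state(1)[OF x]]
          vector_state_matrix_unit[OF x u v])
  qed
  moreover have "(\<lambda>x. (if u = v then c else 0) * indicator (cylinder u) x + vector_state x b) \<in> cont_funs A"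
    by (intro cont_funs_add cont_funs_cylinder b)
  ultimately show "(\<lambda>x. vector_state x (c *\<^sub>C (word u * adj (word v)) + b)) \<in> cont_funs A" by blast
qed

text \<open>This is what makes the definite description in \<open>restriction\<close> meaningful: indicators of clopen
  sets are projections, hence squares, so the restriction of a state is positive on them.\<close>

lemma state_restriction:
  assumes "state \<omega>"
  shows "restriction A \<iota> \<omega> \<in> prob_measures A"
    and "f \<in> cont_funs A \<Longrightarrow> \<omega> (\<iota> f) = functional_of (restriction A \<iota> \<omega>) f"
proof -
  have "\<exists>\<mu>\<in>prob_measures A. \<forall>f\<in>cont_funs A. \<omega> (\<iota> f) = functional_of \<mu> f"
  proof (rule shift_space_Riesz)
    show "sup_bounded_additive (\<lambda>f. \<omega> (\<iota> f))"
      using state_iota_sup_bounded_additive(1)[OF assms, of 1] by simp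
    show "\<omega> (\<iota> (\<lambda>x. c * f x)) = c * \<omega> (\<iota> f)" if "f \<in> cont_funs A" for c f
      using that by (simp add: iota_scale state_scaleC[OF assms])
    show "\<omega> (\<iota> (\<lambda>x. 1)) = 1" by (simp add: iota_one state_one[OF assms])
    fix C assume "C \<in> clopens"
    then have C: "(indicator C :: _ \<Rightarrow> complex) \<in> cont_funs A" by (simp add: clopens_def)
    have "(\<lambda>x. cnj (indicator C x)) = (indicator C :: _ \<Rightarrow> complex)" by (auto simp: indicator_def)
    then have "adj (\<iota> (indicator C)) = \<iota> (indicator C)" using iota_adj[OF C] by simp
    moreover have "(\<lambda>x. indicator C x * indicator C x) = (indicator C :: _ \<Rightarrow> complex)"
      by (auto simp: indicator_def)
    ultimately have "\<iota> (indicator C) = adj (\<iota> (indicator C)) * \<iota> (indicator C)"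
      using iota_mult[OF C C] by simp
    then show "\<omega> (\<iota> (indicator C)) \<in> \<real>\<^sub>\<ge>\<^sub>0" using assms unfolding state_def by metis
  qed
  then obtain \<mu> where \<mu>: "\<mu> \<in> prob_measures A" "\<forall>f\<in>cont_funs A. \<omega> (\<iota> f) = functional_of \<mu> f" by blast
  have "restriction A \<iota> \<omega> = \<mu>"
    unfolding restriction_def
  proof (rule the_equality)
    show "\<mu> \<in> prob_measures A \<and> (\<forall>f\<in>cont_funs A. \<omega> (\<iota> f) = functional_of \<mu> f)" using \<mu> by blast
    fix \<nu> assume "\<nu> \<in> prob_measures A \<and> (\<forall>f\<in>cont_funs A. \<omega> (\<iota> f) = functional_of \<nu> f)"
    then show "\<nu> = \<mu>" using \<mu> by (intro prob_measures_eqI) auto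
  qed
  then show "restriction A \<iota> \<omega> \<in> prob_measures A"
    "f \<in> cont_funs A \<Longrightarrow> \<omega> (\<iota> f) = functional_of (restriction A \<iota> \<omega>) f" using \<mu> by auto
qed

lemma restriction_eqI:
  assumes "state \<omega>" "\<mu> \<in> prob_measures A" "\<And>f. f \<in> cont_funs A \<Longrightarrow> \<omega> (\<iota> f) = functional_of \<mu> f"
  shows "restriction A \<iota> \<omega> = \<mu>"
  using state_restriction[OF assms(1)] assms(2,3) by (intro prob_measures_eqI) auto

end

section \<open>KMS states restrict to eigenmeasures\<close>

locale cuntz_krieger_flow = cuntz_krieger_algebra A d s \<iota> for A d
    and s :: "nat \<Rightarrow> 'a::unital_cstar_algebra" and \<iota> +
  fixes \<beta> :: real and a :: "(nat \<Rightarrow> nat) \<Rightarrow> real" and \<alpha> :: "real \<Rightarrow> 'a \<Rightarrow> 'a"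
  assumes a_cont: "continuous_on (shift_space A) a" and flow: "is_flow A s \<iota> \<beta> a \<alpha>"
begin

definition potential :: "(nat \<Rightarrow> nat) \<Rightarrow> complex" where "potential x = of_real (\<beta> - a x)"

lemma cont_funs_of_real: "continuous_on \<Lambda> g \<Longrightarrow> (\<lambda>x. of_real (g x)) \<in> cont_funs A"
  by (auto simp: cont_funs_def intro: continuous_intros)

lemma cont_funs_potential: "potential \<in> cont_funs A"
  unfolding potential_def[abs_def] using a_cont by (intro cont_funs_of_real continuous_intros)

text \<open>For real \<open>z\<close> these are the unitaries by which the flow multiplies the generators.\<close>

definition cocycle :: "complex \<Rightarrow> 'a" where
  "cocycle z = \<iota> (\<lambda>x. exp (\<i> * z * potential x))"

lemma cont_funs_cocycle: "(\<lambda>x. exp (\<i> * z * potential x)) \<in> cont_funs A"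
  by (intro cont_funs_exp cont_funs_scale cont_funs_potential)

lemma cocycle_zero: "cocycle 0 = 1" by (simp add: cocycle_def iota_one)

lemma cocycle_adj: "adj (cocycle z) = cocycle (- cnj z)"
proof -
  have "(\<lambda>x. cnj (exp (\<i> * z * potential x))) = (\<lambda>x. exp (\<i> * (- cnj z) * potential x))"
    by (rule ext) (simp add: exp_cnj potential_def)
  then show ?thesis using iota_adj[OF cont_funs_cocycle[of z]] by (simp only: cocycle_def)
qed

lemma cocycle_entire: "entire cocycle"
  using entire_iota_exp[OF cont_funs_scale[OF cont_funs_potential, of \<i>]]
  by (simp add: cocycle_def[abs_def] mult_ac)

lemma flow_gen: assumes "i < d" shows "\<alpha> t (s i) = cocycle (of_real t) * s i"
proof -
  have "of_real \<beta> - \<iota> (\<lambda>x. of_real (a x)) = \<iota> potential"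
  proof -
    have "\<iota> potential = \<iota> (\<lambda>x. of_real \<beta> - of_real (a x))" by (simp add: potential_def[abs_def])
    also have "\<dots> = \<iota> (\<lambda>x. of_real \<beta>) - \<iota> (\<lambda>x. of_real (a x))"
      by (intro iota_diff cont_funs_const cont_funs_of_real a_cont)
    also have "\<iota> (\<lambda>x. of_real \<beta>) = of_real \<beta>" by (simp only: iota_const scaleC_of_real scaleR_conv_of_real mult_1_right)
    finally show ?thesis by simp
  qed
  then have "\<alpha> t (s i) = exp ((\<i> * of_real t) *\<^sub>C \<iota> potential) * s i"
    using flow assms unfolding is_flow_def by simp
  also have "(\<i> * of_real t) *\<^sub>C \<iota> potential = \<iota> (\<lambda>x. \<i> * of_real t * potential x)"
    by (rule iota_scale[OF cont_funs_potential, symmetric])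
  also have "exp \<dots> = cocycle (of_real t)"
    unfolding cocycle_def by (intro iota_exp cont_funs_scale cont_funs_potential)
  finally show ?thesis .
qed

lemma flow_hom: "star_hom (\<alpha> t)"
  using flow unfolding is_flow_def one_parameter_automorphism_group_def by blast

lemma flow_mult: "\<alpha> t (x * y) = \<alpha> t x * \<alpha> t y"
  and flow_add: "\<alpha> t (x + y) = \<alpha> t x + \<alpha> t y"
  and flow_scaleC: "\<alpha> t (c *\<^sub>C x) = c *\<^sub>C \<alpha> t x"
  and flow_adj: "\<alpha> t (adj x) = adj (\<alpha> t x)"
  and flow_one: "\<alpha> t 1 = 1"
  using flow_hom[of t] unfolding star_hom_def by blast+

lemma flow_gen_adj: "i < d \<Longrightarrow> \<alpha> t (adj (s i)) = adj (s i) * cocycle (- of_real t)"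
  by (simp add: flow_adj flow_gen adj_mult cocycle_adj)

lemma iota_cocycle_mult:
  "f \<in> cont_funs A \<Longrightarrow> cocycle z * \<iota> f * cocycle (- z) = \<iota> f"
proof -
  assume f: "f \<in> cont_funs A"
  have "cocycle z * \<iota> f * cocycle (- z) = \<iota> (\<lambda>x. exp (\<i> * z * potential x) * f x * exp (\<i> * (- z) * potential x))"
    unfolding cocycle_def
    by (simp only: iota_mult[OF cont_funs_cocycle f] iota_mult[OF cont_funs_mult[OF cont_funs_cocycle f] cont_funs_cocycle])
  also have "(\<lambda>x. exp (\<i> * z * potential x) * f x * exp (\<i> * (- z) * potential x)) = f"
    by (rule ext) (simp add: exp_minus)
  finally show ?thesis .
qed

text \<open>The cocycle commutes with \<open>C(\<Lambda>\<^sub>A)\<close>, so it cancels in \<open>s\<^sub>i p s\<^sub>i\<^sup>*\<close>.\<close>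

lemma flow_cylinder: "set w \<subseteq> {..<d} \<Longrightarrow> \<alpha> t (\<iota> (indicator (cylinder w))) = \<iota> (indicator (cylinder w))"
proof (induction w)
  case Nil
  then show ?case by (simp add: iota_cylinder word_Nil adj_one flow_one)
next
  case (Cons i w)
  have eq: "\<iota> (indicator (cylinder (i # w))) = s i * \<iota> (indicator (cylinder w)) * adj (s i)"
    using Cons.prems by (simp add: iota_cylinder word_Cons adj_mult mult.assoc)
  have "\<alpha> t (\<iota> (indicator (cylinder (i # w)))) =
      cocycle (of_real t) * (s i * \<iota> (indicator (cylinder w)) * adj (s i)) * cocycle (- of_real t)"
    unfolding eq flow_mult using Cons by (simp add: flow_gen flow_gen_adj mult.assoc)
  then show ?case
    unfolding eq[symmetric] using iota_cocycle_mult[OF cont_funs_indicator] by simp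
qed

lemma entire_extensionI:
  assumes "\<And>t. F (of_real t) = \<alpha> t c" "entire F" shows "entire_extension \<alpha> c F"
  using assms by (simp add: entire_extension_def entire_def)

lemma entire_extension_gen: "i < d \<Longrightarrow> entire_extension \<alpha> (s i) (\<lambda>z. cocycle z * s i)"
  by (intro entire_extensionI entire_mult cocycle_entire entire_const) (simp add: flow_gen)

lemma entire_extension_cylinder:
  "set w \<subseteq> {..<d} \<Longrightarrow> entire_extension \<alpha> (\<iota> (indicator (cylinder w))) (\<lambda>z. \<iota> (indicator (cylinder w)))"
  by (intro entire_extensionI entire_const) (simp add: flow_cylinder)

lemma exp_a_cont_funs: "(\<lambda>x. of_real (exp (a x))) \<in> cont_funs A"
  using a_cont by (intro cont_funs_of_real continuous_intros)

lemma ruelle_op_branches: "x \<in> \<Lambda> \<Longrightarrow> ruelle_op A a f x = (\<Sum>i<d. branch i (\<lambda>x. of_real (exp (a x)) * f x) x)"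
  unfolding ruelle_op_def branch_def
  by (subst sum.inter_filter[symmetric]) (auto intro!: sum.cong)

lemma ruelle_op_cont_funs: "f \<in> cont_funs A \<Longrightarrow> ruelle_op A a f \<in> cont_funs A"
proof -
  assume f: "f \<in> cont_funs A"
  have "(\<lambda>x. \<Sum>i<d. branch i (\<lambda>x. of_real (exp (a x)) * f x) x) \<in> cont_funs A"
    by (intro cont_funs_sum branch_cont_funs cont_funs_mult exp_a_cont_funs f) simp
  then show ?thesis
    using cont_funs_cong[of "ruelle_op A a f", OF ruelle_op_branches] by blast
qed

context
  fixes \<omega> assumes kms: "kms_state \<alpha> \<omega>"
begin

lemma kms_is_state: "state \<omega>" using kms by (simp add: kms_state_def)

lemma kms_condition: "entire_extension \<alpha> c F \<Longrightarrow> \<omega> (b * c) = \<omega> (F (- \<i>) * b)"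
  using kms by (simp add: kms_state_def)

text \<open>Projections of cylinders are fixed by the flow, so the KMS condition for them is a trace
  condition.\<close>

lemma kms_iota_commute: assumes f: "f \<in> cont_funs A" shows "\<omega> (b * \<iota> f) = \<omega> (\<iota> f * b)"
proof (rule cylinder_agreement[OF state_iota_sup_bounded_additive(2)[OF kms_is_state]
      state_iota_sup_bounded_additive(1)[OF kms_is_state] _ f])
  fix c and w :: "nat list" assume w: "set w \<subseteq> {..<d}"
  show "\<omega> (b * \<iota> (\<lambda>x. c * indicator (cylinder w) x)) = \<omega> (\<iota> (\<lambda>x. c * indicator (cylinder w) x) * b)"
    unfolding iota_scale[OF cont_funs_indicator] mult_scaleC_left mult_scaleC_right
      state_scaleC[OF kms_is_state] kms_condition[OF entire_extension_cylinder[OF w]] ..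
qed

text \<open>Apply the KMS condition to \<open>c = s\<^sub>i\<close> and \<open>b = s\<^sub>i\<^sup>* e\<^sup>a f\<close>, and sum over \<open>i\<close>.\<close>

lemma kms_ruelle:
  assumes f: "f \<in> cont_funs A"
  shows "\<omega> (\<iota> (ruelle_op A a f)) = of_real (exp \<beta>) * \<omega> (\<iota> f)"
proof -
  let ?g = "\<lambda>x. of_real (exp (a x)) * f x"
  have g: "?g \<in> cont_funs A" by (intro cont_funs_mult exp_a_cont_funs f)
  have one: "\<omega> (\<iota> (branch i ?g)) = \<omega> (\<iota> (\<lambda>x. of_real (exp \<beta>) * (indicator (cylinder [i]) x * f x)))"
    if i: "i < d" for i
  proof -
    have "\<omega> (\<iota> (branch i ?g)) = \<omega> ((adj (s i) * \<iota> ?g) * s i)"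
      by (simp add: iota_branch[OF g i])
    also have "\<dots> = \<omega> (cocycle (- \<i>) * s i * (adj (s i) * \<iota> ?g))"
      by (rule kms_condition[OF entire_extension_gen[OF i]])
    also have "cocycle (- \<i>) * s i * (adj (s i) * \<iota> ?g) = cocycle (- \<i>) * (s i * adj (s i)) * \<iota> ?g"
      by (simp only: mult.assoc)
    also have "\<dots> = \<iota> (\<lambda>x. exp (\<i> * (- \<i>) * potential x) * indicator (cylinder [i]) x * ?g x)"
      unfolding cocycle_def gen_proj[OF i]
      by (simp only: iota_mult cont_funs_mult cont_funs_cocycle cont_funs_indicator g)
    also have "(\<lambda>x. exp (\<i> * (- \<i>) * potential x) * indicator (cylinder [i]) x * ?g x) =
        (\<lambda>x. of_real (exp \<beta>) * (indicator (cylinder [i]) x * f x))"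
      by (rule ext) (simp add: potential_def exp_diff exp_of_real[symmetric])
    finally show ?thesis .
  qed
  have "\<iota> (ruelle_op A a f) = (\<Sum>i<d. \<iota> (branch i ?g))"
  proof -
    have "\<iota> (ruelle_op A a f) = \<iota> (\<lambda>x. \<Sum>i<d. branch i ?g x)"
      by (rule iota_cong[OF ruelle_op_cont_funs[OF f] ruelle_op_branches])
    also have "\<dots> = (\<Sum>i<d. \<iota> (branch i ?g))"
      by (rule iota_sum) (simp add: branch_cont_funs g)
    finally show ?thesis .
  qed
  then have "\<omega> (\<iota> (ruelle_op A a f)) =
      (\<Sum>i<d. \<omega> (\<iota> (\<lambda>x. of_real (exp \<beta>) * (indicator (cylinder [i]) x * f x))))"
    using one by (simp add: state_sum[OF kms_is_state])
  also have "\<dots> = of_real (exp \<beta>) * \<omega> ((\<Sum>i<d. s i * adj (s i)) * \<iota> f)"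
    by (simp add: iota_scale iota_mult cont_funs_mult cont_funs_indicator f gen_proj state_scaleC[OF kms_is_state]
        state_sum[OF kms_is_state] sum_distrib_left sum_distrib_right del: of_real_exp)
  also have "(\<Sum>i<d. s i * adj (s i)) = 1"
    using cuntz_krieger_family by (simp add: cuntz_krieger_family_def)
  finally show ?thesis by simp
qed

lemma kms_restriction_eigenmeasure: "restriction A \<iota> \<omega> \<in> eigenmeasures A a \<beta>"
  unfolding eigenmeasures_def ruelle_adjoint_def
  using state_restriction(1)[OF kms_is_state] kms_ruelle
  by (simp add: state_restriction(2)[OF kms_is_state, symmetric] ruelle_op_cont_funs)

end

end

section \<open>Uniqueness: eigenmeasures without atoms\<close>

text \<open>A strictly positive supersolution bounds the spectral radius: compare the modulus of an
  eigenvector with it at the index where their ratio is largest. Aperiodicity makes a nonzero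
  supersolution strictly positive.\<close>

lemma (in markov_shift) spectral_radius_le_supersolution:
  fixes v :: "nat \<Rightarrow> real"
  assumes nonneg: "\<And>i. i < d \<Longrightarrow> 0 \<le> v i" and lam: "0 < l"
    and super: "\<And>i. i < d \<Longrightarrow> (\<Sum>j<d. real (A $$ (i, j)) * v j) \<le> l * v i"
    and nonzero: "j0 < d" "0 < v j0"
  shows "spectral_radius (map_mat of_nat A) \<le> l"
proof -
  have pow: "(\<Sum>j<d. real ((A ^\<^sub>m n) $$ (i, j)) * v j) \<le> l ^ n * v i" if "i < d" for i n
    using that
  proof (induction n arbitrary: i)
    case 0
    have "(\<Sum>j<d. real ((A ^\<^sub>m 0) $$ (i, j)) * v j) = (\<Sum>j<d. if j = i then v j else 0)"
      using 0 carrier by (intro sum.cong) auto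
    then show ?case using 0 by simp
  next
    case (Suc n)
    have e: "(A ^\<^sub>m Suc n) $$ (i, j) = (\<Sum>k<d. A $$ (i, k) * (A ^\<^sub>m n) $$ (k, j))" if "j < d" for j
      unfolding pow_mat_Suc_left[OF carrier]
      using that Suc.prems carrier by (simp add: scalar_prod_def atLeast0LessThan)
    have "(\<Sum>j<d. real ((A ^\<^sub>m Suc n) $$ (i, j)) * v j) =
        (\<Sum>j<d. \<Sum>k<d. real (A $$ (i, k)) * (real ((A ^\<^sub>m n) $$ (k, j)) * v j))"
      by (intro sum.cong) (simp_all add: e sum_distrib_right mult.assoc del: pow_mat.simps)
    also have "\<dots> = (\<Sum>k<d. real (A $$ (i, k)) * (\<Sum>j<d. real ((A ^\<^sub>m n) $$ (k, j)) * v j))"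
      by (subst sum.swap) (simp add: sum_distrib_left)
    also have "\<dots> \<le> (\<Sum>k<d. real (A $$ (i, k)) * (l ^ n * v k))"
      by (intro sum_mono mult_left_mono Suc.IH) auto
    also have "\<dots> = l ^ n * (\<Sum>k<d. real (A $$ (i, k)) * v k)"
      by (simp add: sum_distrib_left mult_ac)
    also have "\<dots> \<le> l ^ n * (l * v i)" using lam Suc.prems by (intro mult_left_mono super) auto
    finally show ?case by (simp add: mult_ac)
  qed
  obtain N where N: "\<And>i j. i < d \<Longrightarrow> j < d \<Longrightarrow> 0 < (A ^\<^sub>m N) $$ (i, j)"
    using aper unfolding aperiodic_def by auto
  have pos: "0 < v i" if i: "i < d" for i
  proof -
    have "0 < real ((A ^\<^sub>m N) $$ (i, j0)) * v j0" using N[OF i nonzero(1)] nonzero(2) by simp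
    also have "\<dots> \<le> (\<Sum>j<d. real ((A ^\<^sub>m N) $$ (i, j)) * v j)"
      using nonneg nonzero(1) by (intro member_le_sum) auto
    also have "\<dots> \<le> l ^ N * v i" by (rule pow[OF i])
    finally show ?thesis using lam by (simp add: zero_less_mult_iff)
  qed
  let ?A = "map_mat of_nat A :: complex mat"
  have cA: "?A \<in> carrier_mat d d" using carrier by simp
  obtain \<rho> where \<rho>: "\<rho> \<in> spectrum ?A" "spectral_radius ?A = cmod \<rho>"
    using spectral_radius_mem_max(1)[OF cA d_pos] by auto
  then obtain x where x: "x \<in> carrier_vec d" "x \<noteq> 0\<^sub>v d" "?A *\<^sub>v x = \<rho> \<cdot>\<^sub>v x"
    using cA unfolding spectrum_def eigenvalue_def eigenvector_def by auto
  define r where "r i = cmod (x $ i) / v i" for i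
  obtain i where i: "i < d" "\<And>j. j < d \<Longrightarrow> r j \<le> r i"
  proof -
    have "finite (r ` {..<d})" "r ` {..<d} \<noteq> {}" using d_pos by auto
    from Max_in[OF this] obtain i where "i < d" "r i = Max (r ` {..<d})" by auto
    then show ?thesis using that[of i] by simp
  qed
  have xi: "0 < cmod (x $ i)"
  proof (rule ccontr)
    assume "\<not> 0 < cmod (x $ i)"
    then have "r j \<le> 0" if "j < d" for j using i(2)[OF that] by (simp add: r_def)
    then have "x $ j = 0" if "j < d" for j
      using pos[OF that] that by (fastforce simp: r_def divide_le_0_iff)
    then have "x = 0\<^sub>v d" using x(1) by (intro eq_vecI) auto
    then show False using x(2) by simp
  qed
  have "cmod \<rho> * cmod (x $ i) = cmod ((?A *\<^sub>v x) $ i)"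
    unfolding x(3) using x(1) i(1) by (simp add: norm_mult)
  also have "(?A *\<^sub>v x) $ i = (\<Sum>j<d. of_nat (A $$ (i, j)) * x $ j)"
    using x(1) i(1) carrier by (simp add: scalar_prod_def atLeast0LessThan)
  also have "cmod \<dots> \<le> (\<Sum>j<d. real (A $$ (i, j)) * cmod (x $ j))"
    by (rule order_trans[OF norm_sum]) (simp add: norm_mult)
  also have "\<dots> \<le> (\<Sum>j<d. real (A $$ (i, j)) * (r i * v j))"
  proof (intro sum_mono mult_left_mono)
    fix j assume "j \<in> {..<d}"
    then show "cmod (x $ j) \<le> r i * v j" using i(2)[of j] pos[of j] by (simp add: r_def field_simps)
  qed simp
  also have "\<dots> = r i * (\<Sum>j<d. real (A $$ (i, j)) * v j)" by (simp add: sum_distrib_left mult_ac)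
  also have "\<dots> \<le> r i * (l * v i)"
    using i(1) pos[OF i(1)] by (intro mult_left_mono super) (auto simp: r_def)
  also have "\<dots> = l * cmod (x $ i)" using pos[OF i(1)] by (simp add: r_def)
  finally show ?thesis using xi \<rho>(2) by simp
qed

context cuntz_krieger_algebra
begin

text \<open>A nonnegative function is the square of its root.\<close>

lemma state_iota_mono:
  assumes st: "state \<omega>" and f: "f \<in> cont_funs A" and g: "g \<in> cont_funs A"
    and le: "\<And>x. x \<in> \<Lambda> \<Longrightarrow> g x - f x \<in> \<real>\<^sub>\<ge>\<^sub>0"
  shows "Re (\<omega> (\<iota> f)) \<le> Re (\<omega> (\<iota> g))"
proof -
  let ?h = "\<lambda>x. g x - f x"
  define k where "k x = complex_of_real (sqrt (Re (?h x)))" for x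
  have h: "?h \<in> cont_funs A" by (intro cont_funs_diff f g)
  have k: "k \<in> cont_funs A"
    unfolding k_def[abs_def] cont_funs_def mem_Collect_eq
    by (intro continuous_on_of_real continuous_on_real_sqrt continuous_on_Re)
      (use h in \<open>simp add: cont_funs_def\<close>)
  have "(\<lambda>x. cnj (k x)) = k" by (rule ext) (simp add: k_def)
  then have "adj (\<iota> k) * \<iota> k = \<iota> (\<lambda>x. k x * k x)" using iota_adj[OF k] iota_mult[OF k k] by simp
  also have "\<dots> = \<iota> ?h"
  proof (rule iota_cong)
    fix x assume "x \<in> \<Lambda>"
    then have "0 \<le> Re (?h x)" "Im (?h x) = 0" using le by (auto simp: complex_nonneg_Reals_iff)
    then show "k x * k x = ?h x" unfolding k_def of_real_mult[symmetric] by (simp add: complex_eq_iff)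
  qed (intro cont_funs_mult k)
  finally have "0 \<le> Re (\<omega> (\<iota> ?h))" using state_square(2)[OF st, of "\<iota> k"] by simp
  then show ?thesis by (simp add: iota_diff[OF g f] state_diff[OF st])
qed

lemma word_compression:
  assumes "f \<in> cont_funs A" "set w \<subseteq> {..<d}"
  shows "\<exists>g\<in>cont_funs A. adj (word w) * \<iota> f * word w = \<iota> g"
  using assms
proof (induction w arbitrary: f)
  case Nil
  then show ?case by (auto simp: word_Nil adj_one)
next
  case (Cons i w)
  then have i: "i < d" by simp
  have "adj (word (i # w)) * \<iota> f * word (i # w) = adj (word w) * (adj (s i) * \<iota> f * s i) * word w"
    by (simp add: word_Cons adj_mult mult.assoc)
  then show ?case
    using Cons.IH[OF branch_cont_funs[OF Cons.prems(1) i]] Cons.prems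
    by (simp add: iota_branch[OF Cons.prems(1) i])
qed

lemma iota_commute: "f \<in> cont_funs A \<Longrightarrow> g \<in> cont_funs A \<Longrightarrow> \<iota> f * \<iota> g = \<iota> g * \<iota> f"
  by (simp add: iota_mult[symmetric] mult.commute)

text \<open>The source projection \<open>s\<^sub>w\<^sup>* s\<^sub>w\<close> again lies in \<open>C(\<Lambda>\<^sub>A)\<close>.\<close>

lemma word_source_commute:
  assumes "f \<in> cont_funs A" "set w \<subseteq> {..<d}"
  shows "adj (word w) * word w * \<iota> f = \<iota> f * (adj (word w) * word w)"
proof -
  obtain g where "g \<in> cont_funs A" "adj (word w) * \<iota> (\<lambda>x. 1) * word w = \<iota> g"
    using word_compression[OF cont_funs_const assms(2)] by blast
  then show ?thesis using iota_commute[OF _ assms(1)] by (simp add: iota_one)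
qed

lemma word_partial: "set w \<subseteq> {..<d} \<Longrightarrow> word w * (adj (word w) * word w) = word w"
proof (induction w)
  case (Cons i w)
  then have i: "i < d" and w: "set w \<subseteq> {..<d}" by auto
  have comm: "(word w * adj (word w)) * (adj (s i) * s i) = (adj (s i) * s i) * (word w * adj (word w))"
    unfolding gen_square[OF i] iota_cylinder[OF w, symmetric]
    by (rule iota_commute[OF cont_funs_indicator branch_cont_funs[OF cont_funs_const i]])
  have "word (i # w) * (adj (word (i # w)) * word (i # w)) =
      s i * ((word w * adj (word w)) * (adj (s i) * s i)) * word w"
    by (simp add: word_Cons adj_mult mult.assoc)
  also have "\<dots> = (s i * (adj (s i) * s i)) * (word w * (adj (word w) * word w))"
    unfolding comm by (simp add: mult.assoc)
  also have "\<dots> = word (i # w)" using gen_partial[OF i] Cons.IH[OF w] by (simp add: word_Cons)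
  finally show ?case .
qed (simp add: word_Nil adj_one)

lemma word_adj_partial: "set w \<subseteq> {..<d} \<Longrightarrow> adj (word w) * (word w * adj (word w)) = adj (word w)"
  using arg_cong[OF word_partial, of w adj] by (simp add: adj_mult adj_adj mult.assoc)

lemma word_orthogonal:
  assumes u: "set u \<subseteq> {..<d}" and v: "set v \<subseteq> {..<d}" and len: "length v \<le> length u"
    and np: "take (length v) u \<noteq> v"
  shows "adj (word v) * word u = 0"
proof -
  have "x \<notin> cylinder v \<or> x \<notin> cylinder u" for x
  proof (rule ccontr)
    assume "\<not> ?thesis"
    then have "take (length v) u = v"
      using len by (intro nth_equalityI) (auto simp: cylinder_def)
    then show False using np by simp
  qed
  then have "(\<lambda>x. indicator (cylinder v) x * indicator (cylinder u) x :: complex) = (\<lambda>x. 0)"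
    by (auto simp: indicator_def)
  then have "\<iota> (indicator (cylinder v)) * \<iota> (indicator (cylinder u)) = 0"
    unfolding iota_mult[OF cont_funs_indicator cont_funs_indicator, symmetric]
    by (simp add: iota_const scaleC_zero_left)
  then have "(word v * adj (word v)) * (word u * adj (word u)) = 0"
    by (simp add: iota_cylinder u v)
  moreover have "adj (word v) * word u =
      adj (word v) * ((word v * adj (word v)) * (word u * adj (word u))) * word u"
  proof -
    have "adj (word v) * word u = (adj (word v) * (word v * adj (word v))) * (word u * (adj (word u) * word u))"
      by (simp only: word_partial[OF u] word_adj_partial[OF v])
    then show ?thesis by (simp only: mult.assoc)
  qed
  ultimately show ?thesis by simp
qed

text \<open>Both sides are equal to \<open>s\<^sub>u p s\<^sub>v\<^sup>*\<close>, where \<open>p\<close> is the projection of the cylinder of \<open>t\<close>, because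
  source projections commute with \<open>p\<close>.\<close>

lemma matrix_unit_transport:
  assumes u: "set u \<subseteq> {..<d}" and v: "set v \<subseteq> {..<d}" and t: "set t \<subseteq> {..<d}"
  shows "word u * adj (word v) * \<iota> (indicator (cylinder (v @ t))) =
    \<iota> (indicator (cylinder (u @ t))) * (word u * adj (word v))"
proof -
  let ?t = "\<iota> (indicator (cylinder t))"
  have pt: "\<iota> (indicator (cylinder (w @ t))) = word w * ?t * adj (word w)" if "set w \<subseteq> {..<d}" for w
    using that t by (simp add: iota_cylinder word_append adj_mult mult.assoc)
  have "word u * adj (word v) * (word v * ?t * adj (word v)) =
      word u * (adj (word v) * word v * ?t) * adj (word v)" by (simp only: mult.assoc)
  also have "\<dots> = word u * ?t * (adj (word v) * (word v * adj (word v)))"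
    unfolding word_source_commute[OF cont_funs_indicator v] by (simp only: mult.assoc)
  also have "\<dots> = word u * ?t * adj (word v)" unfolding word_adj_partial[OF v] ..
  finally have 1: "word u * adj (word v) * \<iota> (indicator (cylinder (v @ t))) = word u * ?t * adj (word v)"
    unfolding pt[OF v] .
  have "word u * ?t * adj (word u) * (word u * adj (word v)) =
      word u * (?t * (adj (word u) * word u)) * adj (word v)" by (simp only: mult.assoc)
  also have "\<dots> = (word u * (adj (word u) * word u)) * ?t * adj (word v)"
    unfolding word_source_commute[OF cont_funs_indicator u, symmetric] by (simp only: mult.assoc)
  also have "\<dots> = word u * ?t * adj (word v)" unfolding word_partial[OF u] ..
  finally show ?thesis unfolding 1 pt[OF u] ..
qed

end

context cuntz_krieger_flow
begin

lemma a_bounds: assumes "x \<in> \<Lambda>" shows "(INF x\<in>\<Lambda>. a x) \<le> a x" "a x \<le> (SUP x\<in>\<Lambda>. a x)"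
proof -
  obtain B where B: "\<And>x. x \<in> \<Lambda> \<Longrightarrow> cmod (of_real (a x)) \<le> B"
    using cont_funs_bounded[OF cont_funs_of_real[OF a_cont]] by blast
  have "bdd_above (a ` \<Lambda>)" "bdd_below (a ` \<Lambda>)"
    using B by (auto intro!: bdd_aboveI2[where M = B] bdd_belowI2[where m = "- B"] simp: abs_le_iff) force
  then show "(INF x\<in>\<Lambda>. a x) \<le> a x" "a x \<le> (SUP x\<in>\<Lambda>. a x)"
    using assms by (auto intro: cINF_lower cSUP_upper)
qed

lemma ruelle_op_cylinder:
  assumes "x \<in> \<Lambda>" "i < d"
  shows "ruelle_op A a (indicator (cylinder (i # w))) x =
    (if follows i (x 0) then of_real (exp (a (case_nat i x))) else 0) * indicator (cylinder w) x"
proof -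
  have "ruelle_op A a (indicator (cylinder (i # w))) x =
      (\<Sum>k<d. if k = i then (if follows i (x 0) then of_real (exp (a (case_nat i x))) else 0) *
        indicator (cylinder w) x else 0)"
    unfolding ruelle_op_branches[OF assms(1)]
    by (rule sum.cong) (auto simp: branch_def indicator_def cylinder_Cons o_def)
  then show ?thesis using assms(2) by simp
qed

lemma sum_letters: "x \<in> \<Lambda> \<Longrightarrow> (\<Sum>j<d. c j * indicator (cylinder [j]) x) = (c (x 0) :: complex)"
proof -
  assume x: "x \<in> \<Lambda>"
  have "(\<Sum>j<d. c j * indicator (cylinder [j]) x) = (\<Sum>j<d. if j = x 0 then c j else 0)"
    by (rule sum.cong) (auto simp: cylinder_def indicator_def)
  then show ?thesis using shift_space_less[OF x, of 0] by simp
qed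

context
  fixes \<omega> assumes kms: "kms_state \<alpha> \<omega>"
begin

text \<open>The measure of the cylinder of \<open>w\<close> under the restriction of \<open>\<omega>\<close>.\<close>

definition cyl_weight :: "nat list \<Rightarrow> real" where
  "cyl_weight w = Re (\<omega> (\<iota> (indicator (cylinder w))))"

lemma omega_state: "state \<omega>" by (rule kms_is_state[OF kms])

lemma cyl_weight_nonneg: "0 \<le> cyl_weight w"
  using state_square(2)[OF omega_state, of "\<iota> (indicator (cylinder w))"]
  by (simp add: iota_indicator_projection cyl_weight_def)

lemma cyl_weight_Nil: "cyl_weight [] = 1"
  using iota_cylinder[of "[]"] by (simp add: cyl_weight_def word_Nil adj_one state_one[OF omega_state])

lemma ruelle_weight:
  "Re (\<omega> (\<iota> (ruelle_op A a (indicator (cylinder w))))) = exp \<beta> * cyl_weight w"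
  unfolding kms_ruelle[OF kms cont_funs_indicator] by (simp add: cyl_weight_def)

text \<open>The Ruelle operator maps the indicator of \<open>[iw]\<close> to at most \<open>exp (max a)\<close> times that of \<open>[w]\<close>.\<close>

lemma cyl_weight_Cons_le:
  assumes "i < d" shows "exp \<beta> * cyl_weight (i # w) \<le> exp (SUP x\<in>\<Lambda>. a x) * cyl_weight w"
proof -
  have "Re (\<omega> (\<iota> (ruelle_op A a (indicator (cylinder (i # w)))))) \<le>
      Re (\<omega> (\<iota> (\<lambda>x. of_real (exp (SUP x\<in>\<Lambda>. a x)) * indicator (cylinder w) x)))"
  proof (rule state_iota_mono[OF omega_state ruelle_op_cont_funs[OF cont_funs_indicator] cont_funs_cylinder])
    fix x assume x: "x \<in> \<Lambda>"
    have "a (case_nat i x) \<le> (SUP x\<in>\<Lambda>. a x)" if "follows i (x 0)"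
      using that x assms by (intro a_bounds) (simp add: shift_space_cons)
    then show "of_real (exp (SUP x\<in>\<Lambda>. a x)) * indicator (cylinder w) x -
        ruelle_op A a (indicator (cylinder (i # w))) x \<in> \<real>\<^sub>\<ge>\<^sub>0"
      unfolding ruelle_op_cylinder[OF x assms] by (auto simp: indicator_def complex_nonneg_Reals_iff)
  qed
  then show ?thesis
    unfolding ruelle_weight iota_scale[OF cont_funs_indicator] state_scaleC[OF omega_state]
    by (simp add: cyl_weight_def)
qed

text \<open>The Ruelle operator maps the indicator of \<open>[i]\<close> to at least \<open>exp (min a)\<close> times the sum of those of
  the \<open>[j]\<close> with \<open>A\<^sub>i\<^sub>j = 1\<close>.\<close>

lemma cyl_weight_super:
  assumes "i < d"
  shows "exp (INF x\<in>\<Lambda>. a x) * (\<Sum>j<d. real (A $$ (i, j)) * cyl_weight [j]) \<le> exp \<beta> * cyl_weight [i]"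
proof -
  let ?c = "\<lambda>j. of_real (exp (INF x\<in>\<Lambda>. a x) * real (A $$ (i, j))) :: complex"
  have "Re (\<omega> (\<iota> (\<lambda>x. \<Sum>j<d. ?c j * indicator (cylinder [j]) x))) \<le>
      Re (\<omega> (\<iota> (ruelle_op A a (indicator (cylinder [i])))))"
  proof (rule state_iota_mono[OF omega_state _ ruelle_op_cont_funs[OF cont_funs_indicator]])
    show "(\<lambda>x. \<Sum>j<d. ?c j * indicator (cylinder [j]) x) \<in> cont_funs A"
      by (intro cont_funs_sum cont_funs_cylinder)
    fix x assume x: "x \<in> \<Lambda>"
    have "(INF x\<in>\<Lambda>. a x) \<le> a (case_nat i x)" if "follows i (x 0)"
      using that x assms by (intro a_bounds) (simp add: shift_space_cons)
    then show "ruelle_op A a (indicator (cylinder [i])) x -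
        (\<Sum>j<d. ?c j * indicator (cylinder [j]) x) \<in> \<real>\<^sub>\<ge>\<^sub>0"
      unfolding ruelle_op_cylinder[OF x assms] sum_letters[OF x]
      using entry_cases[OF assms shift_space_less[OF x, of 0]]
      by (auto simp: complex_nonneg_Reals_iff cylinder_def)
  qed
  moreover have "\<iota> (\<lambda>x. \<Sum>j<d. ?c j * indicator (cylinder [j]) x) =
      (\<Sum>j<d. ?c j *\<^sub>C \<iota> (indicator (cylinder [j])))"
  proof -
    have "\<iota> (\<lambda>x. \<Sum>j<d. ?c j * indicator (cylinder [j]) x) =
        (\<Sum>j<d. \<iota> (\<lambda>x. ?c j * indicator (cylinder [j]) x))"
      by (rule iota_sum) (rule cont_funs_cylinder)
    then show ?thesis by (simp only: iota_scale[OF cont_funs_indicator])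
  qed
  ultimately show ?thesis
    unfolding ruelle_weight
    by (simp add: state_sum[OF omega_state] state_scaleC[OF omega_state] cyl_weight_def sum_distrib_left mult.assoc)
qed

lemma spectral_radius_le_kms: "spectral_radius (map_mat of_nat A) \<le> exp (\<beta> - (INF x\<in>\<Lambda>. a x))"
proof -
  have "(\<Sum>j<d. s j * adj (s j)) = 1"
    using cuntz_krieger_family by (simp add: cuntz_krieger_family_def)
  from arg_cong[OF this, of "\<lambda>x. Re (\<omega> x)"]
  have "(\<Sum>j<d. cyl_weight [j]) = 1"
    by (simp add: state_sum[OF omega_state] state_one[OF omega_state] gen_proj cyl_weight_def)
  then obtain j where j: "j < d" "0 < cyl_weight [j]"
    using sum_nonpos[of "{..<d}" "\<lambda>j. cyl_weight [j]"] by (metis lessThan_iff not_le not_one_le_zero)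
  show ?thesis
  proof (rule spectral_radius_le_supersolution[where v = "\<lambda>j. cyl_weight [j]", OF cyl_weight_nonneg _ _ j])
    fix i assume "i < d"
    from cyl_weight_super[OF this]
    show "(\<Sum>j<d. real (A $$ (i, j)) * cyl_weight [j]) \<le> exp (\<beta> - (INF x\<in>\<Lambda>. a x)) * cyl_weight [i]"
      by (simp add: exp_diff field_simps)
  qed simp
qed

lemma sup_less_beta:
  assumes "var0 A a < ln (spectral_radius (map_mat of_nat A))" shows "(SUP x\<in>\<Lambda>. a x) < \<beta>"
proof -
  let ?r = "spectral_radius (map_mat of_nat A)"
  have cA: "(map_mat of_nat A :: complex mat) \<in> carrier_mat d d" using carrier by simp
  have r0: "0 \<le> ?r" using spectral_radius_mem_max(1)[OF cA d_pos] by auto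
  have "0 \<le> var0 A a"
    using a_bounds shift_space_nonempty unfolding var0_def by fastforce
  \<comment> \<open>\<open>ln 0 = 0\<close>, so the strict inequality excludes a vanishing spectral radius\<close>
  then have "?r \<noteq> 0" using assms by auto
  then have "ln ?r \<le> \<beta> - (INF x\<in>\<Lambda>. a x)"
    using spectral_radius_le_kms r0 by (metis ln_exp ln_mono order_le_less)
  then show ?thesis using assms by (simp add: var0_def)
qed

context
  assumes gap: "(SUP x\<in>\<Lambda>. a x) < \<beta>"
begin

lemma cyl_weight_decay:
  "set w \<subseteq> {..<d} \<Longrightarrow> cyl_weight w \<le> exp ((SUP x\<in>\<Lambda>. a x) - \<beta>) ^ length w"
proof (induction w)
  case (Cons i w)
  have "cyl_weight (i # w) \<le> exp ((SUP x\<in>\<Lambda>. a x) - \<beta>) * cyl_weight w"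
    using cyl_weight_Cons_le[of i w] Cons.prems by (simp add: exp_diff field_simps)
  also have "\<dots> \<le> exp ((SUP x\<in>\<Lambda>. a x) - \<beta>) * exp ((SUP x\<in>\<Lambda>. a x) - \<beta>) ^ length w"
    using Cons by (intro mult_left_mono) auto
  finally show ?case by simp
qed (simp add: cyl_weight_Nil)

text \<open>For \<open>u = vr\<close>, commuting projections past \<open>s\<^sub>u s\<^sub>v\<^sup>*\<close> localises its value in the cylinders of
  \<open>v\<close>, \<open>v r\<close>, \<open>v r r\<close> and so on, whose weights bound it by the Cauchy-Schwarz inequality and tend to
  zero. If \<open>v\<close> is not a prefix of \<open>u\<close>, the first such step already gives zero.\<close>

lemma kms_off_diagonal:
  assumes u: "set u \<subseteq> {..<d}" and v: "set v \<subseteq> {..<d}" and len: "length v \<le> length u" and ne: "u \<noteq> v"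
  shows "\<omega> (word u * adj (word v)) = 0"
proof -
  let ?b = "word u * adj (word v)"
  let ?p = "\<lambda>w. \<iota> (indicator (cylinder w))"
  show ?thesis
  proof (cases "take (length v) u = v")
    case False
    have "\<omega> ?b = \<omega> (?p u * ?b)"
      using word_partial[OF u] by (simp add: iota_cylinder[OF u] mult.assoc) (simp add: mult.assoc[symmetric])
    also have "\<dots> = \<omega> (?b * ?p u)" by (rule kms_iota_commute[OF kms cont_funs_indicator, symmetric])
    also have "?b * ?p u = word u * (adj (word v) * word u) * adj (word u)"
      by (simp add: iota_cylinder[OF u] mult.assoc)
    finally show ?thesis using word_orthogonal[OF u v len False] by (simp add: state_zero[OF omega_state])
  next
    case True
    define r where "r = drop (length v) u"
    have ur: "u = v @ r" unfolding r_def using True by (metis append_take_drop_id)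
    then have r: "set r \<subseteq> {..<d}" "r \<noteq> []" using u ne by auto
    define t where "t k = concat (replicate k r)" for k
    have t: "set (t k) \<subseteq> {..<d}" "k \<le> length (t k)" for k
    proof -
      show "set (t k) \<subseteq> {..<d}" using r(1) by (induction k) (auto simp: t_def)
      show "k \<le> length (t k)" using r(2) by (induction k) (auto simp: t_def Suc_le_eq neq_Nil_conv)
    qed
    \<comment> \<open>\<open>t k\<close> is \<open>r\<close> repeated \<open>k\<close> times\<close>
    have step: "\<omega> ?b = \<omega> (?p (v @ t k) * ?b)" for k
    proof (induction k)
      case 0
      have "word v * adj (word v) * ?b = word v * (adj (word v) * word v) * (word r * adj (word v))"
        by (simp add: ur word_append mult.assoc)
      also have "\<dots> = ?b" unfolding word_partial[OF v] by (simp add: ur word_append mult.assoc)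
      finally show ?case by (simp add: t_def iota_cylinder[OF v])
    next
      case (Suc k)
      have "\<omega> (?p (v @ t k) * ?b) = \<omega> (?b * ?p (v @ t k))"
        by (rule kms_iota_commute[OF kms cont_funs_indicator, symmetric])
      also have "?b * ?p (v @ t k) = ?p (u @ t k) * ?b" by (rule matrix_unit_transport[OF u v t(1)])
      also have "u @ t k = v @ t (Suc k)" by (simp add: ur t_def)
      finally show ?case using Suc by simp
    qed
    define q where "q = exp ((SUP x\<in>\<Lambda>. a x) - \<beta>)"
    have q: "0 \<le> q" "q < 1" using gap by (auto simp: q_def)
    have bound: "(cmod (\<omega> ?b))\<^sup>2 \<le> Re (\<omega> (adj ?b * ?b)) * q ^ k" for k
    proof -
      have "(cmod (\<omega> ?b))\<^sup>2 \<le> Re (\<omega> (adj ?b * ?b)) * cyl_weight (v @ t k)"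
        using state_Cauchy_Schwarz[OF omega_state, of "?p (v @ t k)" ?b] unfolding step[of k, symmetric]
        by (simp only: iota_indicator_projection step[of k, symmetric] cyl_weight_def)
      also have "\<dots> \<le> Re (\<omega> (adj ?b * ?b)) * q ^ k"
      proof (rule mult_left_mono[OF _ state_square(2)[OF omega_state]])
        have "cyl_weight (v @ t k) \<le> q ^ length (v @ t k)"
          unfolding q_def using v t by (intro cyl_weight_decay) auto
        also have "\<dots> \<le> q ^ k" using q t(2)[of k] by (intro power_decreasing) auto
        finally show "cyl_weight (v @ t k) \<le> q ^ k" .
      qed
      finally show ?thesis .
    qed
    have "(\<lambda>k. Re (\<omega> (adj ?b * ?b)) * q ^ k) \<longlonglongrightarrow> 0"
      using q by (intro tendsto_mult_right_zero LIMSEQ_power_zero) simp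
    then have "(cmod (\<omega> ?b))\<^sup>2 \<le> 0"
      by (rule LIMSEQ_le_const) (use bound in auto)
    then show ?thesis by simp
  qed
qed

lemma kms_matrix_unit:
  assumes u: "set u \<subseteq> {..<d}" and v: "set v \<subseteq> {..<d}"
  shows "\<omega> (word u * adj (word v)) = (if u = v then \<omega> (\<iota> (indicator (cylinder u))) else 0)"
proof -
  consider "u = v" | "u \<noteq> v" "length v \<le> length u" | "u \<noteq> v" "length u \<le> length v" by linarith
  then show ?thesis
  proof cases
    case 3
    have "\<omega> (word u * adj (word v)) = cnj (\<omega> (word v * adj (word u)))"
      using state_adj[OF omega_state, of "word v * adj (word u)"] by (simp add: adj_mult adj_adj)
    then show ?thesis using kms_off_diagonal[OF v u 3(2)] 3(1) by simp
  qed (use iota_cylinder[OF u] kms_off_diagonal[OF u v] in simp_all)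
qed

end

end

lemma kms_unique:
  assumes gap: "var0 A a < ln (spectral_radius (map_mat of_nat A))"
    and kms1: "kms_state \<alpha> \<omega>1" and kms2: "kms_state \<alpha> \<omega>2"
    and eq: "restriction A \<iota> \<omega>1 = restriction A \<iota> \<omega>2"
  shows "\<omega>1 = \<omega>2"
proof
  note st1 = kms_is_state[OF kms1] and st2 = kms_is_state[OF kms2]
  note unit1 = kms_matrix_unit[OF kms1 sup_less_beta[OF kms1 gap]]
    and unit2 = kms_matrix_unit[OF kms2 sup_less_beta[OF kms2 gap]]
  fix x show "\<omega>1 x = \<omega>2 x"
  proof (rule dense_unit_induct[where P = "\<lambda>x. \<omega>1 x = \<omega>2 x"])
    show "closed {x. \<omega>1 x = \<omega>2 x}" by (intro closed_Collect_eq state_continuous st1 st2)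
    show "\<omega>1 0 = \<omega>2 0" by (simp add: state_zero st1 st2)
    fix c x and u v :: "nat list" assume "set u \<subseteq> {..<d}" "set v \<subseteq> {..<d}" "\<omega>1 x = \<omega>2 x"
    moreover have "\<omega>1 (\<iota> (indicator (cylinder w))) = \<omega>2 (\<iota> (indicator (cylinder w)))" for w
      using state_restriction(2)[OF st1 cont_funs_indicator] state_restriction(2)[OF st2 cont_funs_indicator] eq
      by simp
    ultimately show "\<omega>1 (c *\<^sub>C (word u * adj (word v)) + x) = \<omega>2 (c *\<^sub>C (word u * adj (word v)) + x)"
      by (simp add: state_add[OF st1] state_add[OF st2] state_scaleC[OF st1] state_scaleC[OF st2] unit1 unit2)
  qed
qed

end

section \<open>Existence: integrating vector states against an eigenmeasure\<close>

context cuntz_krieger_flow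
begin

lemma flow_zero: "\<alpha> 0 x = x" and flow_plus: "\<alpha> (t + u) x = \<alpha> t (\<alpha> u x)"
  using flow unfolding is_flow_def one_parameter_automorphism_group_def by (simp_all add: fun_eq_iff)

lemma flow_sum: "\<alpha> t (sum f J) = (\<Sum>j\<in>J. \<alpha> t (f j))"
proof (induction J rule: infinite_finite_induct)
  case empty
  show ?case using flow_scaleC[of t 0 0] by (simp add: scaleC_zero_left)
next
  case (infinite J)
  show ?case using infinite flow_scaleC[of t 0 0] by (simp add: scaleC_zero_left)
qed (simp add: flow_add)

lemma cocycle_plus: "cocycle (z + w) = cocycle z * cocycle w"
  unfolding cocycle_def iota_mult[OF cont_funs_cocycle cont_funs_cocycle, symmetric]
  by (simp add: exp_add[symmetric] algebra_simps)

definition strip_bounded :: "(complex \<Rightarrow> 'a) \<Rightarrow> bool" where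
  "strip_bounded G \<longleftrightarrow> (\<exists>C. \<forall>z. \<bar>Im z\<bar> \<le> 1 \<longrightarrow> norm (G z) \<le> C)"

lemma strip_bounded_const: "strip_bounded (\<lambda>z. c)"
  unfolding strip_bounded_def by blast

lemma strip_bounded_add:
  assumes "strip_bounded F" "strip_bounded G" shows "strip_bounded (\<lambda>z. F z + G z)"
proof -
  obtain C D where "\<And>z. \<bar>Im z\<bar> \<le> 1 \<Longrightarrow> norm (F z) \<le> C" "\<And>z. \<bar>Im z\<bar> \<le> 1 \<Longrightarrow> norm (G z) \<le> D"
    using assms unfolding strip_bounded_def by blast
  then have "norm (F z + G z) \<le> C + D" if "\<bar>Im z\<bar> \<le> 1" for z
    using that by (intro norm_triangle_mono) auto
  then show ?thesis unfolding strip_bounded_def by blast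
qed

lemma strip_bounded_mult:
  assumes "strip_bounded F" "strip_bounded G" shows "strip_bounded (\<lambda>z. F z * G z)"
proof -
  obtain C D where CD: "\<And>z. \<bar>Im z\<bar> \<le> 1 \<Longrightarrow> norm (F z) \<le> C" "\<And>z. \<bar>Im z\<bar> \<le> 1 \<Longrightarrow> norm (G z) \<le> D"
    using assms unfolding strip_bounded_def by blast
  have C0: "0 \<le> C" using order_trans[OF norm_ge_zero CD(1)[of 0]] by simp
  have "norm (F z * G z) \<le> C * D" if "\<bar>Im z\<bar> \<le> 1" for z
    using CD(1)[OF that] CD(2)[OF that] C0
    by (intro order_trans[OF norm_mult_ineq] mult_mono) auto
  then show ?thesis unfolding strip_bounded_def by blast
qed

lemma cocycle_strip_bounded: "strip_bounded cocycle" "strip_bounded (\<lambda>z. cocycle (- z))"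
proof -
  obtain B where B: "0 < B" "\<And>x. x \<in> \<Lambda> \<Longrightarrow> cmod (potential x) \<le> B"
    using cont_funs_bounded[OF cont_funs_potential] by blast
  have le: "norm (cocycle z) \<le> exp B" if z: "\<bar>Im z\<bar> \<le> 1" for z
    unfolding cocycle_def
  proof (rule iota_norm_le[OF cont_funs_cocycle])
    fix x assume x: "x \<in> \<Lambda>"
    have "Re (\<i> * z * potential x) \<le> cmod (potential x)"
    proof -
      have "Re (\<i> * z * potential x) = - Im z * (\<beta> - a x)" by (simp add: potential_def)
      also have "\<dots> \<le> \<bar>- Im z * (\<beta> - a x)\<bar>" by simp
      also have "\<dots> \<le> 1 * \<bar>\<beta> - a x\<bar>" unfolding abs_mult using z by (intro mult_right_mono) auto
      finally show ?thesis by (simp only: potential_def norm_of_real mult_1)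
    qed
    then show "cmod (exp (\<i> * z * potential x)) \<le> exp B" using B(2)[OF x] by simp
  qed
  show "strip_bounded cocycle" "strip_bounded (\<lambda>z. cocycle (- z))"
    unfolding strip_bounded_def by (rule exI[of _ "exp B"], use le in auto)+
qed

lemma cocycle_neg_entire: "entire (\<lambda>z. cocycle (- z))"
proof -
  have "entire (\<lambda>z. \<iota> (\<lambda>x. exp (z * (- \<i> * potential x))))"
    by (intro entire_iota_exp cont_funs_scale cont_funs_potential)
  then show ?thesis by (simp add: cocycle_def[abs_def] mult_ac)
qed

text \<open>The KMS condition for all \<open>\<alpha>\<^sub>t(c)\<close> at once, where \<open>G\<close> is the entire extension of
  \<open>t \<mapsto> \<alpha>\<^sub>t(c)\<close>. The whole edges of the strip are needed for the maximum principle, and \<open>\<alpha>\<^sub>t(c)\<close> need not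
  be a polynomial in the generators when \<open>c\<close> is one.\<close>

definition kms_analytic :: "('a \<Rightarrow> complex) \<Rightarrow> (complex \<Rightarrow> 'a) \<Rightarrow> bool" where
  "kms_analytic \<omega> G \<longleftrightarrow> entire G \<and> strip_bounded G \<and>
    (\<forall>t b. \<omega> (b * G (of_real t)) = \<omega> (G (of_real t - \<i>) * b))"

lemma kms_analytic_mult:
  assumes "kms_analytic \<omega> F" "kms_analytic \<omega> G" shows "kms_analytic \<omega> (\<lambda>z. F z * G z)"
  unfolding kms_analytic_def
proof (intro conjI allI)
  fix t :: real and b
  let ?t = "complex_of_real t"
  have "\<omega> (b * (F ?t * G ?t)) = \<omega> ((b * F ?t) * G ?t)" by (simp only: mult.assoc)
  also have "\<dots> = \<omega> (G (?t - \<i>) * (b * F ?t))" using assms(2) unfolding kms_analytic_def by blast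
  also have "\<dots> = \<omega> ((G (?t - \<i>) * b) * F ?t)" by (simp only: mult.assoc)
  also have "\<dots> = \<omega> (F (?t - \<i>) * (G (?t - \<i>) * b))" using assms(1) unfolding kms_analytic_def by blast
  finally show "\<omega> (b * (F ?t * G ?t)) = \<omega> (F (?t - \<i>) * G (?t - \<i>) * b)" by (simp only: mult.assoc)
qed (use assms in \<open>auto simp: kms_analytic_def intro: entire_mult strip_bounded_mult\<close>)

lemma kms_analytic_add:
  assumes "state \<omega>" "kms_analytic \<omega> F" "kms_analytic \<omega> G" shows "kms_analytic \<omega> (\<lambda>z. F z + G z)"
  using assms(2,3) unfolding kms_analytic_def
  by (auto simp: distrib_left distrib_right state_add[OF assms(1)] intro: entire_add strip_bounded_add)

lemma kms_analytic_scale: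
  assumes "state \<omega>" "kms_analytic \<omega> G" shows "kms_analytic \<omega> (\<lambda>z. c *\<^sub>C G z)"
proof -
  have "strip_bounded (\<lambda>z. (c *\<^sub>C 1) * G z)"
    using assms(2) unfolding kms_analytic_def by (intro strip_bounded_mult strip_bounded_const) auto
  then show ?thesis
    using assms(2) unfolding kms_analytic_def
    by (auto simp: mult_scaleC_left mult_scaleC_right state_scaleC[OF assms(1)] intro: entire_scale)
qed

lemma kms_analytic_const: "(\<And>b. \<omega> (b * c) = \<omega> (c * b)) \<Longrightarrow> kms_analytic \<omega> (\<lambda>z. c)"
  unfolding kms_analytic_def by (simp add: entire_const strip_bounded_const)

lemma kms_analytic_sum:
  assumes "state \<omega>" shows "(\<And>j. j \<in> J \<Longrightarrow> kms_analytic \<omega> (F j)) \<Longrightarrow> kms_analytic \<omega> (\<lambda>z. \<Sum>j\<in>J. F j z)"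
  by (induction J rule: infinite_finite_induct)
    (auto intro: kms_analytic_add[OF assms] kms_analytic_const)

text \<open>Products preserve the KMS condition: \<open>\<omega> (b c c') = \<omega> (\<gamma>(c') b c) = \<omega> (\<gamma>(c) \<gamma>(c') b)\<close>, where \<open>\<gamma>\<close> is
  the flow at \<open>- \<i>\<close>.\<close>

lemma kms_analytic_polynomial:
  assumes st: "state \<omega>"
    and gen: "\<And>i. i < d \<Longrightarrow> kms_analytic \<omega> (\<lambda>z. cocycle z * s i)"
    and adj: "\<And>i. i < d \<Longrightarrow> kms_analytic \<omega> (\<lambda>z. adj (s i) * cocycle (- z))"
    and p: "p \<in> star_polys d"
  shows "\<exists>G. kms_analytic \<omega> G \<and> (\<forall>t. G (of_real t) = \<alpha> t (poly_eval s p))"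
proof -
  have letters: "\<exists>G. kms_analytic \<omega> G \<and>
      (\<forall>t. G (of_real t) = \<alpha> t (prod_list (map (\<lambda>(i, b). if b then adj (s i) else s i) l)))"
    if "fst ` set l \<subseteq> {..<d}" for l
    using that
  proof (induction l)
    case Nil
    have "kms_analytic \<omega> (\<lambda>z. 1)" by (rule kms_analytic_const) simp
    then show ?case using flow_one by auto
  next
    case (Cons l ls)
    then obtain G where G: "kms_analytic \<omega> G"
      "\<forall>t. G (of_real t) = \<alpha> t (prod_list (map (\<lambda>(i, b). if b then adj (s i) else s i) ls))" by auto
    obtain i c where l: "l = (i, c)" "i < d" using Cons.prems by (cases l) auto
    define H where "H z = (if c then adj (s i) * cocycle (- z) else cocycle z * s i)" for z
    have "kms_analytic \<omega> H" unfolding H_def[abs_def] using gen[OF l(2)] adj[OF l(2)] by (cases c) auto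
    from kms_analytic_mult[OF this G(1)] have "kms_analytic \<omega> (\<lambda>z. H z * G z)" .
    moreover have "H (of_real t) = \<alpha> t (if c then adj (s i) else s i)" for t
      by (simp add: H_def flow_gen flow_gen_adj l(2))
    ultimately show ?case using G(2) l(1) flow_mult by (intro exI[of _ "\<lambda>z. H z * G z"]) simp
  qed
  have "\<forall>w\<in>Poly_Mapping.keys p. \<exists>G. kms_analytic \<omega> G \<and> (\<forall>t. G (of_real t) = \<alpha> t (word_eval s w))"
    using letters p unfolding word_eval_def star_polys_def by blast
  then obtain G where G: "\<And>w. w \<in> Poly_Mapping.keys p \<Longrightarrow> kms_analytic \<omega> (G w)"
    "\<And>w t. w \<in> Poly_Mapping.keys p \<Longrightarrow> G w (of_real t) = \<alpha> t (word_eval s w)"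
    by metis
  let ?G = "\<lambda>z. \<Sum>w\<in>Poly_Mapping.keys p. Poly_Mapping.lookup p w *\<^sub>C G w z"
  have "kms_analytic \<omega> ?G" by (intro kms_analytic_sum[OF st] kms_analytic_scale[OF st] G(1))
  moreover have "?G (of_real t) = \<alpha> t (poly_eval s p)" for t
    by (simp add: poly_eval_def flow_sum flow_scaleC G(2))
  ultimately show ?thesis by blast
qed

text \<open>By uniqueness of analytic continuation \<open>\<omega> (F (t + w) b) = \<omega> (\<alpha>\<^sub>t (F w) b)\<close>, so bounds on the
  compact segment from \<open>0\<close> to \<open>- \<i>\<close> extend to the strip.\<close>

lemma entire_extension_strip_bounded:
  assumes st: "state \<omega>" and F: "entire_extension \<alpha> c F"
  shows "\<exists>M. \<forall>z. -1 \<le> Im z \<and> Im z \<le> 0 \<longrightarrow> cmod (\<omega> (F z * b)) \<le> M"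
proof -
  have ent: "entire F" and real: "\<And>t. F (of_real t) = \<alpha> t c"
    using F by (simp_all add: entire_extension_def entire_def)
  have shift: "\<omega> (F (of_real t + w) * b) = \<omega> (\<alpha> t (F w) * b)" for t w
  proof -
    let ?T = "\<lambda>x. \<omega> (\<alpha> t x * b)"
    have T: "bounded_linear ?T"
    proof (rule bounded_linear_intro[where K = "norm b"])
      fix x and r :: real
      have "\<alpha> t (r *\<^sub>R x) = r *\<^sub>R \<alpha> t x" using flow_scaleC[of t "of_real r" x] by (simp only: scaleC_of_real)
      then show "?T (r *\<^sub>R x) = r *\<^sub>R ?T x"
        using state_scaleR[OF st, of r "\<alpha> t x * b"] by (simp only: scaleR_conv_of_real[of r "?T x"] mult_scaleR_left)
      show "norm (?T x) \<le> norm x * norm b" by (rule state_star_hom_mult_le[OF st flow_hom])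
    qed (simp add: flow_add distrib_right state_add[OF st])
    have hol1: "(\<lambda>w. ?T (F w)) holomorphic_on UNIV"
      unfolding holomorphic_on_def field_differentiable_def
    proof
      fix z
      obtain D where D: "(F has_derivative (\<lambda>h. h *\<^sub>C D)) (at z)" using ent unfolding entire_def by blast
      have "((\<lambda>w. ?T (F w)) has_derivative (\<lambda>h. ?T D * h)) (at z)"
        using bounded_linear.has_derivative[OF T D]
        by (simp add: flow_scaleC mult_scaleC_left state_scaleC[OF st] mult.commute)
      then show "\<exists>f'. ((\<lambda>w. ?T (F w)) has_field_derivative f') (at z within UNIV)"
        unfolding has_field_derivative_def by auto
    qed
    have "(\<lambda>z. \<omega> (F z * b)) holomorphic_on UNIV"
      by (intro entire_state_holomorphic[OF st] entire_mult ent entire_const)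
    then have hol2: "(\<lambda>w. \<omega> (F (of_real t + w) * b)) holomorphic_on UNIV"
    proof -
      assume "(\<lambda>z. \<omega> (F z * b)) holomorphic_on UNIV"
      note hol = holomorphic_on_subset[OF this subset_UNIV]
      have "(\<lambda>w. of_real t + w) holomorphic_on UNIV" by (intro holomorphic_intros)
      from holomorphic_on_compose[OF this hol] show ?thesis by (simp add: o_def)
    qed
    have "\<omega> (F (of_real t + w) * b) - ?T (F w) = 0"
    proof (rule analytic_continuation[where S = UNIV and U = "range complex_of_real" and \<xi> = 0
          and f = "\<lambda>w. \<omega> (F (of_real t + w) * b) - ?T (F w)"])
      show "(\<lambda>w. \<omega> (F (of_real t + w) * b) - ?T (F w)) holomorphic_on UNIV"
        by (intro holomorphic_on_diff hol1 hol2)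
      show "(0::complex) islimpt range complex_of_real"
      proof (rule islimptI)
        fix T :: "complex set" assume "0 \<in> T" "open T"
        then obtain e where e: "0 < e" "ball 0 e \<subseteq> T" using open_contains_ball by blast
        then have "complex_of_real (e / 2) \<in> T" by (intro subsetD[OF e(2)]) simp
        then show "\<exists>y\<in>range complex_of_real. y \<in> T \<and> y \<noteq> 0"
          using e(1) by (intro bexI[of _ "complex_of_real (e / 2)"] conjI rangeI) auto
      qed
      fix z assume "z \<in> range complex_of_real"
      then obtain u where "z = of_real u" by auto
      then show "\<omega> (F (of_real t + z) * b) - ?T (F z) = 0"
        using real[of "t + u"] real[of u] by (simp add: flow_plus)
    qed auto
    then show ?thesis by simp
  qed
  have "compact ((\<lambda>y::real. F (\<i> * of_real y)) ` {-1..0})"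
  proof (rule compact_continuous_image)
    have "isCont F z" for z
    proof -
      obtain D where "(F has_derivative (\<lambda>h. h *\<^sub>C D)) (at z)" using ent unfolding entire_def by blast
      then show ?thesis by (rule has_derivative_continuous)
    qed
    then have "continuous_on UNIV F" by (simp add: continuous_on_eq_continuous_at)
    then show "continuous_on {-1..0} (\<lambda>y::real. F (\<i> * of_real y))"
      by (rule continuous_on_compose2) (auto intro!: continuous_intros)
  qed simp
  then have "bounded ((\<lambda>y::real. F (\<i> * of_real y)) ` {-1..0})" by (rule compact_imp_bounded)
  then obtain K where "\<forall>x\<in>(\<lambda>y::real. F (\<i> * of_real y)) ` {-1..0}. norm x \<le> K"
    unfolding bounded_iff by blast
  then have K: "\<And>y. y \<in> {-1..0} \<Longrightarrow> norm (F (\<i> * of_real y)) \<le> K" by blast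
  have "cmod (\<omega> (F z * b)) \<le> K * norm b" if "-1 \<le> Im z" "Im z \<le> 0" for z
  proof -
    have "z = of_real (Re z) + \<i> * of_real (Im z)" by (rule complex_eq)
    then have "cmod (\<omega> (F z * b)) = cmod (\<omega> (\<alpha> (Re z) (F (\<i> * of_real (Im z))) * b))"
      using shift by metis
    also have "\<dots> \<le> norm (F (\<i> * of_real (Im z))) * norm b" by (rule state_star_hom_mult_le[OF st flow_hom])
    also have "\<dots> \<le> K * norm b" using that by (intro mult_right_mono K) auto
    finally show ?thesis .
  qed
  then show ?thesis by blast
qed

text \<open>The KMS condition passes from polynomials to all elements with an entire extension: the
  difference of the two extensions is small on the real axis and converges uniformly on
  \<open>Im z = -1\<close>.\<close>

lemma kms_state_generators:
  assumes st: "state \<omega>"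
    and gen: "\<And>i. i < d \<Longrightarrow> kms_analytic \<omega> (\<lambda>z. cocycle z * s i)"
    and adj: "\<And>i. i < d \<Longrightarrow> kms_analytic \<omega> (\<lambda>z. adj (s i) * cocycle (- z))"
  shows "kms_state \<alpha> \<omega>"
  unfolding kms_state_def
proof (intro conjI allI impI st)
  fix b c F assume F: "entire_extension \<alpha> c F"
  have ent: "entire F" and real: "\<And>t. F (of_real t) = \<alpha> t c"
    using F by (simp_all add: entire_extension_def entire_def)
  have "c \<in> closure (poly_eval s ` star_polys d)" using dense_polys by simp
  then obtain u where u: "\<And>n. u n \<in> poly_eval s ` star_polys d" "u \<longlonglongrightarrow> c"
    unfolding closure_sequential by blast
  have "\<forall>n. \<exists>G. kms_analytic \<omega> G \<and> (\<forall>t. G (of_real t) = \<alpha> t (u n))"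
    using u(1) kms_analytic_polynomial[OF st gen adj] by (metis (no_types, lifting) imageE)
  then obtain G where G: "\<And>n. kms_analytic \<omega> (G n)" "\<And>n t. G n (of_real t) = \<alpha> t (u n)" by metis
  \<comment> \<open>on the edge \<open>Im z = -1\<close> the unknown values of \<open>F\<close> cancel in differences of the \<open>E n\<close> below\<close>
  have edge: "\<omega> (G n (of_real t - \<i>) * b) = \<omega> (b * \<alpha> t (u n))" for n t
    using G unfolding kms_analytic_def by metis
  define e where "e n = norm (c - u n) * norm b" for n
  define E where "E n z = \<omega> (F z * b) - \<omega> (G n z * b)" for n z
  have diff: "\<alpha> t (x - y) = \<alpha> t x - \<alpha> t y" for t x y by (rule star_hom_diff[OF flow_hom])
  have "(\<lambda>n. E n (- \<i>)) \<longlonglongrightarrow> 0"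
  proof (rule strip_limit_other_edge[where b = e])
    show "E n holomorphic_on UNIV" for n
      unfolding E_def[abs_def] using G(1)[of n] ent
      by (intro holomorphic_on_diff entire_state_holomorphic[OF st] entire_mult entire_const)
        (simp_all add: kms_analytic_def)
    fix n
    obtain M where M: "\<And>z. -1 \<le> Im z \<Longrightarrow> Im z \<le> 0 \<Longrightarrow> cmod (\<omega> (F z * b)) \<le> M"
      using entire_extension_strip_bounded[OF st F] by blast
    obtain C where C: "\<And>z. \<bar>Im z\<bar> \<le> 1 \<Longrightarrow> norm (G n z) \<le> C"
      using G(1)[of n] unfolding kms_analytic_def strip_bounded_def by blast
    have "cmod (E n z) \<le> M + C * norm b" if z: "-1 \<le> Im z" "Im z \<le> 0" for z
    proof -
      have "cmod (\<omega> (G n z * b)) \<le> norm (G n z) * norm b"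
        using state_norm_le[OF st] norm_mult_ineq order_trans by blast
      also have "\<dots> \<le> C * norm b" using z by (intro mult_right_mono C) auto
      finally show ?thesis
        using M[OF z] norm_triangle_ineq4[of "\<omega> (F z * b)" "\<omega> (G n z * b)"] unfolding E_def by linarith
    qed
    then show "\<exists>M. \<forall>z. -1 \<le> Im z \<and> Im z \<le> 0 \<longrightarrow> cmod (E n z) \<le> M" by blast
  next
    fix n z assume "Im z = 0"
    then have z: "z = of_real (Re z)" by (simp add: complex_eq_iff)
    have "E n z = \<omega> (\<alpha> (Re z) (c - u n) * b)"
      unfolding E_def diff left_diff_distrib state_diff[OF st] using z real G(2) by metis
    then show "cmod (E n z) \<le> e n"
      using state_star_hom_mult_le[OF st flow_hom, of "Re z" "c - u n" b] by (simp add: e_def)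
  next
    fix j k z assume "Im z = -1"
    then have z: "z = of_real (Re z) - \<i>" by (simp add: complex_eq_iff)
    have "E j z - E k z = \<omega> (G k z * b) - \<omega> (G j z * b)" by (simp add: E_def)
    also have "\<dots> = \<omega> (b * \<alpha> (Re z) (u k - u j))"
      unfolding diff right_diff_distrib state_diff[OF st] using edge z by metis
    also have "cmod \<dots> \<le> norm (u k - u j) * norm b" by (rule mult_star_hom_state_le[OF st flow_hom])
    also have "\<dots> \<le> (norm (c - u j) + norm (c - u k)) * norm b"
      using norm_triangle_ineq4[of "c - u j" "c - u k"] by (intro mult_right_mono) simp_all
    finally show "cmod (E j z - E k z) \<le> e j + e k" by (simp add: e_def distrib_right)
  next
    have "(\<lambda>n. norm (c - u n) * norm b) \<longlonglongrightarrow> norm (c - c) * norm b"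
      by (intro tendsto_intros u(2))
    then show "e \<longlonglongrightarrow> 0" by (simp add: e_def[abs_def])
  qed
  moreover have "E n (- \<i>) = \<omega> (F (- \<i>) * b) - \<omega> (b * u n)" for n
    using edge[of n 0] by (simp add: E_def flow_zero)
  ultimately have "(\<lambda>n. \<omega> (F (- \<i>) * b) - \<omega> (b * u n)) \<longlonglongrightarrow> 0" by simp
  moreover have "(\<lambda>n. \<omega> (F (- \<i>) * b) - \<omega> (b * u n)) \<longlonglongrightarrow> \<omega> (F (- \<i>) * b) - \<omega> (b * c)"
    by (intro tendsto_diff tendsto_const bounded_linear.tendsto[OF state_bounded_linear[OF st]]
        tendsto_mult u(2))
  ultimately show "\<omega> (b * c) = \<omega> (F (- \<i>) * b)" using LIMSEQ_unique by fastforce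
qed

context
  fixes \<mu> assumes \<mu>: "\<mu> \<in> eigenmeasures A a \<beta>"
begin

lemma eigenmeasure_prob: "\<mu> \<in> prob_measures A"
  using \<mu> by (simp add: eigenmeasures_def)

definition integral_state :: "'a \<Rightarrow> complex" where
  "integral_state b = functional_of \<mu> (\<lambda>x. vector_state x b)"

lemma functional_of_nonneg:
  assumes f: "f \<in> cont_funs A" and nonneg: "\<And>x. x \<in> \<Lambda> \<Longrightarrow> f x \<in> \<real>\<^sub>\<ge>\<^sub>0"
  shows "functional_of \<mu> f \<in> \<real>\<^sub>\<ge>\<^sub>0"
proof -
  have "functional_of \<mu> f = functional_of \<mu> (\<lambda>x. of_real (Re (f x)))"
    using nonneg by (intro functional_of_cong[OF eigenmeasure_prob]) (simp add: complex_nonneg_Reals_iff complex_eq_iff)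
  also have "\<dots> = of_real (\<integral>x. Re (f x) \<partial>\<mu>)" unfolding functional_of_def by simp
  also have "\<dots> \<in> \<real>\<^sub>\<ge>\<^sub>0"
    unfolding nonneg_Reals_of_real_iff using nonneg by (intro Bochner_Integration.integral_nonneg)
      (simp add: prob_measures_space[OF eigenmeasure_prob] complex_nonneg_Reals_iff)
  finally show ?thesis .
qed

lemma integral_state_eq:
  "(\<And>x. x \<in> \<Lambda> \<Longrightarrow> vector_state x b = f x) \<Longrightarrow> integral_state b = functional_of \<mu> f"
  unfolding integral_state_def by (rule functional_of_cong[OF eigenmeasure_prob])

lemma integral_state_iota: "f \<in> cont_funs A \<Longrightarrow> integral_state (\<iota> f) = functional_of \<mu> f"
  using vector_state_iota[of _ f 1] by (intro integral_state_eq) (simp add: state_one[OF vector_state(1)])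

lemma integral_state_state: "state integral_state"
  unfolding state_def
proof (intro conjI allI)
  fix x y c
  show "integral_state (x + y) = integral_state x + integral_state y"
    unfolding integral_state_def functional_of_add[OF eigenmeasure_prob vector_state_cont_funs vector_state_cont_funs, symmetric]
    by (rule functional_of_cong[OF eigenmeasure_prob]) (rule state_add[OF vector_state(1)])
  show "integral_state (c *\<^sub>C x) = c * integral_state x"
    unfolding integral_state_def functional_of_scale[OF eigenmeasure_prob, symmetric]
    by (rule functional_of_cong[OF eigenmeasure_prob]) (rule state_scaleC[OF vector_state(1)])
  show "integral_state (adj x * x) \<in> \<real>\<^sub>\<ge>\<^sub>0"
    unfolding integral_state_def
    by (rule functional_of_nonneg[OF vector_state_cont_funs]) (use vector_state(1) in \<open>auto simp: state_def\<close>)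
  interpret prob_space \<mu> by (rule prob_measures_prob_space[OF eigenmeasure_prob])
  have "integral_state 1 = functional_of \<mu> (\<lambda>x. 1)"
    by (rule integral_state_eq) (rule state_one[OF vector_state(1)])
  then show "integral_state 1 = 1" by (simp add: functional_of_def prob_space)
qed

lemma integral_state_commute:
  assumes "f \<in> cont_funs A" shows "integral_state (b * \<iota> f) = integral_state (\<iota> f * b)"
  unfolding integral_state_def
  by (rule functional_of_cong[OF eigenmeasure_prob]) (simp add: vector_state_iota vector_state_iota_right assms)

lemma cocycle_minus_i: "cocycle (- \<i>) = \<iota> (\<lambda>x. exp (potential x))"
  by (simp add: cocycle_def)

lemma cocycle_commute: "integral_state (b * cocycle z) = integral_state (cocycle z * b)"
  unfolding cocycle_def by (rule integral_state_commute[OF cont_funs_cocycle])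

text \<open>This is the eigenvalue equation for \<open>f y = exp (- a y) E\<^sub>y (s\<^sub>i b)\<close>: the weight of the Ruelle
  operator cancels, and \<open>E\<^sub>i\<^sub>x (s\<^sub>i b) = E\<^sub>x (b s\<^sub>i)\<close>.\<close>

lemma integral_state_gen:
  assumes i: "i < d" shows "integral_state (b * s i) = integral_state (cocycle (- \<i>) * s i * b)"
proof -
  define f where "f y = of_real (exp (- a y)) * (indicator (cylinder [i]) y * vector_state y (s i * b))" for y
  have f: "f \<in> cont_funs A"
    unfolding f_def[abs_def] using a_cont
    by (intro cont_funs_mult cont_funs_of_real vector_state_cont_funs cont_funs_indicator continuous_intros)
  have "integral_state (b * s i) = functional_of \<mu> (ruelle_op A a f)"
  proof (rule integral_state_eq)
    fix x assume x: "x \<in> \<Lambda>"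
    have "ruelle_op A a f x = (\<Sum>k<d. if k = i then (if follows i (x 0)
        then vector_state (case_nat i x) (s i * b) else 0) else 0)"
      unfolding ruelle_op_branches[OF x]
      by (rule sum.cong)
        (auto simp: branch_def f_def indicator_def cylinder_def mult.assoc[symmetric] of_real_mult[symmetric]
          exp_add[symmetric] simp del: of_real_mult)
    also have "\<dots> = vector_state x (b * s i)" using i by (simp add: vector_state_gen[OF x i])
    finally show "vector_state x (b * s i) = ruelle_op A a f x" by simp
  qed
  also have "\<dots> = of_real (exp \<beta>) * functional_of \<mu> f"
    using \<mu> f unfolding eigenmeasures_def ruelle_adjoint_def by blast
  also have "\<dots> = functional_of \<mu> (\<lambda>x. of_real (exp \<beta>) * f x)"
    by (rule functional_of_scale[OF eigenmeasure_prob, symmetric])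
  also have "\<dots> = integral_state (cocycle (- \<i>) * s i * b)"
  proof (rule integral_state_eq[symmetric])
    fix x assume x: "x \<in> \<Lambda>"
    have "vector_state x (s i * b) = vector_state x (\<iota> (indicator (cylinder [i])) * (s i * b))"
      unfolding gen_proj[OF i, symmetric] using gen_partial[OF i] by (simp add: mult.assoc) (simp add: mult.assoc[symmetric])
    also have "\<dots> = indicator (cylinder [i]) x * vector_state x (s i * b)"
      by (rule vector_state_iota[OF x cont_funs_indicator])
    finally have ind: "indicator (cylinder [i]) x * vector_state x (s i * b) = vector_state x (s i * b)" by simp
    have "vector_state x (cocycle (- \<i>) * s i * b) = exp (potential x) * vector_state x (s i * b)"
      unfolding cocycle_minus_i mult.assoc by (rule vector_state_iota[OF x cont_funs_exp[OF cont_funs_potential]])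
    also have "exp (potential x) = of_real (exp \<beta>) * of_real (exp (- a x))"
      by (simp add: potential_def exp_of_real[symmetric] exp_diff exp_minus divide_inverse)
    finally show "vector_state x (cocycle (- \<i>) * s i * b) = of_real (exp \<beta>) * f x"
      unfolding f_def ind by (simp only: mult.assoc)
  qed
  finally show ?thesis .
qed

text \<open>Taking adjoints turns the claim into one about \<open>\<omega> (s\<^sub>i b\<^sup>*)\<close>. There \<open>s\<^sub>i\<close> is written as
  \<open>e\<^sup>\<beta>\<^sup>-\<^sup>a s\<^sub>i k\<close> with \<open>k = s\<^sub>i\<^sup>* e\<^sup>a\<^sup>-\<^sup>\<beta> s\<^sub>i \<in> C(\<Lambda>\<^sub>A)\<close>, to which the condition for \<open>s\<^sub>i\<close> applies.\<close>

lemma integral_state_gen_adj: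
  assumes i: "i < d" shows "integral_state (b * adj (s i)) = integral_state (adj (s i) * cocycle \<i> * b)"
proof -
  note st = integral_state_state
  let ?g = "\<lambda>x. exp (\<i> * \<i> * potential x)"
  have k: "adj (s i) * cocycle \<i> * s i = \<iota> (branch i ?g)"
    unfolding cocycle_def by (rule iota_branch[OF cont_funs_cocycle i])
  have p_comm: "(s i * adj (s i)) * cocycle \<i> = cocycle \<i> * (s i * adj (s i))"
    unfolding gen_proj[OF i] cocycle_def by (rule iota_commute[OF cont_funs_indicator cont_funs_cocycle])
  have inv: "cocycle (- \<i>) * cocycle \<i> = 1" using cocycle_plus[of "- \<i>" \<i>] by (simp add: cocycle_zero)
  have "cocycle (- \<i>) * s i * (adj (s i) * cocycle \<i> * s i) =
      cocycle (- \<i>) * ((s i * adj (s i)) * cocycle \<i>) * s i" by (simp only: mult.assoc)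
  also have "\<dots> = (cocycle (- \<i>) * cocycle \<i>) * (s i * (adj (s i) * s i))"
    unfolding p_comm by (simp only: mult.assoc)
  also have "\<dots> = s i" unfolding inv gen_partial[OF i] by simp
  finally have si: "s i = cocycle (- \<i>) * s i * \<iota> (branch i ?g)" unfolding k by simp
  have sk: "s i * \<iota> (branch i ?g) = cocycle \<i> * s i"
    unfolding cocycle_def by (rule iota_gen[OF cont_funs_cocycle i, symmetric])
  have "integral_state (s i * adj b) = integral_state (cocycle (- \<i>) * s i * (\<iota> (branch i ?g) * adj b))"
    using si by (metis mult.assoc)
  also have "\<dots> = integral_state (\<iota> (branch i ?g) * adj b * s i)" by (rule integral_state_gen[OF i, symmetric])
  also have "\<dots> = integral_state (\<iota> (branch i ?g) * (adj b * s i))" by (simp only: mult.assoc)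
  also have "\<dots> = integral_state (adj b * s i * \<iota> (branch i ?g))"
    by (rule integral_state_commute[symmetric]) (intro branch_cont_funs cont_funs_cocycle i)
  also have "\<dots> = integral_state (adj b * (cocycle \<i> * s i))" unfolding mult.assoc[of "adj b"] sk ..
  finally have "integral_state (adj (s i * adj b)) = integral_state (adj (adj b * (cocycle \<i> * s i)))"
    by (simp only: state_adj[OF st])
  then show ?thesis by (simp add: adj_mult adj_adj cocycle_adj mult.assoc)
qed

lemma integral_state_kms: "kms_state \<alpha> integral_state"
proof (rule kms_state_generators[OF integral_state_state])
  fix i assume i: "i < d"
  show "kms_analytic integral_state (\<lambda>z. cocycle z * s i)"
    unfolding kms_analytic_def
  proof (intro conjI allI entire_mult cocycle_entire entire_const strip_bounded_mult cocycle_strip_bounded strip_bounded_const)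
    fix t :: real and b
    let ?t = "complex_of_real t"
    have "integral_state (b * (cocycle ?t * s i)) = integral_state (b * cocycle ?t * s i)" by (simp only: mult.assoc)
    also have "\<dots> = integral_state (cocycle (- \<i>) * s i * (b * cocycle ?t))" by (rule integral_state_gen[OF i])
    also have "\<dots> = integral_state (cocycle (- \<i>) * s i * b * cocycle ?t)" by (simp only: mult.assoc)
    also have "\<dots> = integral_state (cocycle ?t * (cocycle (- \<i>) * s i * b))" by (rule cocycle_commute)
    also have "\<dots> = integral_state (cocycle (?t - \<i>) * s i * b)"
      using cocycle_plus[of ?t "- \<i>"] by (simp add: mult.assoc)
    finally show "integral_state (b * (cocycle ?t * s i)) = integral_state (cocycle (?t - \<i>) * s i * b)" .
  qed
  show "kms_analytic integral_state (\<lambda>z. adj (s i) * cocycle (- z))"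
    unfolding kms_analytic_def
  proof (intro conjI allI entire_mult cocycle_neg_entire entire_const strip_bounded_mult cocycle_strip_bounded strip_bounded_const)
    fix t :: real and b
    let ?t = "complex_of_real t"
    have "integral_state (b * (adj (s i) * cocycle (- ?t))) = integral_state (b * adj (s i) * cocycle (- ?t))"
      by (simp only: mult.assoc)
    also have "\<dots> = integral_state (cocycle (- ?t) * (b * adj (s i)))" by (rule cocycle_commute)
    also have "\<dots> = integral_state (cocycle (- ?t) * b * adj (s i))" by (simp only: mult.assoc)
    also have "\<dots> = integral_state (adj (s i) * cocycle \<i> * (cocycle (- ?t) * b))"
      by (rule integral_state_gen_adj[OF i])
    also have "\<dots> = integral_state (adj (s i) * cocycle (- (?t - \<i>)) * b)"
      using cocycle_plus[of \<i> "- ?t"] by (simp add: mult.assoc)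
    finally show "integral_state (b * (adj (s i) * cocycle (- ?t))) =
        integral_state (adj (s i) * cocycle (- (?t - \<i>)) * b)" .
  qed
qed

lemma eigenmeasure_restriction: "\<exists>\<omega>. kms_state \<alpha> \<omega> \<and> restriction A \<iota> \<omega> = \<mu>"
  using integral_state_kms
    restriction_eqI[OF integral_state_state eigenmeasure_prob integral_state_iota] by blast

end

lemma restriction_kms_states: "restriction A \<iota> ` {\<omega>. kms_state \<alpha> \<omega>} = eigenmeasures A a \<beta>"
proof (intro equalityI subsetI)
  fix \<mu> assume "\<mu> \<in> eigenmeasures A a \<beta>"
  from eigenmeasure_restriction[OF this]
  show "\<mu> \<in> restriction A \<iota> ` {\<omega>. kms_state \<alpha> \<omega>}" by blast
qed (auto intro: kms_restriction_eigenmeasure)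

end

theorem proposition7p6:
  fixes A :: "nat mat" and d :: nat
    and s :: "nat \<Rightarrow> 'a::unital_cstar_algebra"
    and \<iota> :: "((nat \<Rightarrow> nat) \<Rightarrow> complex) \<Rightarrow> 'a"
    and \<beta> :: real and a :: "(nat \<Rightarrow> nat) \<Rightarrow> real"
    and \<alpha> :: "real \<Rightarrow> 'a \<Rightarrow> 'a"
  assumes "0 < d" and "A \<in> carrier_mat d d" and "zero_one_mat A" and "aperiodic A"
    and "universal_cuntz_krieger A s"
    and "diagonal_identification A s \<iota>"
    and "continuous_on (shift_space A) a"
    and "is_flow A s \<iota> \<beta> a \<alpha>"
  shows "restriction A \<iota> ` {\<omega>. kms_state \<alpha> \<omega>} = eigenmeasures A a \<beta> \<and>
    (var0 A a < ln (spectral_radius (map_mat of_nat A)) \<longrightarrow>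
      bij_betw (restriction A \<iota>) {\<omega>. kms_state \<alpha> \<omega>} (eigenmeasures A a \<beta>))"
proof -
  interpret cuntz_krieger_flow A d s \<iota> \<beta> a \<alpha>
    by unfold_locales (use assms in auto)
  show ?thesis
  proof (intro conjI impI)
    show "restriction A \<iota> ` {\<omega>. kms_state \<alpha> \<omega>} = eigenmeasures A a \<beta>" by (rule restriction_kms_states)
    assume "var0 A a < ln (spectral_radius (map_mat of_nat A))"
    then have "inj_on (restriction A \<iota>) {\<omega>. kms_state \<alpha> \<omega>}"
      by (intro inj_onI) (use kms_unique in auto)
    then show "bij_betw (restriction A \<iota>) {\<omega>. kms_state \<alpha> \<omega>} (eigenmeasures A a \<beta>)"
      by (simp add: bij_betw_def restriction_kms_states)
  qed
qed

end
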